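(* With high probability, the random complex process $(\mathcal{H}_m(n))_m$ is not homologically connected until the moment when the last copy of $M$ disappears, and is homologically connected thereafter. This change happens at time $m=\frac{n^2}{6}\left(\log n+\frac12\log\log n+O(1)\right)$.
   Context: Consider the random $3$-uniform hypergraph process on vertex set $[n]$: starting with no edges, at each step a triple of vertices chosen uniformly at random among triples not yet present is added; after $m$ steps this is the uniform random hypergraph $H^3(n,m)$. Let $\mathcal{H}_m(n)$ be the $2$-complex consisting of all vertices of $[n]$, all triples of $H^3(n,m)$ (faces) and all pairs contained in some such triple (edges). The shadow graph is the graph on $[n]$ formed by the edges of the complex. A complex is homologically connected if its zero-th and first homology groups with coefficients in $\mathbb{F}_2$ vanish; equivalently, the shadow graph is connected and every $0$-$1$ function on edges that is $1$ on an even number of edges of each face is induced by a $0$-$1$ vertex function $g$ (value $1$ exactly on edges $uv$ with $g(u)\ne g(v)$). A copy of $M$ in a $2$-complex is a face with vertices $a,b,c$ such that the edges $ab$ and $ac$ lie in no other face, and there is a path of edges in the shadow graph between $a$ and $b$ not using the edges $ab$ or $ac$. "With high probability" means with probability tending to $1$ as $n\to\infty$; the $O(1)$ statement means that for every $\omega(n)\to\infty$, whp the change happens at a time $m$ with $\left|\frac{6m}{n^2}-\log n-\frac12\log\log n\right|\le\omega$. *)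

theory Defs
  imports
    "HOL-Probability.Probability"
    "HOL-Algebra.Elementary_Groups"
    "HOL-Library.Z2"
begin

text \<open>
  Simplicial homology with coefficients in the two-element field \<^typ>\<open>bit\<close>, for a complex given
  as its set of nonempty simplices (vertices being singletons). The empty simplex, of dimension
  \<open>-1\<close>, is added for the augmentation \<open>C\<^sub>0 \<rightarrow> C\<^bsub>-1\<^esub>\<close>, so the homology is reduced: its zero-th group
  vanishes iff the complex is connected.
\<close>

definition simplices :: "'a set set \<Rightarrow> int \<Rightarrow> 'a set set" where
  "simplices K p = {\<sigma> \<in> insert {} K. finite \<sigma> \<and> int (card \<sigma>) = p + 1}"

definition chain_group_F2 :: "'a set set \<Rightarrow> int \<Rightarrow> ('a set \<Rightarrow> bit) monoid" where
  "chain_group_F2 K p =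
     \<lparr>carrier = {c. \<forall>\<sigma>. \<sigma> \<notin> simplices K p \<longrightarrow> c \<sigma> = 0},
      monoid.mult = (\<lambda>c d \<sigma>. c \<sigma> + d \<sigma>),
      one = (\<lambda>_. 0)\<rparr>"

definition boundary_F2 :: "'a set set \<Rightarrow> int \<Rightarrow> ('a set \<Rightarrow> bit) \<Rightarrow> 'a set \<Rightarrow> bit" where
  "boundary_F2 K p c =
     (\<lambda>\<sigma>. if \<sigma> \<in> simplices K (p - 1) then \<Sum>\<tau> | \<tau> \<in> simplices K p \<and> \<sigma> \<subseteq> \<tau>. c \<tau> else 0)"

definition reduced_homology_F2 :: "'a set set \<Rightarrow> int \<Rightarrow> ('a set \<Rightarrow> bit) set monoid" where
  "reduced_homology_F2 K p =
     (chain_group_F2 K p)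
       \<lparr>carrier := kernel (chain_group_F2 K p) (chain_group_F2 K (p - 1)) (boundary_F2 K p)\<rparr>
     Mod (boundary_F2 K (p + 1) ` carrier (chain_group_F2 K (p + 1)))"

definition homologically_connected :: "'a set set \<Rightarrow> bool" where
  "homologically_connected K \<longleftrightarrow>
     trivial_group (reduced_homology_F2 K 0) \<and> trivial_group (reduced_homology_F2 K 1)"

definition shadow_edges :: "'a set set \<Rightarrow> 'a set set" where
  "shadow_edges K = {e \<in> K. card e = 2}"

definition copy_of_M :: "'a set set \<Rightarrow> 'a \<Rightarrow> 'a \<Rightarrow> 'a \<Rightarrow> bool" where
  "copy_of_M K a b c \<longleftrightarrow>
     distinct [a, b, c] \<and> {a, b, c} \<in> K \<and>
     (\<forall>f\<in>K. card f = 3 \<and> ({a, b} \<subseteq> f \<or> {a, c} \<subseteq> f) \<longrightarrow> f = {a, b, c}) \<and>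
     (a, b) \<in> {(u, v). {u, v} \<in> shadow_edges K - {{a, b}, {a, c}}}\<^sup>*"

definition triples :: "nat \<Rightarrow> nat set set" where
  "triples n = {t. t \<subseteq> {1..n} \<and> card t = 3}"

text \<open>
  The first \<open>m\<close> steps of the process, recorded as the list of triples in order of their arrival.
  Only \<open>m \<le> n choose 3\<close> is meaningful.
\<close>

primrec hypergraph_process :: "nat \<Rightarrow> nat \<Rightarrow> nat set list pmf" where
  "hypergraph_process n 0 = return_pmf []"
| "hypergraph_process n (Suc m) =
     bind_pmf (hypergraph_process n m)
       (\<lambda>ts. map_pmf (\<lambda>t. ts @ [t]) (pmf_of_set (triples n - set ts)))"

definition full_process :: "nat \<Rightarrow> nat set list pmf" where
  "full_process n = hypergraph_process n (n choose 3)"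

definition complex_of_triples :: "nat \<Rightarrow> nat set set \<Rightarrow> nat set set" where
  "complex_of_triples n T =
     {{v} | v. v \<in> {1..n}} \<union> {e. card e = 2 \<and> (\<exists>t\<in>T. e \<subseteq> t)} \<union> T"

definition complex_at :: "nat \<Rightarrow> nat set list \<Rightarrow> nat \<Rightarrow> nat set set" where
  "complex_at n ts m = complex_of_triples n (set (take m ts))"

text \<open>
  The \<open>LEAST\<close> is attained: \<^term>\<open>complex_at n ts\<close> is constant from time \<^term>\<open>length ts\<close> on, and the
  complex of all triples contains no copy of \<open>M\<close>.
\<close>

definition last_M_disappears :: "nat \<Rightarrow> nat set list \<Rightarrow> nat" where
  "last_M_disappears n ts =
     (LEAST m. \<forall>k\<ge>m. \<not> (\<exists>a b c. copy_of_M (complex_at n ts k) a b c))"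

end

theory Submission
  imports
    Defs
    "HOL-Real_Asymp.Real_Asymp"
begin

text \<open>
  By duality, nontrivial first homology yields a set \<open>S\<close> of edges meeting every face evenly that is
  not a cut. If \<open>S\<close> has minimal size \<open>k\<close>, then \<open>k = 2\<close> forces a copy of \<open>M\<close>, while for \<open>k \<ge> 3\<close> the edges of
  \<open>S\<close> are joined by a tree of \<open>k - 1\<close> faces and at least \<open>max (nk/3) (k(n-1-k))\<close> triples meeting \<open>S\<close>
  oddly are missing; a union bound over such trees excludes this for all \<open>m \<ge> n\<^sup>2 log n / 6\<close> at once.
  Hence from then on the complex is homologically connected exactly when it has no copy of \<open>M\<close>.

  Before that time the complex is never homologically connected: up to \<open>n\<close> faces there is an isolated
  vertex; up to about \<open>n log\<^sup>2 n\<close> faces almost all triples are edge-disjoint, so there are more cycles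
  than boundaries; afterwards every cut is crossed by at least two faces, which makes the path in the
  definition of \<open>M\<close> automatic, and the second moment method provides faces with two private edges
  that survive long enough. Inside the critical window no new copy of \<open>M\<close> is created, because the
  first of the \<open>2n - 5\<close> triples involved is equally likely to be each of them; so the last copy to
  disappear has been present throughout the window.
\<close>

section \<open>The process as a uniformly random order\<close>

text \<open>Homological connectedness is not monotone along the process: a new triple may bring new
  edges, and with them new cocycles or a new copy of \<open>M\<close>. Estimates at single times do
  not suffice, so an interval of times is covered by one event of the form: these triples are
  present at one end, those are absent at the other. Its probability is computed from positions in
  the random order, the triples not being independent.

  The two lower bounds on missing triples serve different k. With x = 6m/n^2 near log n, the trees
  on k pairs, weighted by their k - 1 present faces, amount to about n^2 (C log n)^(k-1). The bound
  k(n-1-k) gains about n^(-k), which wins for each fixed k >= 3 and just fails for k = 2, the case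
  of \<open>M\<close>; the bound nk/3 gains a smaller power n^(-ck), but for every k, and wins once
  k is large. The term (log log n)/2 makes n^2 x exp(-2x), the order of the expected number of faces
  with two private edges, bounded.\<close>

lemma finite_triples [simp]: "finite (triples n)"
  by (rule finite_subset[of _ "Pow {1..n}"]) (auto simp: triples_def)

lemma card_triples [simp]: "card (triples n) = n choose 3"
  using n_subsets[of "{1..n}" 3] by (simp add: triples_def)

lemma triples_diff_nonempty:
  assumes "length ts < n choose 3"
  shows "triples n - set ts \<noteq> {}"
proof
  assume "triples n - set ts = {}"
  then have "triples n \<subseteq> set ts" by blast
  then have "n choose 3 \<le> card (set ts)" using card_mono[of "set ts" "triples n"] by simp
  also have "\<dots> \<le> length ts" by (rule card_length)
  finally show False using assms by simp
qed

lemma set_hypergraph_process: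
  assumes "m \<le> n choose 3" "ts \<in> set_pmf (hypergraph_process n m)"
  shows "length ts = m \<and> distinct ts \<and> set ts \<subseteq> triples n"
  using assms
proof (induction m arbitrary: ts)
  case (Suc m)
  then obtain us t where us: "us \<in> set_pmf (hypergraph_process n m)"
    and t: "t \<in> set_pmf (pmf_of_set (triples n - set us))" and ts: "ts = us @ [t]"
    by auto
  have IH: "length us = m \<and> distinct us \<and> set us \<subseteq> triples n"
    using Suc us by auto
  have "triples n - set us \<noteq> {}"
    using IH Suc.prems by (intro triples_diff_nonempty) auto
  then have "t \<in> triples n - set us" using t by simp
  with IH ts show ?case by auto
qed auto

lemma set_full_process:
  assumes "ts \<in> set_pmf (full_process n)"
  shows "length ts = n choose 3" "distinct ts" "set ts = triples n"
proof -
  have *: "length ts = n choose 3 \<and> distinct ts \<and> set ts \<subseteq> triples n"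
    using set_hypergraph_process[of "n choose 3" n ts] assms by (simp add: full_process_def)
  then show "length ts = n choose 3" "distinct ts" by auto
  show "set ts = triples n"
    by (rule card_subset_eq) (use * distinct_card[of ts] in auto)
qed

text \<open>Each step is uniform on the complement of the past, and a permutation of the triples
  carries complements to complements. Arbitrary permutations of \<open>triples n\<close> are
  allowed, not only those induced by vertices; the later symmetry arguments swap two single
  triples.\<close>

lemma map_hypergraph_process:
  assumes "\<sigma> permutes triples n" "m \<le> n choose 3"
  shows "map_pmf (map \<sigma>) (hypergraph_process n m) = hypergraph_process n m"
  using assms(2)
proof (induction m)
  case (Suc m)
  have inj: "inj \<sigma>" using assms(1) by (rule permutes_inj)
  have "map_pmf (map \<sigma>) (hypergraph_process n (Suc m)) =
      bind_pmf (hypergraph_process n m)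
       (\<lambda>ts. map_pmf (\<lambda>t. map \<sigma> ts @ [t]) (map_pmf \<sigma> (pmf_of_set (triples n - set ts))))"
    by (simp add: map_bind_pmf map_pmf_comp)
  also have "\<dots> = bind_pmf (hypergraph_process n m)
       (\<lambda>ts. map_pmf (\<lambda>t. map \<sigma> ts @ [t]) (pmf_of_set (triples n - set (map \<sigma> ts))))"
  proof (rule bind_pmf_cong[OF refl])
    fix ts assume "ts \<in> set_pmf (hypergraph_process n m)"
    then have "length ts = m" using set_hypergraph_process[of m n ts] Suc.prems by auto
    then have "triples n - set ts \<noteq> {}" using Suc.prems by (intro triples_diff_nonempty) auto
    moreover have "\<sigma> ` (triples n - set ts) = triples n - set (map \<sigma> ts)"
      using image_set_diff[OF inj, of "triples n" "set ts"] permutes_image[OF assms(1)] by simp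
    ultimately have "map_pmf \<sigma> (pmf_of_set (triples n - set ts)) =
        pmf_of_set (triples n - set (map \<sigma> ts))"
      using map_pmf_of_set_inj[of \<sigma> "triples n - set ts"] inj by (simp add: inj_on_subset)
    then show "map_pmf (\<lambda>t. map \<sigma> ts @ [t]) (map_pmf \<sigma> (pmf_of_set (triples n - set ts))) =
       map_pmf (\<lambda>t. map \<sigma> ts @ [t]) (pmf_of_set (triples n - set (map \<sigma> ts)))" by simp
  qed
  also have "\<dots> = bind_pmf (map_pmf (map \<sigma>) (hypergraph_process n m))
       (\<lambda>ts. map_pmf (\<lambda>t. ts @ [t]) (pmf_of_set (triples n - set ts)))"
    by (simp add: bind_map_pmf)
  also have "\<dots> = hypergraph_process n (Suc m)"
    using Suc by simp
  finally show ?case .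
qed auto

lemma map_full_process:
  assumes "\<sigma> permutes triples n"
  shows "map_pmf (map \<sigma>) (full_process n) = full_process n"
  using map_hypergraph_process[OF assms] by (simp add: full_process_def)

abbreviation Pr :: "nat \<Rightarrow> nat set list set \<Rightarrow> real" where
  "Pr n S \<equiv> measure_pmf.prob (full_process n) S"

text \<open>Events are sets of arbitrary lists, but the process only yields enumerations of
  \<open>triples n\<close>; events need to be compared on those alone.\<close>

lemma Pr_mono_on_process:
  assumes "\<And>ts. \<lbrakk>length ts = n choose 3; distinct ts; set ts = triples n; ts \<in> S\<rbrakk> \<Longrightarrow> ts \<in> S'"
  shows "Pr n S \<le> Pr n S'"
proof -
  have "Pr n S = Pr n (S \<inter> set_pmf (full_process n))" by (simp add: measure_Int_set_pmf)
  also have "\<dots> \<le> Pr n S'"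
    by (rule measure_pmf.finite_measure_mono) (auto intro!: assms simp: set_full_process)
  finally show ?thesis .
qed

lemma Pr_cong_on_process:
  assumes "\<And>ts. \<lbrakk>length ts = n choose 3; distinct ts; set ts = triples n\<rbrakk> \<Longrightarrow> ts \<in> S \<longleftrightarrow> ts \<in> S'"
  shows "Pr n S = Pr n S'"
  by (intro antisym Pr_mono_on_process) (use assms in auto)

lemma Pr_union_bound:
  assumes "finite I" "\<And>i. i \<in> I \<Longrightarrow> Pr n (S i) \<le> b i"
  shows "Pr n {ts. \<exists>i\<in>I. ts \<in> S i} \<le> (\<Sum>i\<in>I. b i)"
proof -
  have "Pr n {ts. \<exists>i\<in>I. ts \<in> S i} = Pr n (\<Union>i\<in>I. S i)" by (rule arg_cong[of _ _ "Pr n"]) auto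
  also have "\<dots> \<le> (\<Sum>i\<in>I. Pr n (S i))"
    by (rule measure_pmf.finite_measure_subadditive_finite) (use assms in auto)
  also have "\<dots> \<le> (\<Sum>i\<in>I. b i)" by (rule sum_mono) (use assms in auto)
  finally show ?thesis .
qed

lemma Pr_disjoint_sum:
  assumes "finite I"
    and "\<And>ts i j. \<lbrakk>length ts = n choose 3; distinct ts; set ts = triples n; i \<in> I; j \<in> I;
           ts \<in> S i; ts \<in> S j\<rbrakk> \<Longrightarrow> i = j"
  shows "Pr n {ts. \<exists>i\<in>I. ts \<in> S i} = (\<Sum>i\<in>I. Pr n (S i))"
proof -
  let ?X = "set_pmf (full_process n)"
  have "(\<Sum>i\<in>I. Pr n (S i)) = (\<Sum>i\<in>I. Pr n (S i \<inter> ?X))" by (simp add: measure_Int_set_pmf)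
  also have "\<dots> = Pr n (\<Union>i\<in>I. S i \<inter> ?X)"
    by (rule measure_pmf.finite_measure_finite_Union[symmetric])
       (use assms set_full_process in \<open>fastforce simp: disjoint_family_on_def\<close>)+
  also have "(\<Union>i\<in>I. S i \<inter> ?X) = {ts. \<exists>i\<in>I. ts \<in> S i} \<inter> ?X" by auto
  also have "Pr n \<dots> = Pr n {ts. \<exists>i\<in>I. ts \<in> S i}" by (simp add: measure_Int_set_pmf)
  finally show ?thesis by simp
qed

section \<open>Positions of prescribed triples in the random order\<close>

lemma Pr_permute:
  assumes "\<sigma> permutes triples n"
  shows "Pr n S = Pr n {ts. map \<sigma> ts \<in> S}"
proof -
  have "Pr n S = measure_pmf.prob (map_pmf (map \<sigma>) (full_process n)) S"
    by (simp add: map_full_process[OF assms])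
  also have "\<dots> = Pr n (map \<sigma> -` S)" by simp
  finally show ?thesis by (simp add: vimage_def)
qed

text \<open>Induction on the prescribed positions: swapping \<open>x\<close> with another triple
  outside \<open>xs\<close> leaves the remaining prescriptions intact, so all candidates for
  position \<open>p\<close> are equally likely. The denominator is a falling factorial.\<close>

lemma Pr_positions:
  assumes "length ps = length xs" "distinct ps" "distinct xs"
    "set ps \<subseteq> {..<n choose 3}" "set xs \<subseteq> triples n"
  shows "Pr n {ts. map ((!) ts) ps = xs} = 1 / (\<Prod>j<length xs. real ((n choose 3) - j))"
  using assms
proof (induction ps xs rule: list_induct2)
  case Nil
  then show ?case by simp
next
  case (Cons p ps x xs)
  let ?N = "n choose 3" and ?U = "triples n"
  let ?S = "\<lambda>y. {ts. ts ! p = y \<and> map ((!) ts) ps = xs}"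
  have eq: "Pr n (?S y) = Pr n (?S x)" if y: "y \<in> ?U - set xs" for y
  proof -
    have perm: "Transposition.transpose x y permutes ?U" using y Cons.prems by (intro permutes_swap_id) auto
    have "Pr n (?S x) = Pr n {ts. map (Transposition.transpose x y) ts \<in> ?S x}" by (rule Pr_permute[OF perm])
    also have "\<dots> = Pr n (?S y)"
    proof (rule Pr_cong_on_process)
      fix ts :: "nat set list" assume ts: "length ts = ?N" "distinct ts" "set ts = ?U"
      have "map ((!) (map (Transposition.transpose x y) ts)) ps = map (Transposition.transpose x y) (map ((!) ts) ps)"
        using Cons.prems ts by auto
      also have "\<dots> = xs \<longleftrightarrow> map ((!) ts) ps = xs"
      proof -
        have fix_xs: "map (Transposition.transpose x y) xs = xs"
        proof (rule map_idI)
          fix z assume "z \<in> set xs"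
          then have "z \<noteq> x" "z \<noteq> y" using y Cons.prems by auto
          then show "Transposition.transpose x y z = z" by (rule transpose_apply_other)
        qed
        have "map (Transposition.transpose x y) (map (Transposition.transpose x y) zs) = zs" for zs :: "nat set list"
          by (simp add: comp_def)
        then show ?thesis using fix_xs by metis
      qed
      finally have "map ((!) (map (Transposition.transpose x y) ts)) ps = xs \<longleftrightarrow> map ((!) ts) ps = xs" .
      moreover have "map (Transposition.transpose x y) ts ! p = x \<longleftrightarrow> ts ! p = y"
        using Cons.prems ts(1) transpose_eq_iff[of x y "ts ! p" x] by (simp del: transpose_eq_iff) blast
      ultimately show "ts \<in> {ts. map (Transposition.transpose x y) ts \<in> ?S x} \<longleftrightarrow> ts \<in> ?S y" by auto
    qed
    finally show ?thesis by simp
  qed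
  have "Pr n {ts. map ((!) ts) ps = xs} = Pr n {ts. \<exists>y\<in>?U - set xs. ts \<in> ?S y}"
  proof (rule Pr_cong_on_process)
    fix ts :: "nat set list" assume ts: "length ts = ?N" "distinct ts" "set ts = ?U"
    have "ts ! p \<in> ?U - set xs" if "map ((!) ts) ps = xs"
    proof -
      have "ts ! p \<notin> set xs"
      proof
        assume "ts ! p \<in> set xs"
        then have "ts ! p \<in> (!) ts ` set ps" unfolding that[symmetric] by simp
        then obtain q where "q \<in> set ps" "ts ! p = ts ! q" by auto
        moreover have "p < length ts" "q < length ts" "p \<noteq> q"
          using calculation(1) Cons.prems ts by auto
        ultimately show False using ts nth_eq_iff_index_eq by metis
      qed
      moreover have "ts ! p \<in> ?U" using Cons.prems ts nth_mem[of p ts] by auto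
      ultimately show ?thesis by blast
    qed
    then show "ts \<in> {ts. map ((!) ts) ps = xs} \<longleftrightarrow> ts \<in> {ts. \<exists>y\<in>?U - set xs. ts \<in> ?S y}" by auto
  qed
  also have "\<dots> = (\<Sum>y\<in>?U - set xs. Pr n (?S y))" by (rule Pr_disjoint_sum) auto
  also have "\<dots> = (\<Sum>y\<in>?U - set xs. Pr n (?S x))" by (rule sum.cong) (use eq in auto)
  also have "\<dots> = real (?N - length xs) * Pr n (?S x)"
    using Cons.prems by (simp add: card_Diff_subset distinct_card)
  finally have *: "1 / (\<Prod>j<length xs. real (?N - j)) = real (?N - length xs) * Pr n (?S x)"
    using Cons by simp
  have "length (x # xs) \<le> ?N"
    using Cons.prems card_mono[of ?U "set (x # xs)"] distinct_card[of "x # xs"] by simp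
  then have "real (?N - length xs) > 0" by simp
  with * show ?case by (simp add: field_simps)
qed

lemma card_distinct_lists:
  assumes "finite A"
  shows "real (card {xs. length xs = k \<and> distinct xs \<and> set xs \<subseteq> A}) = (\<Prod>j<k. real (card A - j))"
proof (induction k)
  case 0
  have "{xs. xs = [] \<and> distinct xs \<and> set xs \<subseteq> A} = {[]}" by auto
  then show ?case by simp
next
  case (Suc k)
  let ?L = "\<lambda>k. {xs. length xs = k \<and> distinct xs \<and> set xs \<subseteq> A}"
  have fin: "finite (?L k)"
    by (rule finite_subset[OF _ finite_lists_length_eq[OF assms, of k]]) auto
  have "bij_betw (\<lambda>(xs, x). x # xs) (SIGMA xs:?L k. A - set xs) (?L (Suc k))"
    by (rule bij_betwI[where g = "\<lambda>ys. (tl ys, hd ys)"]) (auto simp: length_Suc_conv)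
  then have "card (?L (Suc k)) = card (SIGMA xs:?L k. A - set xs)" by (simp add: bij_betw_same_card)
  also have "\<dots> = (\<Sum>xs\<in>?L k. card (A - set xs))"
    using fin assms by (subst card_SigmaI) auto
  also have "\<dots> = (\<Sum>xs\<in>?L k. card A - k)"
    by (rule sum.cong) (auto simp: card_Diff_subset distinct_card)
  finally show ?case using Suc by simp
qed

text \<open>Distinct position lists give disjoint events, since indexing into a repetition-free list
  is injective. Probabilities thus reduce to counting admissible position lists.\<close>

lemma Pr_position_set:
  assumes "finite Q" "distinct xs" "set xs \<subseteq> triples n"
    and "\<And>ps. ps \<in> Q \<Longrightarrow> length ps = length xs \<and> distinct ps \<and> set ps \<subseteq> {..<n choose 3}"
  shows "Pr n {ts. \<exists>ps\<in>Q. map ((!) ts) ps = xs} =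
    real (card Q) / (\<Prod>j<length xs. real ((n choose 3) - j))"
proof -
  have "Pr n {ts. \<exists>ps\<in>Q. ts \<in> {ts. map ((!) ts) ps = xs}} = (\<Sum>ps\<in>Q. Pr n {ts. map ((!) ts) ps = xs})"
  proof (rule Pr_disjoint_sum)
    fix ts ps qs assume *: "length ts = n choose 3" "distinct ts" "ps \<in> Q" "qs \<in> Q"
      "ts \<in> {ts. map ((!) ts) ps = xs}" "ts \<in> {ts. map ((!) ts) qs = xs}"
    then have "map ((!) ts) ps = map ((!) ts) qs" by simp
    moreover have "inj_on ((!) ts) (set ps \<union> set qs)"
      using *(1-4) assms(4) by (intro inj_on_nth) (auto simp: subset_iff)
    ultimately show "ps = qs" by (simp add: inj_on_map_eq_map)
  qed (use assms in auto)
  also have "\<dots> = (\<Sum>ps\<in>Q. 1 / (\<Prod>j<length xs. real ((n choose 3) - j)))"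
    by (rule sum.cong) (use assms in \<open>auto intro!: Pr_positions\<close>)
  finally show ?thesis by simp
qed

section \<open>Presence and absence of given triples at given times\<close>

lemma mem_take_iff_position:
  "x \<in> set (take m ts) \<longleftrightarrow> (\<exists>i<m. i < length ts \<and> ts ! i = x)"
  by (auto simp: in_set_conv_nth)

lemma prod_lessThan_add:
  fixes f :: "nat \<Rightarrow> real"
  shows "(\<Prod>j<b + a. f j) = (\<Prod>j<b. f j) * (\<Prod>j<a. f (b + j))"
  by (induction a) (auto simp: algebra_simps)

text \<open>Sampling without replacement misses a set no more often than sampling with replacement:
  the factor 1 - m/(N-j) decreases in j. Once \<open>m + j\<close> exceeds \<open>N\<close>,
  truncated subtraction makes the numerator 0.\<close>

lemma prod_diff_ratio_le:
  assumes "b \<le> N" "m \<le> N"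
  shows "(\<Prod>j<b. real (N - m - j) / real (N - j)) \<le> (1 - real m / real N) ^ b"
proof -
  have "(\<Prod>j<b. real (N - m - j) / real (N - j)) \<le> (\<Prod>j<b. 1 - real m / real N)"
  proof (rule prod_mono, safe)
    fix j assume j: "j < b"
    then have *: "real (N - j) > 0" "real N > 0" using assms by auto
    show "0 \<le> real (N - m - j) / real (N - j)" by simp
    show "real (N - m - j) / real (N - j) \<le> 1 - real m / real N"
    proof (cases "m + j \<le> N")
      case True
      then have "real (N - m - j) = real N - real m - real j" "real (N - j) = real N - real j" by auto
      with * show ?thesis by (simp add: field_simps)
    next
      case False
      then show ?thesis using * assms by (simp add: field_simps)
    qed
  qed
  then show ?thesis by simp
qed

lemma prod_ratio_le:
  assumes "a \<le> R" "m \<le> R"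
  shows "(\<Prod>j<a. real (m - j) / real (R - j)) \<le> (real m / real R) ^ a"
proof -
  have "(\<Prod>j<a. real (m - j) / real (R - j)) \<le> (\<Prod>j<a. real m / real R)"
  proof (rule prod_mono, safe)
    fix j assume "j < a"
    then have j: "j < R" using assms by simp
    show "0 \<le> real (m - j) / real (R - j)" by simp
    show "real (m - j) / real (R - j) \<le> real m / real R"
    proof (cases "j \<le> m")
      case True
      have "real j * real m \<le> real j * real R" using assms by (simp add: mult_left_mono)
      then have "(real m - real j) * real R \<le> real m * (real R - real j)"
        by (simp add: algebra_simps)
      then show ?thesis using j True by (simp add: of_nat_diff divide_simps)
    qed auto
  qed
  then show ?thesis by simp
qed

text \<open>The positions of the elements of \<open>B\<close> are chosen before those of \<open>A\<close>.\<close>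

lemma Pr_present_absent_le:
  assumes "A \<subseteq> triples n" "B \<subseteq> triples n" "A \<inter> B = {}" "card B < n choose 3" "m \<le> n choose 3"
    "m' \<le> (n choose 3) - card B"
  shows "Pr n {ts. A \<subseteq> set (take m' ts) \<and> B \<inter> set (take m ts) = {}} \<le>
    (1 - real m / real (n choose 3)) ^ card B * (real m' / real ((n choose 3) - card B)) ^ card A"
proof -
  let ?N = "n choose 3"
  have fin: "finite A" "finite B" using assms finite_subset finite_triples by blast+
  obtain as bs where as: "distinct as" "set as = A" and bs: "distinct bs" "set bs = B"
    using fin finite_distinct_list by metis
  have len: "length as = card A" "length bs = card B" using as bs distinct_card by fastforce+
  \<comment> \<open>\<open>?QB\<close> and \<open>?QA\<close> hold the candidate position lists of
    \<open>B\<close> and \<open>A\<close>. Since \<open>m'\<close> may exceed \<open>m\<close>, the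
    two ranges can overlap, and the number of compatible pairs is only bounded from above by the
    product.\<close>
  let ?QB = "{ps. length ps = card B \<and> distinct ps \<and> set ps \<subseteq> {m..<?N}}"
  let ?QA = "{ps. length ps = card A \<and> distinct ps \<and> set ps \<subseteq> {..<m'}}"
  let ?Q = "{ps @ qs | ps qs. ps \<in> ?QB \<and> qs \<in> ?QA \<and> distinct (ps @ qs) \<and> set qs \<subseteq> {..<?N}}"
  have finQ: "finite ?QB" "finite ?QA"
    by (auto intro: finite_subset[OF _ finite_lists_length_eq[of "{m..<?N}" "card B"]]
         finite_subset[OF _ finite_lists_length_eq[of "{..<m'}" "card A"]])
  have sub: "?Q \<subseteq> (\<lambda>(ps, qs). ps @ qs) ` (?QB \<times> ?QA)" by auto
  then have finQ': "finite ?Q" using finQ by (meson finite_SigmaI finite_imageI finite_subset)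
  have "card ?Q \<le> card (?QB \<times> ?QA)"
    using surj_card_le[OF _ sub] finQ by simp
  then have "real (card ?Q) \<le> real (card ?QB) * real (card ?QA)"
    unfolding card_cartesian_product of_nat_mult[symmetric] of_nat_le_iff .
  also have "\<dots> = (\<Prod>j<card B. real (?N - m - j)) * (\<Prod>j<card A. real (m' - j))"
    by (subst (1 2) card_distinct_lists) auto
  finally have cardQ: "real (card ?Q) \<le>
      (\<Prod>j<card B. real (?N - m - j)) * (\<Prod>j<card A. real (m' - j))" .
  have "Pr n {ts. A \<subseteq> set (take m' ts) \<and> B \<inter> set (take m ts) = {}} \<le>
        Pr n {ts. \<exists>ps\<in>?Q. map ((!) ts) ps = bs @ as}"
  proof (rule Pr_mono_on_process)
    fix ts :: "nat set list"
    assume ts: "length ts = ?N" "distinct ts" "set ts = triples n"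
      "ts \<in> {ts. A \<subseteq> set (take m' ts) \<and> B \<inter> set (take m ts) = {}}"
    define pos where "pos x = (SOME i. i < ?N \<and> ts ! i = x)" for x
    have pos: "pos x < ?N" "ts ! pos x = x" if "x \<in> triples n" for x
    proof -
      have "x \<in> set ts" using that ts(3) by simp
      then have "\<exists>i. i < ?N \<and> ts ! i = x" using ts(1) by (auto simp: in_set_conv_nth)
      then have "pos x < ?N \<and> ts ! pos x = x" unfolding pos_def by (rule someI_ex)
      then show "pos x < ?N" "ts ! pos x = x" by auto
    qed
    have inj: "inj_on pos (triples n)" using pos by (metis inj_onI)
    have posA: "pos x < m'" if "x \<in> A" for x
    proof -
      have "x \<in> set (take m' ts)" using ts(4) that by blast
      then obtain i where i: "i < m'" "i < ?N" "ts ! i = x" 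
        using ts(1) unfolding mem_take_iff_position by auto
      have "x \<in> triples n" using that assms(1) by blast
      then have "pos x = i"
        using pos[of x] nth_eq_iff_index_eq[OF ts(2), of "pos x" i] ts(1) i by auto
      then show ?thesis using i by simp
    qed
    have posB: "pos x \<ge> m" if "x \<in> B" for x
    proof (rule ccontr)
      assume *: "\<not> pos x \<ge> m"
      have "x \<in> triples n" using that assms(2) by blast
      then have "x \<in> set (take m ts)"
        using pos[of x] * ts(1) unfolding mem_take_iff_position by (intro exI[of _ "pos x"]) auto
      with that ts(4) show False by blast
    qed
    have dist: "distinct (map pos (bs @ as))"
    proof -
      have "inj_on pos (set (bs @ as))"
        by (rule inj_on_subset[OF inj]) (use as bs assms(1,2) in auto)
      moreover have "distinct (bs @ as)" using as bs assms(3) by auto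
      ultimately show ?thesis by (simp only: distinct_map simp_thms)
    qed
    have "map pos bs \<in> ?QB"
    proof -
      have "set (map pos bs) \<subseteq> {m..<?N}" using posB pos(1) bs(2) assms(2) by auto
      then show ?thesis using dist len by (simp only: map_append distinct_append length_map mem_Collect_eq simp_thms)
    qed
    moreover have "map pos as \<in> ?QA"
    proof -
      have "set (map pos as) \<subseteq> {..<m'}" using posA as(2) by auto
      then show ?thesis using dist len by (simp only: map_append distinct_append length_map mem_Collect_eq simp_thms)
    qed
    moreover have "set (map pos as) \<subseteq> {..<?N}" using pos(1) as(2) assms(1) by auto
    ultimately have "map pos bs @ map pos as \<in> ?Q" using dist by (simp only: map_append) blast
    moreover have "map ((!) ts) (map pos bs @ map pos as) = bs @ as"
    proof -
      have "map ((!) ts) (map pos (bs @ as)) = bs @ as"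
        unfolding map_map by (rule map_idI) (use pos(2) as bs assms(1,2) in auto)
      then show ?thesis by simp
    qed
    ultimately show "ts \<in> {ts. \<exists>ps\<in>?Q. map ((!) ts) ps = bs @ as}" by blast
  qed
  also have "\<dots> = real (card ?Q) / (\<Prod>j<card B + card A. real (?N - j))"
  proof -
    have *: "distinct (bs @ as)" "set (bs @ as) \<subseteq> triples n" using as bs assms(1-3) by auto
    have **: "length ps = length (bs @ as) \<and> distinct ps \<and> set ps \<subseteq> {..<?N}" if "ps \<in> ?Q" for ps
      using that len by fastforce
    show ?thesis
      using Pr_position_set[OF finQ' *, OF **] unfolding length_append len .
  qed
  also have "\<dots> \<le> ((\<Prod>j<card B. real (?N - m - j)) * (\<Prod>j<card A. real (m' - j))) /
      (\<Prod>j<card B + card A. real (?N - j))"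
    by (rule divide_right_mono[OF cardQ]) (simp add: prod_nonneg)
  also have "(\<Prod>j<card B + card A. real (?N - j)) =
      (\<Prod>j<card B. real (?N - j)) * (\<Prod>j<card A. real (?N - card B - j))"
    by (simp add: prod_lessThan_add)
  also have "((\<Prod>j<card B. real (?N - m - j)) * (\<Prod>j<card A. real (m' - j))) / \<dots> =
      (\<Prod>j<card B. real (?N - m - j) / real (?N - j)) *
      (\<Prod>j<card A. real (m' - j) / real (?N - card B - j))"
    by (simp add: prod_dividef)
  also have "\<dots> \<le> (1 - real m / real ?N) ^ card B * (real m' / real (?N - card B)) ^ card A"
  proof (rule mult_mono)
    show "(\<Prod>j<card B. real (?N - m - j) / real (?N - j)) \<le> (1 - real m / real ?N) ^ card B"
      by (rule prod_diff_ratio_le) (use assms(4,5) in auto)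
    have "real m / real ?N \<le> 1" using assms(5) by (cases "?N = 0") (auto simp: divide_le_eq_1_pos simp del: binomial_eq_0_iff)
    then show "0 \<le> (1 - real m / real ?N) ^ card B" by simp
    have "card (A \<union> B) \<le> ?N"
      using card_mono[of "triples n" "A \<union> B"] assms(1,2) by simp
    then have "card A \<le> ?N - card B"
      using card_Un_disjoint[OF fin assms(3)] by linarith
    then show "(\<Prod>j<card A. real (m' - j) / real (?N - card B - j)) \<le> (real m' / real (?N - card B)) ^ card A"
      by (rule prod_ratio_le) (rule assms(6))
    show "0 \<le> (\<Prod>j<card A. real (m' - j) / real (?N - card B - j))" by (intro prod_nonneg) auto
  qed
  finally show ?thesis .
qed

lemma prod_diff_ratio_ge:
  assumes "m + b \<le> N" "a + b \<le> N" "0 < N - b"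
  shows "(1 - real m / real (N - b)) ^ b \<le> (\<Prod>j<b. real (N - m - j) / real (N - a - j))"
proof -
  have "(\<Prod>j<b. 1 - real m / real (N - b)) \<le> (\<Prod>j<b. real (N - m - j) / real (N - a - j))"
  proof (rule prod_mono, safe)
    fix j assume j: "j < b"
    have m: "real m \<le> real (N - b)" using assms by simp
    then show "0 \<le> 1 - real m / real (N - b)" using assms by (simp add: divide_le_eq_1)
    have "1 - real m / real (N - b) \<le> 1 - real m / real (N - j)"
      using assms j by (intro diff_mono divide_left_mono) auto
    also have "\<dots> = real (N - m - j) / real (N - j)"
      using assms j by (simp add: field_simps of_nat_diff)
    also have "\<dots> \<le> real (N - m - j) / real (N - a - j)"
      using assms j by (intro divide_left_mono) auto
    finally show "1 - real m / real (N - b) \<le> real (N - m - j) / real (N - a - j)" .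
  qed
  then show ?thesis by simp
qed

text \<open>Here \<open>m \<le> m'\<close> separates the two ranges of positions, so the count is
  exact; \<open>A\<close> is placed first. For two or more triples the factor (m-j)/(N-j) can drop
  below m/N, hence \<open>card A \<le> 1\<close>. The absence factors are bounded below through the
  smaller denominator \<open>N - card B\<close>.\<close>

lemma Pr_present_absent_ge:
  assumes "A \<subseteq> triples n" "B \<subseteq> triples n" "A \<inter> B = {}" "card A \<le> 1"
    "m \<le> m'" "m' + card B \<le> n choose 3" "card B + 1 \<le> n choose 3"
  shows "Pr n {ts. A \<subseteq> set (take m ts) \<and> B \<inter> set (take m' ts) = {}} \<ge>
    (real m / real (n choose 3)) ^ card A * (1 - real m' / real ((n choose 3) - card B)) ^ card B"
proof -
  let ?N = "n choose 3"
  have fin: "finite A" "finite B" using assms finite_subset finite_triples by blast+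
  obtain as bs where as: "distinct as" "set as = A" and bs: "distinct bs" "set bs = B"
    using fin finite_distinct_list by metis
  have len: "length as = card A" "length bs = card B" using as bs distinct_card by fastforce+
  define QB where "QB = {ps. length ps = card B \<and> distinct ps \<and> set ps \<subseteq> {m'..<?N}}"
  define QA where "QA = {ps. length ps = card A \<and> distinct ps \<and> set ps \<subseteq> {..<m}}"
  define Q where "Q = (\<lambda>(qs, ps). qs @ ps) ` (QA \<times> QB)"
  have finQ: "finite QB" "finite QA"
    unfolding QA_def QB_def
    by (auto intro: finite_subset[OF _ finite_lists_length_eq[of "{m'..<?N}" "card B"]]
         finite_subset[OF _ finite_lists_length_eq[of "{..<m}" "card A"]])
  then have finQ': "finite Q" unfolding Q_def by simp
  have "inj_on (\<lambda>(qs, ps). qs @ ps) (QA \<times> QB)"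
    by (auto simp: inj_on_def QA_def)
  then have "real (card Q) = real (card QA) * real (card QB)"
    unfolding Q_def by (simp add: card_image card_cartesian_product)
  also have "\<dots> = (\<Prod>j<card A. real (m - j)) * (\<Prod>j<card B. real (?N - m' - j))"
    unfolding QA_def QB_def by (subst (1 2) card_distinct_lists) auto
  finally have cardQ: "real (card Q) =
      (\<Prod>j<card A. real (m - j)) * (\<Prod>j<card B. real (?N - m' - j))" .
  have le: "(real m / real ?N) ^ card A * (1 - real m' / real (?N - card B)) ^ card B \<le>
      (\<Prod>j<card A. real (m - j) / real (?N - j)) * (\<Prod>j<card B. real (?N - m' - j) / real (?N - card A - j))"
  proof (rule mult_mono)
    show "(real m / real ?N) ^ card A \<le> (\<Prod>j<card A. real (m - j) / real (?N - j))"
    proof -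
      have "card A = 0 \<or> card A = 1" using assms(4) by linarith
      then show ?thesis by (auto simp del: card_0_eq card_eq_0_iff)
    qed
    show "(1 - real m' / real (?N - card B)) ^ card B \<le>
        (\<Prod>j<card B. real (?N - m' - j) / real (?N - card A - j))"
      by (rule prod_diff_ratio_ge) (use assms(4,6,7) in linarith)+
    have "real m' \<le> real (?N - card B)" using assms(6) by linarith
    then have "real m' / real (?N - card B) \<le> 1" using assms(7) by (simp add: divide_le_eq_1)
    then show "0 \<le> (1 - real m' / real (?N - card B)) ^ card B" by simp
    show "0 \<le> (\<Prod>j<card A. real (m - j) / real (?N - j))" by (intro prod_nonneg) auto
  qed
  also have "\<dots> = ((\<Prod>j<card A. real (m - j)) * (\<Prod>j<card B. real (?N - m' - j))) /
      ((\<Prod>j<card A. real (?N - j)) * (\<Prod>j<card B. real (?N - card A - j)))"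
    by (simp add: prod_dividef)
  also have "\<dots> = real (card Q) / (\<Prod>j<card A + card B. real (?N - j))"
    unfolding cardQ prod_lessThan_add by simp
  also have "\<dots> = Pr n {ts. \<exists>ps\<in>Q. map ((!) ts) ps = as @ bs}"
  proof -
    have *: "distinct (as @ bs)" "set (as @ bs) \<subseteq> triples n" using as bs assms(1-3) by auto
    have **: "length ps = length (as @ bs) \<and> distinct ps \<and> set ps \<subseteq> {..<?N}" if "ps \<in> Q" for ps
      using that len assms(5,6) unfolding Q_def QA_def QB_def by fastforce
    show ?thesis
      using Pr_position_set[OF finQ' *, OF **] unfolding length_append len by simp
  qed
  also have "\<dots> \<le> Pr n {ts. A \<subseteq> set (take m ts) \<and> B \<inter> set (take m' ts) = {}}"
  proof (rule Pr_mono_on_process)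
    fix ts :: "nat set list"
    assume ts: "length ts = ?N" "distinct ts" "ts \<in> {ts. \<exists>ps\<in>Q. map ((!) ts) ps = as @ bs}"
    then obtain qs ps where qs: "qs \<in> QA" and ps: "ps \<in> QB" and "map ((!) ts) (qs @ ps) = as @ bs"
      unfolding Q_def by auto
    then have m: "map ((!) ts) qs = as" "map ((!) ts) ps = bs"
      using len by (auto simp: QA_def append_eq_append_conv)
    have "A \<subseteq> set (take m ts)"
    proof
      fix x assume "x \<in> A"
      then obtain q where "q \<in> set qs" "x = ts ! q" using m as by auto
      then show "x \<in> set (take m ts)"
        using qs ts(1) assms(5,6) unfolding mem_take_iff_position QA_def by (intro exI[of _ q]) auto
    qed
    moreover have "x \<notin> set (take m' ts)" if "x \<in> B" for x
    proof
      assume "x \<in> set (take m' ts)"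
      then obtain i where i: "i < m'" "i < length ts" "ts ! i = x" by (auto simp: mem_take_iff_position)
      have "x \<in> set (map ((!) ts) ps)" unfolding m(2) bs(2) by (rule that)
      then obtain q where q: "q \<in> set ps" "x = ts ! q" by auto
      then have "m' \<le> q" "q < ?N" using ps unfolding QB_def by auto
      then show False using i q ts nth_eq_iff_index_eq[OF ts(2), of q i] by auto
    qed
    ultimately show "ts \<in> {ts. A \<subseteq> set (take m ts) \<and> B \<inter> set (take m' ts) = {}}" by blast
  qed
  finally show ?thesis .
qed

text \<open>By symmetry each of the \<open>card B + 1\<close> triples in \<open>insert t B\<close> is equally likely to come first.\<close>

lemma Pr_first_after_le:
  assumes "t \<in> triples n" "B \<subseteq> triples n" "t \<notin> B" "card B + 1 < n choose 3" "m \<le> n choose 3"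
  shows "Pr n {ts. \<exists>s. m \<le> s \<and> s < length ts \<and> ts ! s = t \<and> B \<inter> set (take s ts) = {}} \<le>
    (1 - real m / real (n choose 3)) ^ (card B + 1) / real (card B + 1)"
proof -
  let ?C = "insert t B"
  have fin: "finite B" using assms finite_subset finite_triples by blast
  have cardC: "card ?C = card B + 1" using fin assms by simp
  \<comment> \<open>Transposing \<open>t\<close> and \<open>e\<close> fixes \<open>?C\<close> as a
    set, so all \<open>G e\<close> have the same probability. They are disjoint, and each of them
    forces \<open>?C\<close> to miss the first \<open>m\<close> steps.\<close>
  define G where "G e = {ts :: nat set list. \<exists>s. m \<le> s \<and> s < length ts \<and> ts ! s = e \<and> ?C \<inter> set (take s ts) = {}}" for e
  have eq: "Pr n (G e) = Pr n (G t)" if e: "e \<in> ?C" for e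
  proof -
    let ?\<sigma> = "Transposition.transpose t e"
    have perm: "?\<sigma> permutes triples n" using e assms by (intro permutes_swap_id) auto
    have "?\<sigma> permutes ?C" using e by (intro permutes_swap_id) auto
    then have img: "?\<sigma> ` ?C = ?C" by (rule permutes_image)
    have inj: "inj ?\<sigma>" by simp
    have "Pr n (G e) = Pr n {ts. map ?\<sigma> ts \<in> G e}" by (rule Pr_permute[OF perm])
    also have "{ts. map ?\<sigma> ts \<in> G e} = G t"
    proof -
      have "?C \<inter> set (take s (map ?\<sigma> ts)) = {} \<longleftrightarrow> ?C \<inter> set (take s ts) = {}" for s ts
      proof -
        have "?C \<inter> set (take s (map ?\<sigma> ts)) = ?\<sigma> ` ?C \<inter> ?\<sigma> ` set (take s ts)"
          using img by (simp add: take_map)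
        also have "\<dots> = ?\<sigma> ` (?C \<inter> set (take s ts))" by (rule image_Int[OF inj, symmetric])
        finally show ?thesis by (simp only: image_is_empty)
      qed
      moreover have "?\<sigma> x = e \<longleftrightarrow> x = t" for x
        by (metis transpose_apply_first transpose_involutory)
      ultimately show ?thesis unfolding G_def by (auto simp del: insert_disjoint)
    qed
    finally show ?thesis .
  qed
  have "real (card B + 1) * Pr n (G t) = (\<Sum>e\<in>?C. Pr n (G e))"
    using sum.cong[OF refl eq, of ?C] cardC by (simp only: sum_constant)
  also have "\<dots> = Pr n {ts. \<exists>e\<in>?C. ts \<in> G e}"
  proof (rule Pr_disjoint_sum[symmetric])
    fix ts e f assume *: "distinct ts" "e \<in> ?C" "f \<in> ?C" "ts \<in> G e" "ts \<in> G f"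
    from *(4) obtain i where i: "i < length ts" "ts ! i = e" "?C \<inter> set (take i ts) = {}"
      unfolding G_def by blast
    from *(5) obtain j where j: "j < length ts" "ts ! j = f" "?C \<inter> set (take j ts) = {}"
      unfolding G_def by blast
    have "\<not> i < j" using i j *(2) mem_take_iff_position[of e j ts] by blast
    moreover have "\<not> j < i" using i j *(3) mem_take_iff_position[of f i ts] by blast
    ultimately have "i = j" by simp
    then show "e = f" using i j by simp
  qed (use fin in auto)
  also have "\<dots> \<le> Pr n {ts. {} \<subseteq> set (take 0 ts) \<and> ?C \<inter> set (take m ts) = {}}"
  proof (rule Pr_mono_on_process)
    fix ts assume "ts \<in> {ts. \<exists>e\<in>?C. ts \<in> G e}"
    then obtain s where "m \<le> s" "?C \<inter> set (take s ts) = {}" unfolding G_def by blast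
    then have "?C \<inter> set (take m ts) = {}" using set_take_subset_set_take[of m s ts] by blast
    then show "ts \<in> {ts. {} \<subseteq> set (take 0 ts) \<and> ?C \<inter> set (take m ts) = {}}" by simp
  qed
  also have "\<dots> \<le> (1 - real m / real (n choose 3)) ^ card ?C *
      (real 0 / real ((n choose 3) - card ?C)) ^ card ({} :: nat set set)"
    by (rule Pr_present_absent_le) (use assms cardC in auto)
  finally have "real (card B + 1) * Pr n (G t) \<le> (1 - real m / real (n choose 3)) ^ (card B + 1)"
    using cardC by simp
  then have "Pr n (G t) \<le> (1 - real m / real (n choose 3)) ^ (card B + 1) / real (card B + 1)"
    by (simp add: field_simps)
  moreover have "Pr n {ts. \<exists>s. m \<le> s \<and> s < length ts \<and> ts ! s = t \<and> B \<inter> set (take s ts) = {}} \<le> Pr n (G t)"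
  proof (rule Pr_mono_on_process)
    fix ts :: "nat set list" assume ts: "distinct ts"
      "ts \<in> {ts. \<exists>s. m \<le> s \<and> s < length ts \<and> ts ! s = t \<and> B \<inter> set (take s ts) = {}}"
    then obtain s where s: "m \<le> s" "s < length ts" "ts ! s = t" "B \<inter> set (take s ts) = {}" by blast
    have "t \<notin> set (take s ts)"
      using s nth_eq_iff_index_eq[OF ts(1)] unfolding mem_take_iff_position by (metis less_irrefl)
    with s show "ts \<in> G t" unfolding G_def by blast
  qed
  ultimately show ?thesis by linarith
qed

text \<open>Chebyshev for the number of events that occur. Pairs related by \<open>R\<close>
  contribute at most \<open>d\<close> times the mean to the second moment, all others at most
  \<open>r\<close> each. The bound vanishes when the mean outgrows \<open>d\<close> and r/q^2 tends
  to 1, that is, when unrelated events are asymptotically uncorrelated.\<close>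

lemma Pr_none_le_second_moment:
  fixes S :: "'i \<Rightarrow> nat set list set"
  assumes "finite I" "I \<noteq> {}" "q > 0" "r \<ge> 0"
    and low: "\<And>i. i \<in> I \<Longrightarrow> q \<le> Pr n (S i)"
    and close: "\<And>i. i \<in> I \<Longrightarrow> card {j\<in>I. R i j} \<le> d"
    and pair: "\<And>i j. \<lbrakk>i \<in> I; j \<in> I; \<not> R i j\<rbrakk> \<Longrightarrow> Pr n (S i \<inter> S j) \<le> r"
  shows "Pr n {ts. \<forall>i\<in>I. ts \<notin> S i} \<le> real d / (real (card I) * q) + r / q\<^sup>2 - 1"
proof -
  let ?E = "measure_pmf.expectation (full_process n)"
  define X where "X ts = (\<Sum>i\<in>I. indicator (S i) ts :: real)" for ts
  define \<mu> where "\<mu> = (\<Sum>i\<in>I. Pr n (S i))"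
  have card: "real (card I) > 0" using assms by (simp add: card_gt_0_iff)
  have \<mu>_ge: "\<mu> \<ge> real (card I) * q"
    unfolding \<mu>_def using sum_mono[of I "\<lambda>_. q" "\<lambda>i. Pr n (S i)"] low by simp
  have pos: "real (card I) * q > 0" using card assms(3) by simp
  have \<mu>_pos: "\<mu> > 0" using pos \<mu>_ge by linarith
  have EX: "?E X = \<mu>"
    unfolding X_def \<mu>_def by (subst Bochner_Integration.integral_sum) (auto intro!: measure_pmf.integrable_const_bound[where B = 1])
  have X2: "(X ts)\<^sup>2 = (\<Sum>i\<in>I. \<Sum>j\<in>I. indicator (S i \<inter> S j) ts)" for ts
    unfolding X_def power2_eq_square sum_product by (simp add: indicator_inter_arith)
  have int: "integrable (measure_pmf (full_process n)) (\<lambda>ts. (X ts)\<^sup>2)"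
    unfolding X2 by (intro Bochner_Integration.integrable_sum) (auto intro!: measure_pmf.integrable_const_bound[where B = 1])
  have EX2: "?E (\<lambda>ts. (X ts)\<^sup>2) = (\<Sum>i\<in>I. \<Sum>j\<in>I. Pr n (S i \<inter> S j))"
    unfolding X2
    by (subst Bochner_Integration.integral_sum; (subst Bochner_Integration.integral_sum)?)
       (auto intro!: measure_pmf.integrable_const_bound[where B = 1] Bochner_Integration.integrable_sum)
  have "(\<Sum>j\<in>I. Pr n (S i \<inter> S j)) \<le> real d * Pr n (S i) + real (card I) * r" if i: "i \<in> I" for i
  proof -
    have "(\<Sum>j\<in>I. Pr n (S i \<inter> S j)) \<le> (\<Sum>j\<in>I. (if R i j then Pr n (S i) else 0) + r)"
    proof (rule sum_mono)
      fix j assume j: "j \<in> I"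
      show "Pr n (S i \<inter> S j) \<le> (if R i j then Pr n (S i) else 0) + r"
      proof (cases "R i j")
        case True
        have "Pr n (S i \<inter> S j) \<le> Pr n (S i)" by (rule measure_pmf.finite_measure_mono) auto
        then show ?thesis using True assms(4) by simp
      qed (use pair i j in auto)
    qed
    also have "\<dots> = real (card {j\<in>I. R i j}) * Pr n (S i) + real (card I) * r"
      using assms(1) by (simp add: sum.distrib sum.If_cases Int_def)
    also have "\<dots> \<le> real d * Pr n (S i) + real (card I) * r"
      using close[OF i] by (intro add_right_mono mult_right_mono) auto
    finally show ?thesis .
  qed
  then have "?E (\<lambda>ts. (X ts)\<^sup>2) \<le> (\<Sum>i\<in>I. real d * Pr n (S i) + real (card I) * r)"
    unfolding EX2 by (rule sum_mono)
  also have "\<dots> = real d * \<mu> + (real (card I))\<^sup>2 * r"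
    unfolding \<mu>_def by (simp add: sum.distrib sum_distrib_left power2_eq_square)
  finally have EX2_le: "?E (\<lambda>ts. (X ts)\<^sup>2) \<le> real d * \<mu> + (real (card I))\<^sup>2 * r" .
  have "Pr n {ts. \<forall>i\<in>I. ts \<notin> S i} \<le> Pr n {ts\<in>space (measure_pmf (full_process n)). \<mu> \<le> \<bar>X ts - ?E X\<bar>}"
    by (rule measure_pmf.finite_measure_mono) (auto simp: EX X_def)
  also have "\<dots> \<le> measure_pmf.variance (full_process n) X / \<mu>\<^sup>2"
    by (rule measure_pmf.Chebyshev_inequality) (use int \<mu>_pos in auto)
  also have "measure_pmf.variance (full_process n) X = ?E (\<lambda>ts. (X ts)\<^sup>2) - \<mu>\<^sup>2"
  proof -
    have "integrable (measure_pmf (full_process n)) X"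
      unfolding X_def by (intro Bochner_Integration.integrable_sum) (auto intro!: measure_pmf.integrable_const_bound[where B = 1])
    then show ?thesis using measure_pmf.variance_eq[OF _ int] EX by simp
  qed
  also have "(?E (\<lambda>ts. (X ts)\<^sup>2) - \<mu>\<^sup>2) / \<mu>\<^sup>2 \<le> (real d * \<mu> + (real (card I))\<^sup>2 * r - \<mu>\<^sup>2) / \<mu>\<^sup>2"
    using EX2_le by (intro divide_right_mono) auto
  also have "\<dots> = real d / \<mu> + (real (card I))\<^sup>2 * r / \<mu>\<^sup>2 - 1"
    using \<mu>_pos by (simp add: field_simps power2_eq_square)
  also have "\<dots> \<le> real d / (real (card I) * q) + r / q\<^sup>2 - 1"
  proof -
    have "real d / \<mu> \<le> real d / (real (card I) * q)"
      using \<mu>_ge pos \<mu>_pos by (intro divide_left_mono) auto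
    moreover have "(real (card I))\<^sup>2 * r / \<mu>\<^sup>2 \<le> (real (card I))\<^sup>2 * r / (real (card I) * q)\<^sup>2"
      using \<mu>_ge pos \<mu>_pos assms(3,4) card by (intro divide_left_mono power_mono mult_pos_pos zero_less_power) auto
    moreover have "(real (card I))\<^sup>2 * r / (real (card I) * q)\<^sup>2 = r / q\<^sup>2"
      using card by (simp add: power_mult_distrib)
    ultimately show ?thesis by linarith
  qed
  finally show ?thesis .
qed

section \<open>Homology and cocycles\<close>

declare add_bit_eq_xor [simp del] mult_bit_eq_and [simp del]

lemma of_nat_bit_eq: "(of_nat k :: bit) = (if even k then 0 else 1)"
  by (induction k) auto

lemma bit_add_self [simp]: "(x :: bit) + x = 0"
  by (cases x) (auto simp: add_bit_eq_xor)

lemma bit_sum_indicator: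
  assumes "finite S"
  shows "(\<Sum>x\<in>S. (if P x then 1 else 0 :: bit)) = of_nat (card {x\<in>S. P x})"
  using assms by (simp add: sum.If_cases Int_def)

text \<open>A linear functional separates a vector from a subspace; over the two-element field a
  functional on functions with finite support is the sum over a set of coordinates.\<close>

lemma separating_coordinates:
  fixes W :: "('a \<Rightarrow> bit) set"
  assumes "finite X" "(\<lambda>_. 0) \<in> W"
    and "\<And>v w. \<lbrakk>v \<in> W; w \<in> W\<rbrakk> \<Longrightarrow> (\<lambda>x. v x + w x) \<in> W"
    and "\<And>w x. \<lbrakk>w \<in> W; x \<notin> X\<rbrakk> \<Longrightarrow> w x = 0"
    and "\<And>x. x \<notin> X \<Longrightarrow> z x = 0" "z \<notin> W"
  shows "\<exists>S\<subseteq>X. (\<forall>w\<in>W. (\<Sum>x\<in>S. w x) = 0) \<and> (\<Sum>x\<in>S. z x) = 1"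
  using assms
proof (induction X arbitrary: W z rule: finite_induct)
  case empty
  then have "z = (\<lambda>_. 0)" by auto
  with empty show ?case by simp
next
  case (insert x X)
  show ?case
  proof (cases "\<exists>w0\<in>W. w0 x = 1")
    case False
    then have W0: "w x = 0" if "w \<in> W" for w using that by (metis bit_not_one_iff)
    show ?thesis
    proof (cases "z x = 1")
      case True
      with W0 show ?thesis by (intro exI[of _ "{x}"]) auto
    next
      case False
      then have "z x = 0" by simp
      then have "\<exists>S\<subseteq>X. (\<forall>w\<in>W. (\<Sum>x\<in>S. w x) = 0) \<and> (\<Sum>x\<in>S. z x) = 1"
        using insert.prems W0 by (intro insert.IH) (metis insert_iff)+
      then show ?thesis by blast
    qed
  next
    case True
    then obtain w0 where w0: "w0 \<in> W" "w0 x = 1" by blast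
    \<comment> \<open>\<open>w0\<close> is a pivot for the coordinate \<open>x\<close>: adding it
      clears \<open>x\<close> in \<open>z\<close> without changing the class modulo
      \<open>W\<close>.\<close>
    define z' where "z' = (if z x = 1 then (\<lambda>y. z y + w0 y) else z)"
    have z'W: "z' \<notin> W"
    proof
      assume "z' \<in> W"
      then have "(\<lambda>y. z' y + (if z x = 1 then w0 y else 0)) \<in> W"
        using insert.prems(1,2) w0 by (cases "z x = 1") auto
      also have "(\<lambda>y. z' y + (if z x = 1 then w0 y else 0)) = z"
        by (auto simp: z'_def fun_eq_iff add.assoc)
      finally show False using insert.prems by simp
    qed
    have z'x: "z' x = 0" using w0 by (cases "z x = 1") (auto simp: z'_def)
    have z'X: "z' y = 0" if "y \<notin> X" for y
      using that z'x insert.prems(3,4) w0 by (cases "y = x") (auto simp: z'_def)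
    define W' where "W' = {w\<in>W. w x = 0}"
    have "\<exists>S\<subseteq>X. (\<forall>w\<in>W'. (\<Sum>x\<in>S. w x) = 0) \<and> (\<Sum>x\<in>S. z' x) = 1"
    proof (rule insert.IH)
      show "\<And>w y. \<lbrakk>w \<in> W'; y \<notin> X\<rbrakk> \<Longrightarrow> w y = 0"
        using insert.prems(3) unfolding W'_def by (metis (mono_tags) insert_iff mem_Collect_eq)
    qed (use insert.prems z'X z'W in \<open>auto simp: W'_def\<close>)
    then obtain S where S: "S \<subseteq> X" "\<And>w. w \<in> W' \<Longrightarrow> (\<Sum>x\<in>S. w x) = 0" "(\<Sum>x\<in>S. z' x) = 1" by blast
    define c where "c = (\<Sum>x\<in>S. w0 x)"
    \<comment> \<open>The functional found on \<open>X\<close> is extended so that it kills the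
      pivot: \<open>x\<close> joins \<open>S\<close> exactly when \<open>w0\<close> sums to 1 over
      \<open>S\<close>.\<close>
    define S' where "S' = (if c = 1 then insert x S else S)"
    have finS: "finite S" "x \<notin> S" using S(1) insert.hyps finite_subset by auto
    have sum_S': "(\<Sum>y\<in>S'. w y) = c * w x + (\<Sum>y\<in>S. w y)" for w :: "'a \<Rightarrow> bit"
      using finS by (cases c) (auto simp: S'_def)
    have W_zero: "(\<Sum>y\<in>S'. w y) = 0" if w: "w \<in> W" for w
    proof (cases "w x = 0")
      case True
      then show ?thesis using S(2)[of w] w by (simp add: sum_S' W'_def)
    next
      case False
      then have "w x = 1" by simp
      then have "(\<lambda>y. w y + w0 y) \<in> W'" using insert.prems w w0 by (auto simp: W'_def)
      then have "(\<Sum>y\<in>S. w y + w0 y) = 0" by (rule S(2))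
      then have "(\<Sum>y\<in>S. w y) + c = 0" by (simp add: sum.distrib c_def)
      then show ?thesis using \<open>w x = 1\<close> by (simp add: sum_S' add.commute)
    qed
    have "(\<Sum>y\<in>S'. z' y) = 1" using S(3) z'x by (simp add: sum_S')
    moreover have "(\<Sum>y\<in>S'. z' y) = (\<Sum>y\<in>S'. z y)"
      using W_zero[OF w0(1)] by (auto simp: z'_def sum.distrib)
    ultimately have "S' \<subseteq> insert x X \<and> (\<forall>w\<in>W. (\<Sum>x\<in>S'. w x) = 0) \<and> (\<Sum>x\<in>S'. z x) = 1"
      using S(1) W_zero by (auto simp: S'_def)
    then show ?thesis by blast
  qed
qed

lemma card_bit_functions:
  assumes "finite X"
  shows "finite {f :: 'b \<Rightarrow> bit. \<forall>x. x \<notin> X \<longrightarrow> f x = 0}"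
    "card {f :: 'b \<Rightarrow> bit. \<forall>x. x \<notin> X \<longrightarrow> f x = 0} = 2 ^ card X"
proof -
  have "bij_betw (\<lambda>f. {x. f x = (1 :: bit)}) {f. \<forall>x. x \<notin> X \<longrightarrow> f x = 0} (Pow X)"
    by (rule bij_betwI[where g = "\<lambda>S x. if x \<in> S then 1 else 0"]) (auto simp: fun_eq_iff)
  then show "finite {f :: 'b \<Rightarrow> bit. \<forall>x. x \<notin> X \<longrightarrow> f x = 0}"
    "card {f :: 'b \<Rightarrow> bit. \<forall>x. x \<notin> X \<longrightarrow> f x = 0} = 2 ^ card X"
    using assms bij_betw_finite bij_betw_same_card by (fastforce simp: card_Pow)+
qed

lemma comm_group_chain_group: "comm_group (chain_group_F2 K p)"
proof (rule comm_groupI)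
  fix x assume "x \<in> carrier (chain_group_F2 K p)"
  then show "\<exists>y\<in>carrier (chain_group_F2 K p). y \<otimes>\<^bsub>chain_group_F2 K p\<^esub> x = \<one>\<^bsub>chain_group_F2 K p\<^esub>"
    by (intro bexI[of _ x]) (auto simp: chain_group_F2_def)
qed (auto simp: chain_group_F2_def algebra_simps)

lemma boundary_hom: "boundary_F2 K p \<in> hom (chain_group_F2 K p) (chain_group_F2 K (p - 1))"
  by (auto simp: hom_def chain_group_F2_def boundary_F2_def fun_eq_iff sum.distrib)

text \<open>The hypothesis \<open>dd\<close> places the image inside the kernel, and commutativity
  makes it normal there. The quotient is trivial exactly when every coset of the image collapses to
  the image.\<close>

lemma trivial_reduced_homology_iff:
  assumes dd: "\<And>c. c \<in> carrier (chain_group_F2 K (p + 1)) \<Longrightarrow>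
    boundary_F2 K p (boundary_F2 K (p + 1) c) = (\<lambda>_. 0)"
  shows "trivial_group (reduced_homology_F2 K p) \<longleftrightarrow>
    (\<forall>z\<in>carrier (chain_group_F2 K p). boundary_F2 K p z = (\<lambda>_. 0) \<longrightarrow>
       z \<in> boundary_F2 K (p + 1) ` carrier (chain_group_F2 K (p + 1)))"
proof -
  let ?C = "chain_group_F2 K p" and ?C' = "chain_group_F2 K (p - 1)" and ?D = "chain_group_F2 K (p + 1)"
  let ?Z = "kernel ?C ?C' (boundary_F2 K p)" and ?I = "boundary_F2 K (p + 1) ` carrier ?D"
  let ?G = "?C\<lparr>carrier := ?Z\<rparr>"
  interpret C: comm_group ?C by (rule comm_group_chain_group)
  interpret C': comm_group ?C' by (rule comm_group_chain_group)
  interpret D: comm_group ?D by (rule comm_group_chain_group)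
  interpret h: group_hom ?C ?C' "boundary_F2 K p"
    by unfold_locales (rule boundary_hom)
  interpret h': group_hom ?D ?C "boundary_F2 K (p + 1)"
    by unfold_locales (use boundary_hom[of K "p + 1"] in simp)
  have Z: "?Z = {z\<in>carrier ?C. boundary_F2 K p z = (\<lambda>_. 0)}"
    by (auto simp: kernel_def chain_group_F2_def)
  have subZ: "subgroup ?Z ?C" by (rule h.subgroup_kernel)
  interpret G: comm_group ?G
    using C.submonoid_is_comm_monoid[OF subgroup.subgroup_is_submonoid[OF subZ]]
      C.subgroup_imp_group[OF subZ] by (rule comm_group.intro)
  have I_sub: "?I \<subseteq> ?Z" using dd h'.hom_closed by (auto simp: Z)
  have subI: "subgroup ?I ?G"
    using C.subgroup_incl[OF h'.img_is_subgroup subZ I_sub] by simp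
  then have norm: "?I \<lhd> ?G" by (rule G.subgroup_imp_normal)
  interpret N: normal ?I ?G by (rule norm)
  have eq: "reduced_homology_F2 K p = ?G Mod ?I" by (simp add: reduced_homology_F2_def)
  have car: "carrier (?G Mod ?I) = (\<lambda>z. ?I #>\<^bsub>?G\<^esub> z) ` ?Z"
    by (auto simp: FactGroup_def RCOSETS_def)
  have one: "\<one>\<^bsub>?G Mod ?I\<^esub> = ?I" by (simp add: FactGroup_def)
  have "trivial_group (?G Mod ?I) \<longleftrightarrow> (\<forall>z\<in>?Z. ?I #>\<^bsub>?G\<^esub> z = ?I)"
  proof -
    have "trivial_group (?G Mod ?I) \<longleftrightarrow> carrier (?G Mod ?I) = {?I}"
      unfolding trivial_group_def one using N.factorgroup_is_group by simp
    also have "\<dots> \<longleftrightarrow> (\<forall>z\<in>?Z. ?I #>\<^bsub>?G\<^esub> z = ?I)"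
      unfolding car using subgroup.one_closed[OF subZ] by auto
    finally show ?thesis .
  qed
  also have "\<dots> \<longleftrightarrow> (\<forall>z\<in>?Z. z \<in> ?I)"
  proof (rule ball_cong[OF refl])
    fix z assume "z \<in> ?Z"
    then have z: "z \<in> carrier ?G" by simp
    show "?I #>\<^bsub>?G\<^esub> z = ?I \<longleftrightarrow> z \<in> ?I"
      using G.coset_join1[OF _ z subI] G.coset_join2[OF z subI] I_sub by auto
  qed
  finally show ?thesis unfolding eq Z by auto
qed

section \<open>Chains, cycles and cocycles of the complex of a set of triples\<close>

definition covered_pairs :: "nat set set \<Rightarrow> nat set set" where
  "covered_pairs T = {e. card e = 2 \<and> (\<exists>t\<in>T. e \<subseteq> t)}"

definition vertex_sets :: "nat \<Rightarrow> nat set set" where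
  "vertex_sets n = (\<lambda>v. {v}) ` {1..n}"

text \<open>The boundary of a 1-chain, indexed by vertices instead of singletons: a degree modulo
  2.\<close>

definition edge_boundary :: "nat set set \<Rightarrow> (nat set \<Rightarrow> bit) \<Rightarrow> nat \<Rightarrow> bit" where
  "edge_boundary T z v = (\<Sum>e | e \<in> covered_pairs T \<and> v \<in> e. z e)"

definition edge_indicator :: "nat set \<Rightarrow> nat set \<Rightarrow> bit" where
  "edge_indicator e \<sigma> = (if \<sigma> = e then 1 else 0)"

text \<open>A 1-cochain over the two-element field is encoded by its support, so that addition of
  cochains becomes symmetric difference.\<close>

definition cocycle :: "nat set set \<Rightarrow> nat set set \<Rightarrow> bool" where
  "cocycle T S \<longleftrightarrow> S \<subseteq> covered_pairs T \<and> (\<forall>t\<in>T. even (card {e\<in>S. e \<subseteq> t}))"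

text \<open>The cut at \<open>A\<close>: an edge meets \<open>A\<close> oddly exactly when it has
  one end in \<open>A\<close>. The parity form is additive in \<open>A\<close>.\<close>

definition coboundary :: "nat set set \<Rightarrow> nat set \<Rightarrow> nat set set" where
  "coboundary T A = {e\<in>covered_pairs T. odd (card (e \<inter> A))}"

context
  fixes n :: nat and T :: "nat set set"
  assumes T: "T \<subseteq> triples n"
begin

lemma triple_facts: "t \<in> T \<Longrightarrow> card t = 3 \<and> finite t \<and> t \<subseteq> {1..n}"
  using T finite_subset[of t "{1..n}"] by (auto simp: triples_def)

lemma finite_T: "finite T"
  using T by (rule finite_subset) (auto simp: triples_def intro: finite_subset[of _ "Pow {1..n}"])

lemma covered_facts: "e \<in> covered_pairs T \<Longrightarrow> card e = 2 \<and> finite e \<and> e \<subseteq> {1..n}"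
  using triple_facts by (auto simp: covered_pairs_def intro: finite_subset)

lemma finite_covered: "finite (covered_pairs T)"
  by (rule finite_subset[of _ "Pow {1..n}"]) (use covered_facts in auto)

lemma simplices_2: "simplices (complex_of_triples n T) 2 = T"
  using triple_facts by (auto simp: simplices_def complex_of_triples_def)

lemma simplices_1: "simplices (complex_of_triples n T) 1 = covered_pairs T"
proof (rule Set.set_eqI)
  fix e
  have "e \<notin> T" if "card e = 2" using that triple_facts[of e] by auto
  moreover have "e \<in> covered_pairs T \<Longrightarrow> finite e" using covered_facts by simp
  moreover have "e \<in> covered_pairs T \<longleftrightarrow> card e = 2 \<and> (\<exists>t\<in>T. e \<subseteq> t)" by (simp add: covered_pairs_def)
  ultimately show "e \<in> simplices (complex_of_triples n T) 1 \<longleftrightarrow> e \<in> covered_pairs T"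
    by (auto simp: simplices_def complex_of_triples_def)
qed

lemma simplices_0: "simplices (complex_of_triples n T) 0 = vertex_sets n"
  using triple_facts by (auto simp: simplices_def complex_of_triples_def vertex_sets_def)

lemma simplices_minus_1: "simplices (complex_of_triples n T) (- 1) = {{}}"
  by (auto simp: simplices_def)

text \<open>After exchanging the sums, \<open>c \<tau>\<close> enters once for every simplex between
  \<sigma> and \<tau>, and \<open>ev\<close> says that their number is even.\<close>

lemma boundary_boundary:
  assumes "finite (simplices (complex_of_triples n T) p)" "finite (simplices (complex_of_triples n T) (p + 1))"
    and ev: "\<And>\<sigma> \<tau>. \<lbrakk>\<sigma> \<in> simplices (complex_of_triples n T) (p - 1); \<tau> \<in> simplices (complex_of_triples n T) (p + 1)\<rbrakk> \<Longrightarrow>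
           even (card {\<rho>\<in>simplices (complex_of_triples n T) p. \<sigma> \<subseteq> \<rho> \<and> \<rho> \<subseteq> \<tau>})"
  shows "boundary_F2 (complex_of_triples n T) p (boundary_F2 (complex_of_triples n T) (p + 1) c) = (\<lambda>_. 0)"
proof
  fix \<sigma>
  show "boundary_F2 (complex_of_triples n T) p (boundary_F2 (complex_of_triples n T) (p + 1) c) \<sigma> = 0"
  proof (cases "\<sigma> \<in> simplices (complex_of_triples n T) (p - 1)")
    case True
    have "boundary_F2 (complex_of_triples n T) p (boundary_F2 (complex_of_triples n T) (p + 1) c) \<sigma> =
        (\<Sum>\<rho> | \<rho> \<in> simplices (complex_of_triples n T) p \<and> \<sigma> \<subseteq> \<rho>. \<Sum>\<tau> | \<tau> \<in> simplices (complex_of_triples n T) (p + 1) \<and> \<rho> \<subseteq> \<tau>. c \<tau>)"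
      using True by (simp add: boundary_F2_def)
    also have "\<dots> = (\<Sum>\<tau> | \<tau> \<in> simplices (complex_of_triples n T) (p + 1). \<Sum>\<rho> | \<rho> \<in> {\<rho>\<in>simplices (complex_of_triples n T) p. \<sigma> \<subseteq> \<rho>} \<and> \<rho> \<subseteq> \<tau>. c \<tau>)"
      using sum.swap_restrict[of "{\<rho>\<in>simplices (complex_of_triples n T) p. \<sigma> \<subseteq> \<rho>}" "simplices (complex_of_triples n T) (p + 1)" "\<lambda>_ \<tau>. c \<tau>" "\<lambda>\<rho> \<tau>. \<rho> \<subseteq> \<tau>"] assms
      by simp
    also have "\<dots> = 0"
    proof (rule sum.neutral, safe)
      fix \<tau> assume "\<tau> \<in> simplices (complex_of_triples n T) (p + 1)"
      then have "(of_nat (card {\<rho>\<in>simplices (complex_of_triples n T) p. \<sigma> \<subseteq> \<rho> \<and> \<rho> \<subseteq> \<tau>}) :: bit) = 0"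
        using ev[OF True] by (simp add: of_nat_bit_eq)
      then show "(\<Sum>\<rho> | \<rho> \<in> {\<rho>\<in>simplices (complex_of_triples n T) p. \<sigma> \<subseteq> \<rho>} \<and> \<rho> \<subseteq> \<tau>. c \<tau>) = 0" by (simp add: conj_assoc)
    qed
    finally show ?thesis .
  qed (simp add: boundary_F2_def)
qed

lemma boundary_boundary_0: "boundary_F2 (complex_of_triples n T) 0 (boundary_F2 (complex_of_triples n T) 1 c) = (\<lambda>_. 0)"
proof -
  have "even (card {\<rho>\<in>vertex_sets n. \<sigma> \<subseteq> \<rho> \<and> \<rho> \<subseteq> \<tau>})" if "\<sigma> \<in> {{}}" "\<tau> \<in> covered_pairs T" for \<sigma> \<tau>
  proof -
    have "{\<rho>\<in>vertex_sets n. \<sigma> \<subseteq> \<rho> \<and> \<rho> \<subseteq> \<tau>} = (\<lambda>v. {v}) ` \<tau>"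
      using that covered_facts[of \<tau>] by (auto simp: vertex_sets_def)
    then show ?thesis using that covered_facts[of \<tau>] by (simp add: card_image)
  qed
  then show ?thesis
    using boundary_boundary[of 0 c] simplices_0 simplices_1 simplices_minus_1 finite_covered
    by (simp add: vertex_sets_def)
qed

lemma boundary_boundary_1: "boundary_F2 (complex_of_triples n T) 1 (boundary_F2 (complex_of_triples n T) 2 c) = (\<lambda>_. 0)"
proof -
  have "even (card {\<rho>\<in>covered_pairs T. \<sigma> \<subseteq> \<rho> \<and> \<rho> \<subseteq> \<tau>})" if st: "\<sigma> \<in> vertex_sets n" "\<tau> \<in> T" for \<sigma> \<tau>
  proof -
    obtain v where v: "\<sigma> = {v}" using st(1) unfolding vertex_sets_def by blast
    have t: "card \<tau> = 3" "finite \<tau>" using triple_facts st by auto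
    have "{\<rho>\<in>covered_pairs T. \<sigma> \<subseteq> \<rho> \<and> \<rho> \<subseteq> \<tau>} = (if v \<in> \<tau> then (\<lambda>w. {v, w}) ` (\<tau> - {v}) else {})"
    proof -
      have "{\<rho>\<in>covered_pairs T. {v} \<subseteq> \<rho> \<and> \<rho> \<subseteq> \<tau>} = (\<lambda>w. {v, w}) ` (\<tau> - {v})" if v\<tau>: "v \<in> \<tau>"
      proof (intro equalityI subsetI)
        fix \<rho> assume "\<rho> \<in> {\<rho>\<in>covered_pairs T. {v} \<subseteq> \<rho> \<and> \<rho> \<subseteq> \<tau>}"
        then have "card \<rho> = 2" "v \<in> \<rho>" "\<rho> \<subseteq> \<tau>" by (auto simp: covered_pairs_def)
        then obtain w where "\<rho> = {v, w}" "w \<noteq> v" by (auto simp: card_2_iff)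
        then show "\<rho> \<in> (\<lambda>w. {v, w}) ` (\<tau> - {v})" using \<open>\<rho> \<subseteq> \<tau>\<close> by auto
      next
        fix \<rho> assume "\<rho> \<in> (\<lambda>w. {v, w}) ` (\<tau> - {v})"
        then obtain w where "\<rho> = {v, w}" "w \<in> \<tau>" "w \<noteq> v" by auto
        then show "\<rho> \<in> {\<rho>\<in>covered_pairs T. {v} \<subseteq> \<rho> \<and> \<rho> \<subseteq> \<tau>}"
          using v\<tau> st by (auto simp: covered_pairs_def intro!: bexI[of _ \<tau>])
      qed
      then show ?thesis unfolding v by auto
    qed
    moreover have "card ((\<lambda>w. {v, w}) ` (\<tau> - {v})) = card (\<tau> - {v})"
      by (rule card_image) (auto simp: inj_on_def doubleton_eq_iff)
    ultimately show ?thesis using t by auto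
  qed
  then show ?thesis
    using boundary_boundary[of 1 c] simplices_0 simplices_1 simplices_2 finite_covered finite_T
    by simp
qed

lemma trivial_homology_0_iff:
  "trivial_group (reduced_homology_F2 (complex_of_triples n T) 0) \<longleftrightarrow>
    (\<forall>z. (\<forall>\<sigma>. \<sigma> \<notin> vertex_sets n \<longrightarrow> z \<sigma> = 0) \<longrightarrow> (\<Sum>\<sigma>\<in>vertex_sets n. z \<sigma>) = 0 \<longrightarrow>
       z \<in> boundary_F2 (complex_of_triples n T) 1 ` carrier (chain_group_F2 (complex_of_triples n T) 1))"
proof -
  have "boundary_F2 (complex_of_triples n T) 0 z = (\<lambda>_. 0) \<longleftrightarrow> (\<Sum>\<sigma>\<in>vertex_sets n. z \<sigma>) = 0" for z
    by (auto simp: boundary_F2_def simplices_0 simplices_minus_1 fun_eq_iff)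
  then show ?thesis
    using trivial_reduced_homology_iff[of "complex_of_triples n T" 0] boundary_boundary_0
    by (auto simp: chain_group_F2_def simplices_0)
qed

lemma trivial_homology_1_iff:
  "trivial_group (reduced_homology_F2 (complex_of_triples n T) 1) \<longleftrightarrow>
    (\<forall>z. (\<forall>e. e \<notin> covered_pairs T \<longrightarrow> z e = 0) \<longrightarrow> (\<forall>v\<in>{1..n}. edge_boundary T z v = 0) \<longrightarrow>
       z \<in> boundary_F2 (complex_of_triples n T) 2 ` carrier (chain_group_F2 (complex_of_triples n T) 2))"
proof -
  have "boundary_F2 (complex_of_triples n T) 1 z = (\<lambda>_. 0) \<longleftrightarrow> (\<forall>v\<in>{1..n}. edge_boundary T z v = 0)" for z
  proof -
    have "boundary_F2 (complex_of_triples n T) 1 z = (\<lambda>_. 0) \<longleftrightarrow> (\<forall>\<sigma>\<in>vertex_sets n. boundary_F2 (complex_of_triples n T) 1 z \<sigma> = 0)"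
      by (auto simp: boundary_F2_def simplices_0 fun_eq_iff)
    also have "\<dots> \<longleftrightarrow> (\<forall>v\<in>{1..n}. boundary_F2 (complex_of_triples n T) 1 z {v} = 0)"
      unfolding vertex_sets_def by blast
    also have "\<dots> \<longleftrightarrow> (\<forall>v\<in>{1..n}. edge_boundary T z v = 0)"
      by (rule ball_cong)
        (auto simp: boundary_F2_def simplices_0 simplices_1 vertex_sets_def edge_boundary_def)
    finally show ?thesis .
  qed
  then show ?thesis
    using trivial_reduced_homology_iff[of "complex_of_triples n T" 1] boundary_boundary_1
    by (auto simp: chain_group_F2_def simplices_1)
qed

text \<open>The chain {v} + {w} has augmentation 0, but no edge reaches \<open>v\<close>, so every
  boundary has coefficient 0 there.\<close>

lemma not_homology_0_if_isolated:
  assumes "v \<in> {1..n}" "w \<in> {1..n}" "v \<noteq> w" "\<And>t. t \<in> T \<Longrightarrow> v \<notin> t"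
  shows "\<not> trivial_group (reduced_homology_F2 (complex_of_triples n T) 0)"
proof
  assume triv: "trivial_group (reduced_homology_F2 (complex_of_triples n T) 0)"
  define z :: "nat set \<Rightarrow> bit" where "z \<sigma> = (if \<sigma> \<in> {{v}, {w}} then 1 else 0)" for \<sigma>
  have "(\<Sum>\<sigma>\<in>vertex_sets n. z \<sigma>) = of_nat (card {\<sigma>\<in>vertex_sets n. \<sigma> \<in> {{v}, {w}}})"
    unfolding z_def by (rule bit_sum_indicator) (simp add: vertex_sets_def)
  also have "{\<sigma>\<in>vertex_sets n. \<sigma> \<in> {{v}, {w}}} = {{v}, {w}}"
    using assms by (auto simp: vertex_sets_def)
  finally have "(\<Sum>\<sigma>\<in>vertex_sets n. z \<sigma>) = 0" using assms by simp
  moreover have "z \<sigma> = 0" if "\<sigma> \<notin> vertex_sets n" for \<sigma>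
    using that assms by (auto simp: z_def vertex_sets_def)
  ultimately obtain c where c: "z = boundary_F2 (complex_of_triples n T) 1 c"
    using triv unfolding trivial_homology_0_iff by blast
  have "{\<tau>. \<tau> \<in> covered_pairs T \<and> {v} \<subseteq> \<tau>} = {}"
    using assms(4) by (auto simp: covered_pairs_def)
  then have "z {v} = 0" unfolding c boundary_F2_def simplices_1 by (simp only: sum.empty if_cancel)
  then show False by (simp add: z_def)
qed

text \<open>Dimension count: at most \<open>2 ^ card T\<close> boundaries cannot exhaust the at least
  \<open>2 ^ (card (covered_pairs T) - n)\<close> cycles.\<close>

lemma not_homology_1_if_many_pairs:
  assumes "card (covered_pairs T) > card T + n"
  shows "\<not> trivial_group (reduced_homology_F2 (complex_of_triples n T) 1)"
proof
  assume triv: "trivial_group (reduced_homology_F2 (complex_of_triples n T) 1)"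
  let ?C1 = "{c :: nat set \<Rightarrow> bit. \<forall>\<sigma>. \<sigma> \<notin> covered_pairs T \<longrightarrow> c \<sigma> = 0}"
  let ?C2 = "{c :: nat set \<Rightarrow> bit. \<forall>\<sigma>. \<sigma> \<notin> T \<longrightarrow> c \<sigma> = 0}"
  let ?C0 = "{c :: nat \<Rightarrow> bit. \<forall>v. v \<notin> {1..n} \<longrightarrow> c v = 0}"
  let ?Z = "{c\<in>?C1. \<forall>v\<in>{1..n}. edge_boundary T c v = 0}"
  have fin2: "finite ?C2" "card ?C2 = 2 ^ card T" using card_bit_functions[OF finite_T] .
  have fin1: "finite ?C1" "card ?C1 = 2 ^ card (covered_pairs T)"
    using card_bit_functions[OF finite_covered] .
  have fin0: "finite ?C0" "card ?C0 = 2 ^ n"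
    using card_bit_functions[of "{1..n}"] by auto
  have "?Z \<subseteq> boundary_F2 (complex_of_triples n T) 2 ` ?C2"
    using triv unfolding trivial_homology_1_iff by (auto simp: chain_group_F2_def simplices_2)
  then have "card ?Z \<le> card (boundary_F2 (complex_of_triples n T) 2 ` ?C2)" by (rule card_mono[OF finite_imageI[OF fin2(1)]])
  also have "\<dots> \<le> 2 ^ card T" using card_image_le[OF fin2(1)] unfolding fin2(2) .
  finally have cardZ: "card ?Z \<le> 2 ^ card T" .
  \<comment> \<open>The boundary of 1-chains, set to 0 outside \<open>{1..n}\<close> so that its
    values lie among the \<open>2 ^ n\<close> elements of \<open>?C0\<close>.\<close>
  define d where "d c v = (if v \<in> {1..n} then edge_boundary T c v else 0)" for c v
  have fibre: "card {c\<in>?C1. d c = g} \<le> card ?Z" for g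
  proof (cases "{c\<in>?C1. d c = g} = {}")
    case True
    show ?thesis unfolding True by simp
  next
    case False
    then obtain c0 where c0: "c0 \<in> ?C1" "d c0 = g" by blast
    \<comment> \<open>Two chains with equal boundary differ by a cycle, so translation by
      \<open>c0\<close> embeds the fibre into \<open>?Z\<close>.\<close>
    have "(\<lambda>c \<sigma>. c \<sigma> + c0 \<sigma>) ` {c\<in>?C1. d c = g} \<subseteq> ?Z"
    proof (rule image_subsetI)
      fix c assume c: "c \<in> {c\<in>?C1. d c = g}"
      have "edge_boundary T (\<lambda>\<sigma>. c \<sigma> + c0 \<sigma>) v = 0" if v: "v \<in> {1..n}" for v
      proof -
        have "edge_boundary T (\<lambda>\<sigma>. c \<sigma> + c0 \<sigma>) v = edge_boundary T c v + edge_boundary T c0 v"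
          by (simp add: edge_boundary_def sum.distrib)
        moreover have "d c v = g v" "d c0 v = g v" using c c0(2) by auto
        then have "edge_boundary T c v = g v" "edge_boundary T c0 v = g v"
          using v by (simp_all add: d_def)
        ultimately show ?thesis by simp
      qed
      then show "(\<lambda>\<sigma>. c \<sigma> + c0 \<sigma>) \<in> ?Z" using c c0(1) by simp
    qed
    moreover have "inj_on (\<lambda>c \<sigma>. c \<sigma> + c0 \<sigma>) {c\<in>?C1. d c = g}"
      by (auto simp: inj_on_def fun_eq_iff)
    moreover have "finite ?Z" using fin1 by simp
    ultimately show ?thesis by (meson card_inj_on_le)
  qed
  have "?C1 = (\<Union>g\<in>?C0. {c\<in>?C1. d c = g})" by (auto simp: d_def)
  then have "card ?C1 \<le> (\<Sum>g\<in>?C0. card {c\<in>?C1. d c = g})"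
    using card_UN_le[OF fin0(1), of "\<lambda>g. {c\<in>?C1. d c = g}"] by argo
  also have "\<dots> \<le> (\<Sum>g\<in>?C0. card ?Z)" by (rule sum_mono) (rule fibre)
  also have "\<dots> \<le> 2 ^ n * 2 ^ card T" using fin0(2) cardZ by simp
  finally have "(2::nat) ^ card (covered_pairs T) \<le> 2 ^ (n + card T)" using fin1 by (simp add: power_add)
  then show False using assms by simp
qed

lemma edge_boundary_add: "edge_boundary T (\<lambda>\<sigma>. c \<sigma> + d \<sigma>) v = edge_boundary T c v + edge_boundary T d v"
  by (simp add: edge_boundary_def sum.distrib)

lemma edge_boundary_edge:
  assumes "e \<in> covered_pairs T"
  shows "edge_boundary T (edge_indicator e) v = (if v \<in> e then 1 else 0)"
proof -
  have "edge_boundary T (edge_indicator e) v = of_nat (card {x\<in>{e. e \<in> covered_pairs T \<and> v \<in> e}. x = e})"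
    unfolding edge_boundary_def edge_indicator_def by (rule bit_sum_indicator) (simp add: finite_covered)
  also have "{x\<in>{e. e \<in> covered_pairs T \<and> v \<in> e}. x = e} = (if v \<in> e then {e} else {})"
    using assms by auto
  finally show ?thesis by simp
qed

text \<open>The chain is the sum modulo 2 of the edges of the walk. Edges used twice cancel, and so
  do the two end terms when \<open>a = b\<close>.\<close>

lemma path_chain:
  assumes "F \<subseteq> covered_pairs T" "(a, b) \<in> {(u, v). {u, v} \<in> F}\<^sup>*"
  shows "\<exists>c. (\<forall>e. e \<notin> F \<longrightarrow> c e = 0) \<and>
    (\<forall>v. edge_boundary T c v = (if v = a then 1 else 0) + (if v = b then 1 else 0))"
  using assms(2)
proof (induction rule: rtrancl_induct)
  case base
  show ?case by (rule exI[of _ "\<lambda>_. 0"]) (auto simp: edge_boundary_def)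
next
  case (step u w)
  then obtain c where c: "\<forall>e. e \<notin> F \<longrightarrow> c e = 0"
    "\<forall>v. edge_boundary T c v = (if v = a then 1 else 0) + (if v = u then 1 else 0)" by blast
  have uw: "{u, w} \<in> F" using step by auto
  then have cov: "{u, w} \<in> covered_pairs T" using assms by auto
  then have "u \<noteq> w" using covered_facts[OF cov] by auto
  then have "edge_boundary T (\<lambda>\<sigma>. c \<sigma> + edge_indicator {u, w} \<sigma>) v =
      (if v = a then 1 else 0) + (if v = w then 1 else 0)" for v
    using c(2) by (auto simp: edge_boundary_add edge_boundary_edge[OF cov])
  moreover have "c e + edge_indicator {u, w} e = 0" if "e \<notin> F" for e
    using that uw c(1) by (auto simp: edge_indicator_def)
  ultimately show ?case by (intro exI[of _ "\<lambda>\<sigma>. c \<sigma> + edge_indicator {u, w} \<sigma>"]) blast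
qed

lemma shadow_edges_eq: "shadow_edges (complex_of_triples n T) = covered_pairs T"
  using triple_facts by (auto simp: shadow_edges_def complex_of_triples_def covered_pairs_def)

lemma faces_eq: "{f\<in>complex_of_triples n T. card f = 3} = T"
  using triple_facts by (auto simp: complex_of_triples_def)

lemma copy_of_M_iff:
  "copy_of_M (complex_of_triples n T) a b c \<longleftrightarrow> distinct [a, b, c] \<and> {a, b, c} \<in> T \<and>
     (\<forall>f\<in>T. {a, b} \<subseteq> f \<or> {a, c} \<subseteq> f \<longrightarrow> f = {a, b, c}) \<and>
     (a, b) \<in> {(u, v). {u, v} \<in> covered_pairs T - {{a, b}, {a, c}}}\<^sup>*"
proof -
  have abc: "{a, b, c} \<in> complex_of_triples n T \<longleftrightarrow> {a, b, c} \<in> T" if "distinct [a, b, c]"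
  proof -
    have "card {a, b, c} = 3" using that by simp
    then have "{a, b, c} \<in> complex_of_triples n T \<longleftrightarrow> {a, b, c} \<in> {f\<in>complex_of_triples n T. card f = 3}" by blast
    then show ?thesis unfolding faces_eq .
  qed
  have faces: "(\<forall>f\<in>complex_of_triples n T. card f = 3 \<and> P f \<longrightarrow> Q f) \<longleftrightarrow> (\<forall>f\<in>T. P f \<longrightarrow> Q f)" for P Q
    using faces_eq by blast
  show ?thesis unfolding copy_of_M_def shadow_edges_eq faces
    by (intro conj_cong refl) (rule abc)
qed

text \<open>Closing the path with the edge ab gives a cycle that contains ab but not ac. Every
  boundary has equal coefficients on ab and ac, because abc is the only face over either
  edge.\<close>

lemma not_homology_1_if_copy_of_M:
  assumes "copy_of_M (complex_of_triples n T) a b c"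
  shows "\<not> trivial_group (reduced_homology_F2 (complex_of_triples n T) 1)"
proof
  assume triv: "trivial_group (reduced_homology_F2 (complex_of_triples n T) 1)"
  have d: "distinct [a, b, c]" and abc: "{a, b, c} \<in> T"
    and only: "\<And>f. f \<in> T \<Longrightarrow> {a, b} \<subseteq> f \<or> {a, c} \<subseteq> f \<Longrightarrow> f = {a, b, c}"
    and path: "(a, b) \<in> {(u, v). {u, v} \<in> covered_pairs T - {{a, b}, {a, c}}}\<^sup>*"
    using assms[unfolded copy_of_M_iff] by blast+
  have ab: "{a, b} \<in> covered_pairs T" and ac: "{a, c} \<in> covered_pairs T"
    using d abc unfolding covered_pairs_def by (auto intro!: bexI[of _ "{a, b, c}"])
  obtain g where g: "\<forall>e. e \<notin> covered_pairs T - {{a, b}, {a, c}} \<longrightarrow> g e = 0"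
    "\<forall>v. edge_boundary T g v = (if v = a then 1 else 0) + (if v = b then 1 else 0)"
    using path_chain[OF _ path] by blast
  define z where "z = (\<lambda>\<sigma>. g \<sigma> + edge_indicator {a, b} \<sigma>)"
  have "edge_boundary T z v = 0" for v
    using d g(2) unfolding z_def by (auto simp: edge_boundary_add edge_boundary_edge[OF ab])
  moreover have "z e = 0" if "e \<notin> covered_pairs T" for e
    using that g(1) ab by (auto simp: z_def edge_indicator_def)
  ultimately obtain q where q: "z = boundary_F2 (complex_of_triples n T) 2 q"
    using triv[unfolded trivial_homology_1_iff, THEN spec, of z] by blast
  have "{t. t \<in> T \<and> {a, b} \<subseteq> t} = {{a, b, c}}" "{t. t \<in> T \<and> {a, c} \<subseteq> t} = {{a, b, c}}"
    using only abc by blast+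
  then have "z {a, b} = q {a, b, c}" "z {a, c} = q {a, b, c}"
    using ab ac unfolding q by (auto simp: boundary_F2_def simplices_1 simplices_2)
  moreover have "z {a, b} = 1" "z {a, c} = 0"
    using g(1) d by (auto simp: z_def edge_indicator_def doubleton_eq_iff)
  ultimately show False by simp
qed

text \<open>A 0-cycle that is not a boundary would be separated from the boundaries by a set
  \<open>A\<close> of vertices that no edge leaves. Then \<open>A\<close> is empty or everything,
  and either choice evaluates to 0 on a chain of augmentation 0.\<close>

lemma homology_0_if_cuts:
  assumes "\<And>A. \<lbrakk>A \<subseteq> {1..n}; A \<noteq> {}; A \<noteq> {1..n}\<rbrakk> \<Longrightarrow> coboundary T A \<noteq> {}"
  shows "trivial_group (reduced_homology_F2 (complex_of_triples n T) 0)"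
  unfolding trivial_homology_0_iff
proof (intro allI impI)
  fix z :: "nat set \<Rightarrow> bit"
  assume z: "\<forall>\<sigma>. \<sigma> \<notin> vertex_sets n \<longrightarrow> z \<sigma> = 0" "(\<Sum>\<sigma>\<in>vertex_sets n. z \<sigma>) = 0"
  let ?W = "boundary_F2 (complex_of_triples n T) 1 ` carrier (chain_group_F2 (complex_of_triples n T) 1)"
  have inj: "inj_on (\<lambda>v. {v}) X" for X :: "nat set" by (simp add: inj_on_def)
  show "z \<in> ?W"
  proof (rule ccontr)
    assume "z \<notin> ?W"
    have "\<exists>S\<subseteq>vertex_sets n. (\<forall>w\<in>?W. (\<Sum>x\<in>S. w x) = 0) \<and> (\<Sum>x\<in>S. z x) = 1"
    proof (rule separating_coordinates)
      show "(\<lambda>_. 0) \<in> ?W"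
        by (rule image_eqI[of _ _ "\<lambda>_. 0"]) (auto simp: boundary_F2_def chain_group_F2_def)
      fix v w assume "v \<in> ?W" "w \<in> ?W"
      then obtain c d where "c \<in> carrier (chain_group_F2 (complex_of_triples n T) 1)" "v = boundary_F2 (complex_of_triples n T) 1 c"
        "d \<in> carrier (chain_group_F2 (complex_of_triples n T) 1)" "w = boundary_F2 (complex_of_triples n T) 1 d" by blast
      then show "(\<lambda>x. v x + w x) \<in> ?W"
        by (intro image_eqI[of _ _ "\<lambda>x. c x + d x"])
          (auto simp: boundary_F2_def chain_group_F2_def sum.distrib fun_eq_iff)
    next
      fix w x assume "w \<in> ?W" "x \<notin> vertex_sets n"
      then show "w x = 0" by (auto simp: boundary_F2_def simplices_0)
    qed (use z \<open>z \<notin> ?W\<close> in \<open>auto simp: vertex_sets_def\<close>)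
    then obtain S where S: "S \<subseteq> vertex_sets n" "\<And>w. w \<in> ?W \<Longrightarrow> (\<Sum>x\<in>S. w x) = 0" "(\<Sum>x\<in>S. z x) = 1"
      by blast
    define A where "A = {v\<in>{1..n}. {v} \<in> S}"
    have S_eq: "S = (\<lambda>v. {v}) ` A" using S(1) by (auto simp: A_def vertex_sets_def)
    have "coboundary T A = {}"
    proof (rule ccontr)
      assume "coboundary T A \<noteq> {}"
      then obtain e where e: "e \<in> covered_pairs T" "odd (card (e \<inter> A))" by (auto simp: coboundary_def)
      have "edge_indicator e \<in> carrier (chain_group_F2 (complex_of_triples n T) 1)"
        using e by (auto simp: chain_group_F2_def simplices_1 edge_indicator_def)
      then have "0 = (\<Sum>x\<in>S. boundary_F2 (complex_of_triples n T) 1 (edge_indicator e) x)" using S(2) by fastforce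
      also have "\<dots> = (\<Sum>v\<in>A. boundary_F2 (complex_of_triples n T) 1 (edge_indicator e) {v})"
        unfolding S_eq by (simp add: sum.reindex[OF inj])
      also have "\<dots> = (\<Sum>v\<in>A. if v \<in> e then 1 else 0)"
      proof (rule sum.cong[OF refl])
        fix v assume "v \<in> A"
        then have "{v} \<in> simplices (complex_of_triples n T) 0" by (auto simp: A_def simplices_0 vertex_sets_def)
        then have "boundary_F2 (complex_of_triples n T) 1 (edge_indicator e) {v} = edge_boundary T (edge_indicator e) v"
          by (simp add: boundary_F2_def simplices_1 edge_boundary_def)
        then show "boundary_F2 (complex_of_triples n T) 1 (edge_indicator e) {v} = (if v \<in> e then 1 else 0)"
          using edge_boundary_edge[OF e(1)] by simp
      qed
      also have "\<dots> = of_nat (card {v\<in>A. v \<in> e})" by (rule bit_sum_indicator) (simp add: A_def)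
      also have "{v\<in>A. v \<in> e} = e \<inter> A" by auto
      finally show False using e(2) by (simp add: of_nat_bit_eq)
    qed
    moreover have "A \<subseteq> {1..n}" by (auto simp: A_def)
    ultimately have "A = {} \<or> A = {1..n}" using assms by blast
    then have "S = {} \<or> S = vertex_sets n" unfolding S_eq vertex_sets_def by auto
    then show False using S(3) z(2) by auto
  qed
qed

text \<open>The functional separating a cycle from the boundaries is a set \<open>S\<close> of
  edges. Vanishing on boundaries of faces makes it a cocycle; its value 1 on the cycle excludes
  coboundaries, which vanish on all cycles.\<close>

lemma noncoboundary_cocycle_exists:
  assumes "\<not> trivial_group (reduced_homology_F2 (complex_of_triples n T) 1)"
  shows "\<exists>S. cocycle T S \<and> (\<forall>A. S \<noteq> coboundary T A)"
proof -
  let ?W = "boundary_F2 (complex_of_triples n T) 2 ` carrier (chain_group_F2 (complex_of_triples n T) 2)"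
  obtain z where z: "\<forall>e. e \<notin> covered_pairs T \<longrightarrow> z e = 0" "\<forall>v\<in>{1..n}. edge_boundary T z v = 0" "z \<notin> ?W"
    using assms unfolding trivial_homology_1_iff by blast
  have "\<exists>S\<subseteq>covered_pairs T. (\<forall>w\<in>?W. (\<Sum>x\<in>S. w x) = 0) \<and> (\<Sum>x\<in>S. z x) = 1"
  proof (rule separating_coordinates)
    show "(\<lambda>_. 0) \<in> ?W"
      by (rule image_eqI[of _ _ "\<lambda>_. 0"]) (auto simp: boundary_F2_def chain_group_F2_def)
    fix v w assume "v \<in> ?W" "w \<in> ?W"
    then obtain c d where "c \<in> carrier (chain_group_F2 (complex_of_triples n T) 2)" "v = boundary_F2 (complex_of_triples n T) 2 c"
      "d \<in> carrier (chain_group_F2 (complex_of_triples n T) 2)" "w = boundary_F2 (complex_of_triples n T) 2 d" by blast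
    then show "(\<lambda>x. v x + w x) \<in> ?W"
      by (intro image_eqI[of _ _ "\<lambda>x. c x + d x"])
        (auto simp: boundary_F2_def chain_group_F2_def sum.distrib fun_eq_iff)
  next
    fix w x assume "w \<in> ?W" "x \<notin> covered_pairs T"
    then show "w x = 0" by (auto simp: boundary_F2_def simplices_1)
  qed (use z finite_covered in auto)
  then obtain S where S: "S \<subseteq> covered_pairs T" "\<And>w. w \<in> ?W \<Longrightarrow> (\<Sum>x\<in>S. w x) = 0" "(\<Sum>x\<in>S. z x) = 1"
    by blast
  have finS: "finite S" using S(1) finite_covered finite_subset by blast
  have "even (card {e\<in>S. e \<subseteq> t})" if t: "t \<in> T" for t
  proof -
    have "edge_indicator t \<in> carrier (chain_group_F2 (complex_of_triples n T) 2)"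
      using t by (auto simp: chain_group_F2_def simplices_2 edge_indicator_def)
    then have "0 = (\<Sum>e\<in>S. boundary_F2 (complex_of_triples n T) 2 (edge_indicator t) e)" using S(2) by fastforce
    also have "\<dots> = (\<Sum>e\<in>S. if e \<subseteq> t then 1 else 0)"
    proof (rule sum.cong[OF refl])
      fix e assume "e \<in> S"
      then have e: "e \<in> simplices (complex_of_triples n T) 1" using S(1) by (auto simp: simplices_1)
      have "boundary_F2 (complex_of_triples n T) 2 (edge_indicator t) e =
          of_nat (card {x\<in>{\<tau>. \<tau> \<in> T \<and> e \<subseteq> \<tau>}. x = t})"
        using e finite_T by (subst bit_sum_indicator[symmetric]) (auto simp: boundary_F2_def simplices_2 edge_indicator_def)
      also have "{x\<in>{\<tau>. \<tau> \<in> T \<and> e \<subseteq> \<tau>}. x = t} = (if e \<subseteq> t then {t} else {})" using t by auto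
      finally show "boundary_F2 (complex_of_triples n T) 2 (edge_indicator t) e = (if e \<subseteq> t then 1 else 0)" by simp
    qed
    also have "\<dots> = of_nat (card {e\<in>S. e \<subseteq> t})" by (rule bit_sum_indicator[OF finS])
    finally show ?thesis by (simp add: of_nat_bit_eq split: if_splits)
  qed
  then have "cocycle T S" using S(1) by (simp add: cocycle_def)
  moreover have "S \<noteq> coboundary T A" for A
  proof
    assume S_eq: "S = coboundary T A"
    \<comment> \<open>Adding up the vanishing degrees over \<open>A\<close> counts each edge as
      often as it has ends in \<open>A\<close>; modulo 2 only the cut remains.\<close>
    have "0 = (\<Sum>v\<in>A \<inter> {1..n}. edge_boundary T z v)" using z(2) by (intro sum.neutral[symmetric]) auto
    also have "\<dots> = (\<Sum>e\<in>covered_pairs T. \<Sum>v | v \<in> A \<inter> {1..n} \<and> v \<in> e. z e)"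
      unfolding edge_boundary_def
      using sum.swap_restrict[of "A \<inter> {1..n}" "covered_pairs T" "\<lambda>_ e. z e" "\<lambda>v e. v \<in> e"] finite_covered
      by simp
    also have "\<dots> = (\<Sum>e\<in>covered_pairs T. if odd (card (e \<inter> A)) then z e else 0)"
    proof (rule sum.cong[OF refl])
      fix e assume "e \<in> covered_pairs T"
      then have "{v. v \<in> A \<inter> {1..n} \<and> v \<in> e} = e \<inter> A" using covered_facts by blast
      then show "(\<Sum>v | v \<in> A \<inter> {1..n} \<and> v \<in> e. z e) = (if odd (card (e \<inter> A)) then z e else 0)"
        by (simp add: of_nat_bit_eq)
    qed
    also have "\<dots> = (\<Sum>e\<in>S. z e)"
      unfolding S_eq coboundary_def using finite_covered by (simp add: sum.inter_filter)
    finally show False using S(3) by simp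
  qed
  ultimately show ?thesis by blast
qed

end

section \<open>Minimal cocycles\<close>

definition pairs :: "nat \<Rightarrow> nat set set" where
  "pairs n = {e. e \<subseteq> {1..n} \<and> card e = 2}"

text \<open>The support of the coboundary of \<open>S\<close> in the complex of all triples. These
  triples have to be missing for \<open>S\<close> to be a cocycle.\<close>

definition odd_triples :: "nat \<Rightarrow> nat set set \<Rightarrow> nat set set" where
  "odd_triples n S = {t \<in> triples n. odd (card {e\<in>S. e \<subseteq> t})}"

lemma finite_pairs [simp]: "finite (pairs n)"
  by (rule finite_subset[of _ "Pow {1..n}"]) (auto simp: pairs_def)

lemma card_pairs_le: "card (pairs n) \<le> n\<^sup>2"
proof -
  have "card (pairs n) = n choose 2"
    using n_subsets[of "{1..n}" 2] by (simp add: pairs_def)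
  also have "\<dots> \<le> n\<^sup>2" by (cases "2 \<le> n") (auto intro: binomial_le_pow simp: binomial_eq_0)
  finally show ?thesis .
qed

lemma odd_card_sym_diff:
  assumes "finite A" "finite B"
  shows "odd (card (sym_diff A B)) \<longleftrightarrow> odd (card A) \<noteq> odd (card B)"
proof -
  have "card A = card (A - B) + card (A \<inter> B)"
    using assms card_Int_Diff[of A B] by simp
  moreover have "card B = card (B - A) + card (A \<inter> B)"
    using assms card_Int_Diff[of B A] by (simp add: Int_commute)
  moreover have "card (sym_diff A B) = card (A - B) + card (B - A)"
    using assms by (intro card_Un_disjoint) auto
  ultimately show ?thesis by auto
qed

lemma card_pairs_in_triple:
  assumes "distinct [x, y, z]" "\<And>e. e \<in> S \<Longrightarrow> card e = 2"
  shows "card {e\<in>S. e \<subseteq> {x, y, z}} =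
    of_bool ({x, y} \<in> S) + of_bool ({x, z} \<in> S) + of_bool ({y, z} \<in> S)"
proof -
  have "{e\<in>S. e \<subseteq> {x, y, z}} = {e\<in>{{x, y}, {x, z}, {y, z}}. e \<in> S}"
  proof (intro equalityI subsetI)
    fix e assume "e \<in> {e\<in>S. e \<subseteq> {x, y, z}}"
    then have e: "e \<in> S" "e \<subseteq> {x, y, z}" "card e = 2" using assms(2) by auto
    then obtain u v where uv: "e = {u, v}" "u \<noteq> v" by (auto simp: card_2_iff)
    then have "u \<in> {x, y, z}" "v \<in> {x, y, z}" using e(2) by auto
    then show "e \<in> {e\<in>{{x, y}, {x, z}, {y, z}}. e \<in> S}" using uv e(1) by (auto simp: insert_commute)
  qed auto
  also have "{{x, y}, {x, z}, {y, z}} = set [{x, y}, {x, z}, {y, z}]" by simp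
  also have "card {e\<in>set [{x, y}, {x, z}, {y, z}]. e \<in> S} = length (filter (\<lambda>e. e \<in> S) [{x, y}, {x, z}, {y, z}])"
  proof -
    have "distinct [{x, y}, {x, z}, {y, z}]" using assms(1) by (auto simp: doubleton_eq_iff)
    then have "distinct (filter (\<lambda>e. e \<in> S) [{x, y}, {x, z}, {y, z}])" by (rule distinct_filter)
    from distinct_card[OF this] show ?thesis unfolding set_filter .
  qed
  finally show ?thesis by simp
qed

lemma triple_obtain:
  assumes "card t = 3" "v \<in> t"
  obtains x y where "t = {v, x, y}" "distinct [v, x, y]"
proof -
  have "card (t - {v}) = 2" using assms card_ge_0_finite[of t] by simp
  then obtain x y where "t - {v} = {x, y}" "x \<noteq> y" by (auto simp: card_2_iff)
  then have "t = {v, x, y}" "distinct [v, x, y]" using assms by auto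
  then show thesis using that by blast
qed

definition crossing :: "nat \<Rightarrow> nat set \<Rightarrow> nat set set" where
  "crossing n A = {t\<in>triples n. t \<inter> A \<noteq> {} \<and> t - A \<noteq> {}}"

definition nontrivial_cocycle :: "nat set set \<Rightarrow> nat set set \<Rightarrow> bool" where
  "nontrivial_cocycle T S \<longleftrightarrow> cocycle T S \<and> (\<forall>A. S \<noteq> coboundary T A)"

definition minimal_cocycle :: "nat set set \<Rightarrow> nat set set \<Rightarrow> bool" where
  "minimal_cocycle T S \<longleftrightarrow> nontrivial_cocycle T S \<and> (\<forall>S'. nontrivial_cocycle T S' \<longrightarrow> card S \<le> card S')"

context
  fixes n :: nat and T :: "nat set set"
  assumes T: "T \<subseteq> triples n"
begin

lemma covered_subset_pairs: "covered_pairs T \<subseteq> pairs n"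
  using covered_facts[OF T] by (auto simp: pairs_def)

lemma cocycle_finite: "cocycle T S \<Longrightarrow> finite S"
  unfolding cocycle_def using finite_covered[OF T] finite_subset by blast

lemma cocycle_sym_diff:
  assumes "cocycle T S" "cocycle T S'"
  shows "cocycle T (sym_diff S S')"
proof -
  have "even (card {e\<in>sym_diff S S'. e \<subseteq> t})" if "t \<in> T" for t
  proof -
    have "{e\<in>sym_diff S S'. e \<subseteq> t} = sym_diff {e\<in>S. e \<subseteq> t} {e\<in>S'. e \<subseteq> t}" by auto
    moreover have "even (card {e\<in>S. e \<subseteq> t})" "even (card {e\<in>S'. e \<subseteq> t})"
      using assms that by (auto simp: cocycle_def)
    moreover have "finite {e\<in>S. e \<subseteq> t}" "finite {e\<in>S'. e \<subseteq> t}"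
      using assms cocycle_finite by auto
    ultimately show ?thesis using odd_card_sym_diff[of "{e\<in>S. e \<subseteq> t}" "{e\<in>S'. e \<subseteq> t}"] by simp
  qed
  moreover have "sym_diff S S' \<subseteq> covered_pairs T" using assms by (auto simp: cocycle_def)
  ultimately show ?thesis by (simp add: cocycle_def)
qed

lemma odd_card_pair_Int: "u \<noteq> v \<Longrightarrow> odd (card ({u, v} \<inter> A)) \<longleftrightarrow> (u \<in> A) \<noteq> (v \<in> A)"
  by (cases "u \<in> A"; cases "v \<in> A") auto

lemma pair_of_triple_covered: "\<lbrakk>{x, y, z} \<in> T; x \<noteq> y\<rbrakk> \<Longrightarrow> {x, y} \<in> covered_pairs T"
  unfolding covered_pairs_def by (auto intro!: bexI[of _ "{x, y, z}"])

lemma cocycle_coboundary: "cocycle T (coboundary T A)"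
proof -
  have "even (card {e\<in>coboundary T A. e \<subseteq> t})" if t: "t \<in> T" for t
  proof -
    have "card t = 3" using triple_facts[OF T t] by simp
    then obtain x y z where xyz: "t = {x, y, z}" "distinct [x, y, z]" by (auto simp: card_3_iff)
    have cov: "{x, y} \<in> covered_pairs T" "{x, z} \<in> covered_pairs T" "{y, z} \<in> covered_pairs T"
      using t xyz pair_of_triple_covered[of x y z] pair_of_triple_covered[of x z y]
        pair_of_triple_covered[of y z x] by (auto simp: insert_commute)
    have "card {e\<in>coboundary T A. e \<subseteq> t} = of_bool ({x, y} \<in> coboundary T A) +
        of_bool ({x, z} \<in> coboundary T A) + of_bool ({y, z} \<in> coboundary T A)"
      unfolding xyz(1) by (rule card_pairs_in_triple[OF xyz(2)]) (use covered_facts[OF T] in \<open>auto simp: coboundary_def\<close>)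
    moreover have "{u, v} \<in> coboundary T A \<longleftrightarrow> (u \<in> A) \<noteq> (v \<in> A)"
      if "{u, v} \<in> covered_pairs T" "u \<noteq> v" for u v
      using that by (simp add: coboundary_def odd_card_pair_Int del: Int_insert_left)
    ultimately show ?thesis using cov xyz(2) by auto
  qed
  then show ?thesis by (auto simp: cocycle_def coboundary_def)
qed

lemma coboundary_sym_diff: "coboundary T (sym_diff A B) = sym_diff (coboundary T A) (coboundary T B)"
proof -
  have "odd (card (e \<inter> sym_diff A B)) \<longleftrightarrow> odd (card (e \<inter> A)) \<noteq> odd (card (e \<inter> B))"
    if "e \<in> covered_pairs T" for e
  proof -
    have "e \<inter> sym_diff A B = sym_diff (e \<inter> A) (e \<inter> B)" by auto
    then show ?thesis using odd_card_sym_diff[of "e \<inter> A" "e \<inter> B"] covered_facts[OF T that] by simp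
  qed
  then show ?thesis unfolding coboundary_def by blast
qed

lemma nontrivial_cocycle_switch:
  assumes "nontrivial_cocycle T S"
  shows "nontrivial_cocycle T (sym_diff S (coboundary T A))"
proof -
  have "sym_diff S (coboundary T A) \<noteq> coboundary T B" for B
  proof
    assume "sym_diff S (coboundary T A) = coboundary T B"
    then have "S = sym_diff (coboundary T B) (coboundary T A)" by blast
    then have "S = coboundary T (sym_diff B A)" by (simp only: coboundary_sym_diff)
    with assms show False by (auto simp: nontrivial_cocycle_def)
  qed
  then show ?thesis using assms cocycle_sym_diff cocycle_coboundary by (simp add: nontrivial_cocycle_def)
qed

lemma minimal_cocycle_facts:
  assumes "minimal_cocycle T S"
  shows "cocycle T S" "finite S" "S \<subseteq> covered_pairs T" "S \<subseteq> pairs n" "\<And>e. e \<in> S \<Longrightarrow> card e = 2"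
    "\<And>t. t \<in> T \<Longrightarrow> even (card {e\<in>S. e \<subseteq> t})" "S \<noteq> {}"
proof -
  show 1: "cocycle T S" using assms by (auto simp: minimal_cocycle_def nontrivial_cocycle_def)
  show "finite S" using cocycle_finite[OF 1] .
  show 2: "S \<subseteq> covered_pairs T" using 1 by (auto simp: cocycle_def)
  show "S \<subseteq> pairs n" using 2 covered_subset_pairs by auto
  show "\<And>e. e \<in> S \<Longrightarrow> card e = 2" using 2 covered_facts[OF T] by blast
  show "\<And>t. t \<in> T \<Longrightarrow> even (card {e\<in>S. e \<subseteq> t})" using 1 by (auto simp: cocycle_def)
  have "coboundary T {} = {}" by (simp add: coboundary_def)
  then show "S \<noteq> {}" using assms by (auto simp: minimal_cocycle_def nontrivial_cocycle_def)
qed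

text \<open>The cut is taken among all pairs, not only the covered ones. Uncovered pairs are never
  in \<open>S\<close>, so they only enlarge the symmetric difference, and the bound no longer refers
  to \<open>T\<close>.\<close>

lemma minimal_cocycle_switch:
  assumes "minimal_cocycle T S"
  shows "card S \<le> card (sym_diff S {e\<in>pairs n. odd (card (e \<inter> A))})"
proof -
  have "card S \<le> card (sym_diff S (coboundary T A))"
    using assms nontrivial_cocycle_switch by (auto simp: minimal_cocycle_def)
  also have "\<dots> \<le> card (sym_diff S {e\<in>pairs n. odd (card (e \<inter> A))})"
    by (rule card_mono)
      (use minimal_cocycle_facts[OF assms] covered_subset_pairs in \<open>auto simp: coboundary_def\<close>)
  finally show ?thesis .
qed

text \<open>Switching a minimal cocycle by the neighbourhood of \<open>v\<close> leaves exactly the links at \<open>v\<close> of the odd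
  triples, so every vertex lies in at least \<open>card S\<close> of them.\<close>

lemma odd_triples_ge_cone:
  assumes "minimal_cocycle T S"
  shows "n * card S \<le> 3 * card (odd_triples n S)"
proof -
  have fin: "finite (odd_triples n S)" by (simp add: odd_triples_def)
  have "card S \<le> card {t\<in>odd_triples n S. v \<in> t}" if v: "v \<in> {1..n}" for v
  proof -
    let ?g = "{u. {u, v} \<in> S}"
    let ?D = "sym_diff S {e\<in>pairs n. odd (card (e \<inter> ?g))}"
    have vg: "v \<notin> ?g" using minimal_cocycle_facts(5)[OF assms, of "{v, v}"] by auto
    have D: "v \<notin> e \<and> insert v e \<in> {t\<in>odd_triples n S. v \<in> t}" if e: "e \<in> ?D" for e
    proof -
      have "e \<in> pairs n" using e minimal_cocycle_facts(4)[OF assms] by auto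
      then obtain u w where uw: "e = {u, w}" "u \<noteq> w" "u \<in> {1..n}" "w \<in> {1..n}"
        by (auto simp: pairs_def card_2_iff)
      have mem: "(e \<in> S) \<noteq> ((u \<in> ?g) \<noteq> (w \<in> ?g))"
        using e \<open>e \<in> pairs n\<close> odd_card_pair_Int[OF uw(2), of ?g] unfolding uw(1) by blast
      have "v \<noteq> u" "v \<noteq> w" using mem vg uw by (auto simp: insert_commute)
      have "card {e\<in>S. e \<subseteq> {v, u, w}} = of_bool ({v, u} \<in> S) + of_bool ({v, w} \<in> S) + of_bool ({u, w} \<in> S)"
        by (rule card_pairs_in_triple)
          (use \<open>v \<noteq> u\<close> \<open>v \<noteq> w\<close> uw minimal_cocycle_facts(5)[OF assms] in auto)
      moreover have "({u, w} \<in> S) \<noteq> (({v, u} \<in> S) \<noteq> ({v, w} \<in> S))"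
        using mem uw(1) by (simp add: insert_commute)
      ultimately have "odd (card {e\<in>S. e \<subseteq> {v, u, w}})" by (auto split: if_splits simp: of_bool_def)
      then show ?thesis using \<open>v \<noteq> u\<close> \<open>v \<noteq> w\<close> uw v by (auto simp: odd_triples_def triples_def)
    qed
    have "card S \<le> card ?D" by (rule minimal_cocycle_switch[OF assms])
    also have "\<dots> \<le> card {t\<in>odd_triples n S. v \<in> t}"
    proof (rule card_inj_on_le[where f = "insert v"])
      show "inj_on (insert v) ?D" 
      proof (rule inj_onI)
        fix e f assume "e \<in> ?D" "f \<in> ?D" "insert v e = insert v f"
        then show "e = f" using D[of e] D[of f] insert_ident[of v e f] by blast
      qed
      show "insert v ` ?D \<subseteq> {t\<in>odd_triples n S. v \<in> t}" using D by (intro image_subsetI) blast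
    qed (use fin in auto)
    finally show ?thesis .
  qed
  then have "(\<Sum>v\<in>{1..n}. card S) \<le> (\<Sum>v\<in>{1..n}. card {t\<in>odd_triples n S. v \<in> t})" by (rule sum_mono)
  also have "\<dots> = (\<Sum>t\<in>odd_triples n S. card {v\<in>{1..n}. v \<in> t})"
    using sum.swap_restrict[of "{1..n}" "odd_triples n S" "\<lambda>_ _. 1 :: nat" "\<lambda>v t. v \<in> t"] fin by simp
  also have "\<dots> = (\<Sum>t\<in>odd_triples n S. 3)"
  proof (rule sum.cong[OF refl])
    fix t assume "t \<in> odd_triples n S"
    then have "t \<subseteq> {1..n}" "card t = 3" by (auto simp: odd_triples_def triples_def)
    then show "card {v\<in>{1..n}. v \<in> t} = 3" 
      using Int_absorb1[of t "{1..n}"] by (simp add: Int_def)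
  qed
  finally show ?thesis by simp
qed

text \<open>If no face joined \<open>S'\<close> to the rest, both parts would meet every face
  evenly. Being smaller than \<open>S\<close> they would both be coboundaries, and so would their
  union \<open>S\<close>.\<close>

lemma minimal_cocycle_connected:
  assumes "minimal_cocycle T S" "S' \<subset> S" "S' \<noteq> {}"
  shows "\<exists>s\<in>S'. \<exists>s'\<in>S - S'. \<exists>t\<in>T. s \<subseteq> t \<and> s' \<subseteq> t"
proof (rule ccontr)
  assume no: "\<not> ?thesis"
  have fin: "finite S" by (rule minimal_cocycle_facts(2)[OF assms(1)])
  have split: "{e\<in>S'. e \<subseteq> t} = {} \<or> {e\<in>S - S'. e \<subseteq> t} = {}" if "t \<in> T" for t
    using no that by blast
  have ev: "even (card {e\<in>S'. e \<subseteq> t}) \<and> even (card {e\<in>S - S'. e \<subseteq> t})" if t: "t \<in> T" for t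
  proof -
    have S: "{e\<in>S. e \<subseteq> t} = {e\<in>S'. e \<subseteq> t} \<union> {e\<in>S - S'. e \<subseteq> t}" using assms(2) by auto
    have "even (card {e\<in>S. e \<subseteq> t})" by (rule minimal_cocycle_facts(6)[OF assms(1) t])
    from split[OF t] show ?thesis
    proof
      assume 0: "{e\<in>S'. e \<subseteq> t} = {}"
      with \<open>even (card {e\<in>S. e \<subseteq> t})\<close> show ?thesis unfolding S 0 by simp
    next
      assume 0: "{e\<in>S - S'. e \<subseteq> t} = {}"
      with \<open>even (card {e\<in>S. e \<subseteq> t})\<close> show ?thesis unfolding S 0 by simp
    qed
  qed
  have co: "cocycle T S'" "cocycle T (S - S')"
    using ev assms(2) minimal_cocycle_facts(3)[OF assms(1)] by (auto simp: cocycle_def)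
  have "card S' < card S" "card (S - S') < card S"
    using psubset_card_mono[OF fin, of S'] psubset_card_mono[OF fin, of "S - S'"] assms(2,3) by auto
  then have "\<not> nontrivial_cocycle T S'" "\<not> nontrivial_cocycle T (S - S')" using assms(1) by (auto simp: minimal_cocycle_def)
  then obtain A B where AB: "S' = coboundary T A" "S - S' = coboundary T B"
    using co unfolding nontrivial_cocycle_def by blast
  have "coboundary T (sym_diff A B) = S"
    unfolding coboundary_sym_diff AB[symmetric] using assms(2) by blast
  then show False using assms(1) by (auto simp: minimal_cocycle_def nontrivial_cocycle_def)
qed

text \<open>\<open>A\<close> consists of the vertices reachable from \<open>a\<close> without the
  edges ab and ac; by construction no other edge leaves it.\<close>

lemma separated_imp_coboundary:
  assumes "distinct [a, b, c]" "{a, b, c} \<in> T"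
    and "(a, b) \<notin> {(u, v). {u, v} \<in> covered_pairs T - {{a, b}, {a, c}}}\<^sup>*" (is "_ \<notin> ?R\<^sup>*")
  shows "\<exists>A\<subseteq>{1..n}. a \<in> A \<and> b \<notin> A \<and> coboundary T A = {{a, b}, {a, c}}"
proof -
  define A where "A = {v\<in>{1..n}. (a, v) \<in> ?R\<^sup>*}"
  have abc: "a \<in> {1..n}" "b \<in> {1..n}" "c \<in> {1..n}" using triple_facts[OF T assms(2)] by auto
  have a: "a \<in> A" and b: "b \<notin> A" using abc assms(3) by (auto simp: A_def)
  have sym: "(v, u) \<in> ?R" if "(u, v) \<in> ?R" for u v using that by (auto simp: insert_commute)
  have closed: "v \<in> A" if "u \<in> A" "(u, v) \<in> ?R" for u v
  proof -
    have "{u, v} \<in> covered_pairs T" using that(2) by blast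
    then have "v \<in> {1..n}" using covered_facts[OF T] by blast
    then show ?thesis using that by (auto simp: A_def intro: rtrancl_into_rtrancl)
  qed
  have cov: "{a, b} \<in> covered_pairs T" "{a, c} \<in> covered_pairs T" "{c, b} \<in> covered_pairs T"
    using assms(1,2) pair_of_triple_covered[of a b c] pair_of_triple_covered[of a c b]
      pair_of_triple_covered[of c b a] by (auto simp: insert_commute)
  \<comment> \<open>The edge bc is still available and would lead from \<open>c\<close> to
    \<open>b\<close>.\<close>
  have c: "c \<notin> A"
  proof
    assume "c \<in> A"
    moreover have "(c, b) \<in> ?R" using cov(3) assms(1) by (auto simp: doubleton_eq_iff)
    ultimately show False using closed b by blast
  qed
  have "e \<in> {{a, b}, {a, c}}" if e: "e \<in> covered_pairs T" "odd (card (e \<inter> A))" for e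
  proof (rule ccontr)
    assume ne: "e \<notin> {{a, b}, {a, c}}"
    have "card e = 2" using covered_facts[OF T e(1)] by simp
    then obtain u v where uv: "e = {u, v}" "u \<noteq> v" by (auto simp: card_2_iff)
    have "(u \<in> A) \<noteq> (v \<in> A)" using e(2) unfolding uv(1) odd_card_pair_Int[OF uv(2)] .
    moreover have "(u, v) \<in> ?R" using e(1) ne uv by auto
    ultimately show False using closed sym by blast
  qed
  moreover have "odd (card ({a, b} \<inter> A))" "odd (card ({a, c} \<inter> A))"
    using a b c assms(1) by (auto simp: odd_card_pair_Int simp del: Int_insert_left)
  ultimately have "coboundary T A = {{a, b}, {a, c}}" using cov unfolding coboundary_def by blast
  then show ?thesis using a b by (intro exI[of _ A]) (auto simp: A_def)
qed

lemma crossing_coboundary: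
  assumes "t \<in> T" "t \<in> crossing n A"
  shows "\<exists>e\<in>coboundary T A. e \<subseteq> t"
proof -
  obtain u v where uv: "u \<in> t" "u \<in> A" "v \<in> t" "v \<notin> A" using assms(2) by (auto simp: crossing_def)
  then have "u \<noteq> v" by auto
  then have "{u, v} \<in> coboundary T A"
    using uv assms(1) by (auto simp: coboundary_def covered_pairs_def odd_card_pair_Int simp del: Int_insert_left)
  then show ?thesis using uv by (intro bexI[of _ "{u, v}"]) auto
qed

text \<open>Without the path, the cut around \<open>a\<close> would consist of ab and ac only. A
  face crossing it contains one of these edges, hence is abc, against the two crossing faces granted
  by \<open>cuts\<close>.\<close>

lemma copy_of_M_if_cuts:
  assumes "distinct [a, b, c]" "{a, b, c} \<in> T"
    and only: "\<And>f. \<lbrakk>f \<in> T; {a, b} \<subseteq> f \<or> {a, c} \<subseteq> f\<rbrakk> \<Longrightarrow> f = {a, b, c}"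
    and cuts: "\<And>A. \<lbrakk>A \<subseteq> {1..n}; A \<noteq> {}; A \<noteq> {1..n}\<rbrakk> \<Longrightarrow> 2 \<le> card (T \<inter> crossing n A)"
  shows "copy_of_M (complex_of_triples n T) a b c"
proof -
  have "(a, b) \<in> {(u, v). {u, v} \<in> covered_pairs T - {{a, b}, {a, c}}}\<^sup>*"
  proof (rule ccontr)
    assume "\<not> ?thesis"
    then obtain A where A: "A \<subseteq> {1..n}" "a \<in> A" "b \<notin> A" "coboundary T A = {{a, b}, {a, c}}"
      using separated_imp_coboundary[OF assms(1,2)] by blast
    have "b \<in> {1..n}" using triple_facts[OF T assms(2)] by auto
    then have "2 \<le> card (T \<inter> crossing n A)" using A by (intro cuts) auto
    moreover have "T \<inter> crossing n A \<subseteq> {{a, b, c}}"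
      using crossing_coboundary[of _ A] only unfolding A(4) by blast
    ultimately show False using card_mono[of "{{a, b, c}}" "T \<inter> crossing n A"] by simp
  qed
  then show ?thesis using assms(1,2) only unfolding copy_of_M_iff[OF T] by blast
qed

lemma homology_0_if_crossing:
  assumes cuts: "\<And>A. \<lbrakk>A \<subseteq> {1..n}; A \<noteq> {}; A \<noteq> {1..n}\<rbrakk> \<Longrightarrow> T \<inter> crossing n A \<noteq> {}"
  shows "trivial_group (reduced_homology_F2 (complex_of_triples n T) 0)"
proof (rule homology_0_if_cuts[OF T])
  fix A assume "A \<subseteq> {1..n}" "A \<noteq> {}" "A \<noteq> {1..n}"
  then have "T \<inter> crossing n A \<noteq> {}" by (rule cuts)
  then show "coboundary T A \<noteq> {}" using crossing_coboundary by blast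
qed

text \<open>By parity the two pairs lie in the same faces, so they share a vertex \<open>a\<close>
  and span the only face over either of them. The path from \<open>a\<close> to \<open>b\<close>
  exists because otherwise the two pairs would form a cut.\<close>

lemma minimal_cocycle_card_2:
  assumes "minimal_cocycle T S" "card S = 2"
  shows "\<exists>a b c. copy_of_M (complex_of_triples n T) a b c"
proof -
  obtain e f where S: "S = {e, f}" "e \<noteq> f" using assms(2) by (auto simp: card_2_iff)
  have both: "e \<subseteq> t \<longleftrightarrow> f \<subseteq> t" if "t \<in> T" for t
  proof (rule ccontr)
    assume "\<not> ?thesis"
    then have "{x\<in>S. x \<subseteq> t} = {e} \<or> {x\<in>S. x \<subseteq> t} = {f}" using S by auto
    then have "card {x\<in>S. x \<subseteq> t} = 1" by auto
    then show False using minimal_cocycle_facts(6)[OF assms(1) that] by simp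
  qed
  obtain t where t: "t \<in> T" "e \<subseteq> t"
    using minimal_cocycle_facts(3)[OF assms(1)] S by (auto simp: covered_pairs_def)
  then have ft: "f \<subseteq> t" using both by blast
  have ce: "card e = 2" "card f = 2" using minimal_cocycle_facts(5)[OF assms(1)] S by auto
  have ct: "card t = 3" "finite t" using triple_facts[OF T t(1)] by auto
  have "e \<inter> f \<noteq> {}"
  proof
    assume "e \<inter> f = {}"
    then have "card (e \<union> f) = 4" using ce by (subst card_Un_disjoint) (auto intro: card_ge_0_finite)
    then show False using card_mono[of t "e \<union> f"] ct t ft by auto
  qed
  then obtain a where a: "a \<in> e" "a \<in> f" by blast
  obtain b where b: "e = {a, b}" "a \<noteq> b" using ce(1) a by (auto simp: card_2_iff)
  obtain c where c: "f = {a, c}" "a \<noteq> c" using ce(2) a by (auto simp: card_2_iff)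
  have bc: "b \<noteq> c" using S b c by auto
  have d: "distinct [a, b, c]" using b c bc by auto
  have t_eq: "t' = {a, b, c}" if t': "t' \<in> T" "{a, b} \<subseteq> t' \<or> {a, c} \<subseteq> t'" for t'
  proof -
    have "{a, b, c} \<subseteq> t'" using both[OF t'(1)] t'(2) b c by auto
    moreover have "card t' = 3" "finite t'" using triple_facts[OF T t'(1)] by auto
    moreover have "card {a, b, c} = 3" using d by simp
    ultimately show ?thesis by (metis card_subset_eq)
  qed
  have abc: "{a, b, c} \<in> T" using t_eq[of t] t b by auto
  have "(a, b) \<in> {(u, v). {u, v} \<in> covered_pairs T - {{a, b}, {a, c}}}\<^sup>*"
  proof (rule ccontr)
    assume "\<not> ?thesis"
    then obtain A where "coboundary T A = {{a, b}, {a, c}}"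
      using separated_imp_coboundary[OF d abc] by blast
    then show False using assms(1) S b c by (auto simp: minimal_cocycle_def nontrivial_cocycle_def)
  qed
  then have "copy_of_M (complex_of_triples n T) a b c" using d abc t_eq unfolding copy_of_M_iff[OF T] by blast
  then show ?thesis by blast
qed

text \<open>A face over one edge of \<open>S\<close> meets \<open>S\<close> evenly, so it contains a
  second one.\<close>

lemma minimal_cocycle_card_ge_2:
  assumes "minimal_cocycle T S"
  shows "2 \<le> card S"
proof -
  obtain e where e: "e \<in> S" using minimal_cocycle_facts(7)[OF assms] by blast
  then obtain t where t: "t \<in> T" "e \<subseteq> t" using minimal_cocycle_facts(3)[OF assms] by (auto simp: covered_pairs_def)
  have fin: "finite {x\<in>S. x \<subseteq> t}" using minimal_cocycle_facts(2)[OF assms] by simp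
  have "card {x\<in>S. x \<subseteq> t} \<noteq> 0" using e t fin by auto
  then have "2 \<le> card {x\<in>S. x \<subseteq> t}"
    using minimal_cocycle_facts(6)[OF assms t(1)] by (auto simp: even_iff_mod_2_eq_zero)
  also have "\<dots> \<le> card S" by (rule card_mono) (use minimal_cocycle_facts(2)[OF assms] in auto)
  finally show ?thesis .
qed

lemma minimal_cocycle_exists:
  assumes "\<not> trivial_group (reduced_homology_F2 (complex_of_triples n T) 1)"
  shows "\<exists>S. minimal_cocycle T S"
proof -
  obtain S where "nontrivial_cocycle T S" using noncoboundary_cocycle_exists[OF T assms] by (auto simp: nontrivial_cocycle_def)
  then show ?thesis using ex_has_least_nat[of "nontrivial_cocycle T" S card] by (auto simp: minimal_cocycle_def)
qed

end

text \<open>Extending e in \<open>S\<close> by a vertex w gives an odd triple whenever e is the only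
  member of \<open>S\<close> inside it. Such triples determine e and w. For small \<open>S\<close>
  this is nearly three times as strong as the cone bound.\<close>

lemma odd_triples_ge_private:
  assumes "S \<subseteq> pairs n"
  shows "card S * (n - 1 - card S) \<le> card (odd_triples n S)"
proof -
  have finS: "finite S" using assms finite_subset finite_pairs by blast
  have S2: "card e = 2" "e \<subseteq> {1..n}" "finite e" if "e \<in> S" for e
    using that assms by (auto simp: pairs_def intro: finite_subset)
  define X where "X e = {w\<in>{1..n} - e. \<forall>e'\<in>S. e' \<subseteq> insert w e \<longrightarrow> e' = e}" for e
  have cardX: "n - 1 - card S \<le> card (X e)" if e: "e \<in> S" for e
  proof -
    \<comment> \<open>Each other member e' of \<open>S\<close> spoils at most one vertex, the single
      element of e' - e. So at least (n - 2) - (card S - 1) vertices remain.\<close>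
    have "{1..n} - e - X e \<subseteq> (\<lambda>e'. the_elem (e' - e)) ` (S - {e})"
    proof
      fix w assume "w \<in> {1..n} - e - X e"
      then obtain e' where w: "w \<notin> e" and e': "e' \<in> S" "e' \<subseteq> insert w e" "e' \<noteq> e" by (auto simp: X_def)
      have "\<not> e' \<subseteq> e" using e' S2[OF e] S2[OF e'(1)] card_subset_eq by metis
      then have "e' - e = {w}" using e'(2) by auto
      then show "w \<in> (\<lambda>e'. the_elem (e' - e)) ` (S - {e})" using e' by (intro image_eqI[of _ _ e']) auto
    qed
    then have "card ({1..n} - e - X e) \<le> card (S - {e})" using finS by (meson surj_card_le finite_Diff)
    also have "\<dots> = card S - 1" using e finS by simp
    finally have 1: "card ({1..n} - e - X e) \<le> card S - 1" .
    have "card ({1..n} - e) = n - 2" using S2[OF e] by (simp add: card_Diff_subset)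
    moreover have "card ({1..n} - e) = card ({1..n} - e - X e) + card (X e)"
    proof -
      have "{1..n} - e = ({1..n} - e - X e) \<union> X e" by (auto simp: X_def)
      then show ?thesis using card_Un_disjoint[of "{1..n} - e - X e" "X e"] by (auto simp: X_def)
    qed
    moreover have "card S > 0" using e finS card_gt_0_iff by blast
    ultimately show ?thesis using 1 by linarith
  qed
  have "card S * (n - 1 - card S) = (\<Sum>e\<in>S. n - 1 - card S)" by simp
  also have "\<dots> \<le> (\<Sum>e\<in>S. card (X e))" by (rule sum_mono) (rule cardX)
  also have "\<dots> = card (SIGMA e:S. X e)" using finS by (subst card_SigmaI) (auto simp: X_def)
  also have "\<dots> \<le> card (odd_triples n S)"
  proof (rule card_inj_on_le[where f = "\<lambda>(e, w). insert w e"])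
    have only: "{e'\<in>S. e' \<subseteq> insert w e} = {e}" if "e \<in> S" "w \<in> X e" for e w
      using that by (auto simp: X_def)
    show "inj_on (\<lambda>(e, w). insert w e) (SIGMA e:S. X e)"
    proof (rule inj_onI, clarify)
      fix e w f x assume *: "e \<in> S" "w \<in> X e" "f \<in> S" "x \<in> X f" "insert w e = insert x f"
      then have "{e} = {f}" using only[of e w] only[of f x] by simp
      moreover have "w \<notin> e" "x \<notin> f" using * by (auto simp: X_def)
      ultimately show "e = f \<and> w = x" using *(5) by auto
    qed
    show "(\<lambda>(e, w). insert w e) ` (SIGMA e:S. X e) \<subseteq> odd_triples n S"
    proof clarify
      fix e w assume *: "e \<in> S" "w \<in> X e"
      then have "w \<notin> e" "w \<in> {1..n}" by (auto simp: X_def)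
      then have "insert w e \<in> triples n" using S2[OF *(1)] by (auto simp: triples_def)
      then show "insert w e \<in> odd_triples n S" using only[OF *] by (simp add: odd_triples_def)
    qed
  qed (simp add: odd_triples_def)
  finally show ?thesis .
qed

section \<open>Counting trees of pairs\<close>

text \<open>For a pair e these are its neighbours in the line graph of the complete graph; the union
  of e with a neighbour is the triple attached to a tree edge.\<close>

definition nbrs :: "nat \<Rightarrow> nat set \<Rightarrow> nat set set" where
  "nbrs n e = {e'\<in>pairs n. card (e \<union> e') = 3}"

text \<open>Rooted trees of pairs, recorded by their vertices and by the triples spanned by their edges.
  Splitting off one branch at the root gives the quadratic recursion behind the count.\<close>

inductive pair_tree :: "nat \<Rightarrow> nat set \<Rightarrow> nat \<Rightarrow> nat set set \<Rightarrow> nat set set \<Rightarrow> bool" for n where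
  leaf: "pair_tree n e 1 {e} {}"
| graft: "\<lbrakk>pair_tree n e i S A; pair_tree n e' j S' A'; e' \<in> nbrs n e\<rbrakk> \<Longrightarrow>
    pair_tree n e (i + j) (S \<union> S') (insert (e \<union> e') (A \<union> A'))"

definition pair_trees :: "nat \<Rightarrow> nat set \<Rightarrow> nat \<Rightarrow> (nat set set \<times> nat set set) set" where
  "pair_trees n e k = {(S, A). pair_tree n e k S A}"

lemma pair_tree_size_pos: "pair_tree n e k S A \<Longrightarrow> 1 \<le> k"
  by (induction rule: pair_tree.induct) auto

lemma finite_nbrs [simp]: "finite (nbrs n e)"
  by (simp add: nbrs_def)

lemma card_nbrs_le:
  assumes "e \<in> pairs n"
  shows "card (nbrs n e) \<le> 2 * n"
proof -
  have e: "card e = 2" "finite e" using assms by (auto simp: pairs_def intro: card_ge_0_finite)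
  have "nbrs n e \<subseteq> (\<lambda>(x, w). insert w (e - {x})) ` (e \<times> {1..n})"
  proof
    fix e' assume "e' \<in> nbrs n e"
    then have e': "e' \<subseteq> {1..n}" "card e' = 2" "finite e'" "card (e \<union> e') = 3"
      by (auto simp: nbrs_def pairs_def intro: card_ge_0_finite)
    have "card (e \<inter> e') = 1" using card_Un_Int[OF e(2) e'(3)] e e' by simp
    then obtain a where a: "e \<inter> e' = {a}" by (auto simp: card_1_singleton_iff)
    obtain x where x: "e = {a, x}" "a \<noteq> x" 
    proof -
      have "card (e - {a}) = 1" using a e by (simp add: card_Diff_singleton_if) auto
      then obtain x where "e - {a} = {x}" by (auto simp: card_1_singleton_iff)
      then show thesis using a that[of x] by blast
    qed
    obtain w where w: "e' = {a, w}" "a \<noteq> w" 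
    proof -
      have "card (e' - {a}) = 1" using a e' by (simp add: card_Diff_singleton_if) auto
      then obtain w where "e' - {a} = {w}" by (auto simp: card_1_singleton_iff)
      then show thesis using a that[of w] by blast
    qed
    have "e' = insert w (e - {x})" using x w by auto
    moreover have "x \<in> e" "w \<in> {1..n}" using x w e' by auto
    ultimately show "e' \<in> (\<lambda>(x, w). insert w (e - {x})) ` (e \<times> {1..n})"
      by (intro image_eqI[of _ _ "(x, w)"]) simp_all
  qed
  then have "card (nbrs n e) \<le> card (e \<times> {1..n})" by (rule surj_card_le[rotated]) (use e(2) in simp)
  then show ?thesis using e by (simp add: card_cartesian_product)
qed

text \<open>The new pair is hung below \<open>s\<close> inside whichever branch contains
  \<open>s\<close>, so the root and the existing grafts stay in place.\<close>

lemma pair_tree_grow: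
  assumes "pair_tree n e k S A" "s \<in> S" "s' \<in> nbrs n s"
  shows "pair_tree n e (k + 1) (insert s' S) (insert (s \<union> s') A)"
  using assms
proof (induction rule: pair_tree.induct)
  case (leaf e)
  then show ?case using pair_tree.graft[OF pair_tree.leaf pair_tree.leaf, of s' n e] by simp
next
  case (graft e i S A e' j S' A')
  show ?case
  proof (cases "s \<in> S")
    case True
    then have "pair_tree n e (i + 1) (insert s' S) (insert (s \<union> s') A)" using graft by simp
    from pair_tree.graft[OF this graft.hyps(2,3)]
    have "pair_tree n e (i + j + 1) (insert s' S \<union> S') (insert (e \<union> e') (insert (s \<union> s') A \<union> A'))" by (simp only: add_ac)
    moreover have "insert s' S \<union> S' = insert s' (S \<union> S')"
      "insert (e \<union> e') (insert (s \<union> s') A \<union> A') = insert (s \<union> s') (insert (e \<union> e') (A \<union> A'))"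
      by blast+
    ultimately show ?thesis by (simp only:)
  next
    case False
    then have "pair_tree n e' (j + 1) (insert s' S') (insert (s \<union> s') A')" using graft by simp
    from pair_tree.graft[OF graft.hyps(1) this graft.hyps(3)]
    have "pair_tree n e (i + j + 1) (S \<union> insert s' S') (insert (e \<union> e') (A \<union> insert (s \<union> s') A'))" by (simp only: add_ac)
    moreover have "S \<union> insert s' S' = insert s' (S \<union> S')"
      "insert (e \<union> e') (A \<union> insert (s \<union> s') A') = insert (s \<union> s') (insert (e \<union> e') (A \<union> A'))"
      by blast+
    ultimately show ?thesis by (simp only:)
  qed
qed

lemma pair_trees_subset:
  "pair_trees n e k \<subseteq> (if k = 1 then {({e}, {})} else {}) \<union>
     (\<Union>i\<in>{1..<k}. \<Union>e'\<in>nbrs n e. (\<lambda>((S, A), (S', A')). (S \<union> S', insert (e \<union> e') (A \<union> A'))) `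
        (pair_trees n e i \<times> pair_trees n e' (k - i)))"
proof safe
  fix S A assume "(S, A) \<in> pair_trees n e k"
    and no: "(S, A) \<notin> (\<Union>i\<in>{1..<k}. \<Union>e'\<in>nbrs n e. (\<lambda>((S, A), (S', A')). (S \<union> S', insert (e \<union> e') (A \<union> A'))) `
        (pair_trees n e i \<times> pair_trees n e' (k - i)))"
  then have "pair_tree n e k S A" by (simp add: pair_trees_def)
  then show "(S, A) \<in> (if k = 1 then {({e}, {})} else {})"
  proof cases
    case leaf
    then show ?thesis by simp
  next
    case (graft i S1 A1 e' j S2 A2)
    have "i \<ge> 1" "j \<ge> 1" using graft pair_tree_size_pos by blast+
    then have "i \<in> {1..<k}" "k - i = j" using graft(1) by auto
    moreover have "(S, A) \<in> (\<lambda>((S, A), (S', A')). (S \<union> S', insert (e \<union> e') (A \<union> A'))) `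
        (pair_trees n e i \<times> pair_trees n e' j)"
      using graft by (intro image_eqI[of _ _ "((S1, A1), (S2, A2))"]) (auto simp: pair_trees_def)
    ultimately have False using no graft(6) by blast
    then show ?thesis ..
  qed
qed

lemma finite_pair_trees [simp]: "finite (pair_trees n e k)"
proof (induction k arbitrary: e rule: less_induct)
  case (less k)
  show ?case
    by (rule finite_subset[OF pair_trees_subset]) (use less in auto)
qed

lemma card_pair_trees_rec:
  "card (pair_trees n e k) \<le> of_bool (k = 1) +
     (\<Sum>i\<in>{1..<k}. \<Sum>e'\<in>nbrs n e. card (pair_trees n e i) * card (pair_trees n e' (k - i)))"
proof -
  let ?f = "\<lambda>i e'. (\<lambda>((S, A), (S', A')). (S \<union> S', insert (e \<union> e') (A \<union> A'))) `
        (pair_trees n e i \<times> pair_trees n e' (k - i))"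
  have "card (pair_trees n e k) \<le> card ((if k = 1 then {({e}, {})} else {}) \<union> (\<Union>i\<in>{1..<k}. \<Union>e'\<in>nbrs n e. ?f i e'))"
    by (rule card_mono[OF _ pair_trees_subset]) auto
  also have "\<dots> \<le> card (if k = 1 then {({e}, {} :: nat set set)} else {}) + card (\<Union>i\<in>{1..<k}. \<Union>e'\<in>nbrs n e. ?f i e')"
    by (rule card_Un_le)
  also have "card (if k = 1 then {({e}, {} :: nat set set)} else {}) = of_bool (k = 1)" by simp
  also have "card (\<Union>i\<in>{1..<k}. \<Union>e'\<in>nbrs n e. ?f i e') \<le> (\<Sum>i\<in>{1..<k}. card (\<Union>e'\<in>nbrs n e. ?f i e'))"
    by (rule card_UN_le) simp
  also have "\<dots> \<le> (\<Sum>i\<in>{1..<k}. \<Sum>e'\<in>nbrs n e. card (?f i e'))"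
    by (intro sum_mono card_UN_le) simp
  also have "\<dots> \<le> (\<Sum>i\<in>{1..<k}. \<Sum>e'\<in>nbrs n e. card (pair_trees n e i \<times> pair_trees n e' (k - i)))"
    by (intro sum_mono card_image_le) simp
  finally show ?thesis by (simp add: card_cartesian_product)
qed

text \<open>A truncated Cauchy product: in a splitting of k \<le> K + 1 into two positive parts,
  both parts are at most K.\<close>

lemma convolution_le:
  fixes a b :: "nat \<Rightarrow> real"
  assumes "\<And>i. 0 \<le> a i" "\<And>i. 0 \<le> b i"
  shows "(\<Sum>k\<in>{1..Suc K}. \<Sum>i\<in>{1..<k}. a i * b (k - i)) \<le> (\<Sum>i\<in>{1..K}. a i) * (\<Sum>j\<in>{1..K}. b j)"
proof -
  have "(\<Sum>k\<in>{1..Suc K}. \<Sum>i\<in>{1..<k}. a i * b (k - i)) =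
      (\<Sum>(k, i)\<in>(SIGMA k:{1..Suc K}. {1..<k}). a i * b (k - i))"
    by (rule sum.Sigma) auto
  also have "\<dots> = (\<Sum>(i, j)\<in>(\<lambda>(k, i). (i, k - i)) ` (SIGMA k:{1..Suc K}. {1..<k}). a i * b j)"
    by (subst sum.reindex) (auto simp: inj_on_def intro!: sum.cong)
  also have "\<dots> \<le> (\<Sum>(i, j)\<in>{1..K} \<times> {1..K}. a i * b j)"
    by (rule sum_mono2) (use assms in auto)
  also have "\<dots> = (\<Sum>i\<in>{1..K}. a i) * (\<Sum>j\<in>{1..K}. b j)"
    by (simp add: sum_product sum.cartesian_product)
  finally show ?thesis .
qed

text \<open>With at most 2n neighbours per pair, the generating function is dominated by the
  solution of y = z + 2n y^2. At z = 1/(8n) its discriminant 1 - 8nz vanishes and y = 1/(4n) is the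
  double root, so this bound reproduces itself in the induction on the truncation
  \<open>K\<close>.\<close>

lemma pair_tree_generating_function:
  assumes "n \<ge> 1" "e \<in> pairs n"
  shows "(\<Sum>k\<in>{1..K}. real (card (pair_trees n e k)) * (1 / (8 * real n)) ^ k) \<le> 1 / (4 * real n)"
  using assms(2)
proof (induction K arbitrary: e)
  case 0
  then show ?case by simp
next
  case (Suc K)
  define z where "z = 1 / (8 * real n)"
  have z: "z > 0" using assms(1) by (simp add: z_def)
  define w where "w e k = real (card (pair_trees n e k)) * z ^ k" for e k
  have w0: "w e k \<ge> 0" for e k using z by (simp add: w_def)
  have IH: "(\<Sum>k\<in>{1..K}. w e k) \<le> 1 / (4 * real n)" if "e \<in> pairs n" for e
    using Suc.IH[OF that] by (simp add: w_def z_def)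
  have "w e k \<le> of_bool (k = 1) * z + (\<Sum>i\<in>{1..<k}. \<Sum>e'\<in>nbrs n e. w e i * w e' (k - i))" for k
  proof -
    have "real (card (pair_trees n e k)) \<le> real (of_bool (k = 1) +
        (\<Sum>i\<in>{1..<k}. \<Sum>e'\<in>nbrs n e. card (pair_trees n e i) * card (pair_trees n e' (k - i))))"
      using card_pair_trees_rec[of n e k] by (rule of_nat_mono)
    then have "w e k \<le> (of_bool (k = 1) +
        (\<Sum>i\<in>{1..<k}. \<Sum>e'\<in>nbrs n e. real (card (pair_trees n e i)) * real (card (pair_trees n e' (k - i))))) * z ^ k"
      unfolding w_def using z by (intro mult_right_mono) auto
    also have "\<dots> = of_bool (k = 1) * z ^ k +
        (\<Sum>i\<in>{1..<k}. \<Sum>e'\<in>nbrs n e. real (card (pair_trees n e i)) * real (card (pair_trees n e' (k - i))) * z ^ k)"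
      by (simp add: distrib_right sum_distrib_right)
    also have "of_bool (k = 1) * z ^ k = of_bool (k = 1) * z" by simp
    also have "(\<Sum>i\<in>{1..<k}. \<Sum>e'\<in>nbrs n e. real (card (pair_trees n e i)) * real (card (pair_trees n e' (k - i))) * z ^ k) =
        (\<Sum>i\<in>{1..<k}. \<Sum>e'\<in>nbrs n e. w e i * w e' (k - i))"
    proof (intro sum.cong refl)
      fix i e' assume "i \<in> {1..<k}"
      then have "z ^ k = z ^ i * z ^ (k - i)" by (simp add: power_add[symmetric])
      then show "real (card (pair_trees n e i)) * real (card (pair_trees n e' (k - i))) * z ^ k = w e i * w e' (k - i)"
        by (simp add: w_def)
    qed
    finally show ?thesis .
  qed
  then have "(\<Sum>k\<in>{1..Suc K}. w e k) \<le>
      (\<Sum>k\<in>{1..Suc K}. of_bool (k = 1) * z + (\<Sum>i\<in>{1..<k}. \<Sum>e'\<in>nbrs n e. w e i * w e' (k - i)))"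
    by (rule sum_mono)
  also have "\<dots> = z + (\<Sum>k\<in>{1..Suc K}. \<Sum>i\<in>{1..<k}. \<Sum>e'\<in>nbrs n e. w e i * w e' (k - i))"
  proof -
    have "(\<Sum>k\<in>{1..Suc K}. of_bool (k = 1) * z) = z"
      by (subst sum.mono_neutral_right[of _ "{1}"]) auto
    then show ?thesis by (simp only: sum.distrib)
  qed
  also have "(\<Sum>k\<in>{1..Suc K}. \<Sum>i\<in>{1..<k}. \<Sum>e'\<in>nbrs n e. w e i * w e' (k - i)) =
      (\<Sum>e'\<in>nbrs n e. \<Sum>k\<in>{1..Suc K}. \<Sum>i\<in>{1..<k}. w e i * w e' (k - i))"
  proof -
    have "(\<Sum>i\<in>{1..<k}. \<Sum>e'\<in>nbrs n e. w e i * w e' (k - i)) =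
        (\<Sum>e'\<in>nbrs n e. \<Sum>i\<in>{1..<k}. w e i * w e' (k - i))" for k by (rule sum.swap)
    then show ?thesis by (simp only:) (rule sum.swap)
  qed
  also have "\<dots> \<le> (\<Sum>e'\<in>nbrs n e. (\<Sum>i\<in>{1..K}. w e i) * (\<Sum>j\<in>{1..K}. w e' j))"
    by (intro sum_mono convolution_le w0)
  also have "\<dots> \<le> (\<Sum>e'\<in>nbrs n e. (1 / (4 * real n)) * (1 / (4 * real n)))"
  proof (rule sum_mono)
    fix e' assume "e' \<in> nbrs n e"
    then have "e' \<in> pairs n" by (simp add: nbrs_def)
    then show "(\<Sum>i\<in>{1..K}. w e i) * (\<Sum>j\<in>{1..K}. w e' j) \<le> (1 / (4 * real n)) * (1 / (4 * real n))"
      using IH Suc.prems by (intro mult_mono) (auto intro: sum_nonneg w0)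
  qed
  also have "\<dots> \<le> 2 * real n * ((1 / (4 * real n)) * (1 / (4 * real n)))"
  proof -
    have "real (card (nbrs n e)) \<le> 2 * real n" using card_nbrs_le[OF Suc.prems] by linarith
    then show ?thesis unfolding sum_constant by (rule mult_right_mono) simp
  qed
  also have "\<dots> = 1 / (8 * real n)" using assms(1) by (simp add: field_simps)
  finally have "(\<Sum>k\<in>{1..Suc K}. w e k) \<le> z + 1 / (8 * real n)" by simp
  also have "\<dots> = 1 / (4 * real n)" by (simp add: z_def)
  finally show ?case by (simp add: w_def z_def)
qed

lemma card_pair_trees_le:
  assumes "n \<ge> 1" "e \<in> pairs n"
  shows "real (card (pair_trees n e k)) \<le> (8 * real n) ^ k / (4 * real n)"
proof (cases "k = 0")
  case True
  have "pair_trees n e 0 = {}" using pair_tree_size_pos[of n e 0] by (auto simp: pair_trees_def)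
  then show ?thesis using True by simp
next
  case False
  have "real (card (pair_trees n e k)) * (1 / (8 * real n)) ^ k \<le>
      (\<Sum>k\<in>{1..k}. real (card (pair_trees n e k)) * (1 / (8 * real n)) ^ k)"
    using False by (intro member_le_sum) auto
  also have "\<dots> \<le> 1 / (4 * real n)" by (rule pair_tree_generating_function[OF assms])
  finally show ?thesis using assms(1) by (simp add: field_simps)
qed

text \<open>What a minimal cocycle leaves visible at one time, with minimality already converted
  into counts: the faces of a spanning tree are present, the odd triples are absent, and two lower
  bounds on the latter cover the different ranges of k.\<close>

definition obstruction :: "nat \<Rightarrow> nat set set \<Rightarrow> nat \<Rightarrow> nat set set \<Rightarrow> nat set set \<Rightarrow> bool" where
  "obstruction n T k S A \<longleftrightarrow> card S = k \<and> card A = k - 1 \<and> A \<subseteq> T \<and> odd_triples n S \<inter> T = {} \<and>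
     n * k \<le> 3 * card (odd_triples n S) \<and> k * (n - 1 - k) \<le> card (odd_triples n S)"

text \<open>Connectedness of the minimal cocycle adds one pair at a time. The invariant that every
  face of \<open>A\<close> contains two pairs of \<open>S'\<close> guarantees that each added face
  is new, whence \<open>card A = j - 1\<close>.\<close>

lemma minimal_cocycle_tree:
  assumes T: "T \<subseteq> triples n" and S: "minimal_cocycle T S" "e \<in> S" and j: "1 \<le> j" "j \<le> card S"
  shows "\<exists>S' A. pair_tree n e j S' A \<and> S' \<subseteq> S \<and> card S' = j \<and> card A = j - 1 \<and> A \<subseteq> T \<and> finite A \<and>
    (\<forall>t\<in>A. 2 \<le> card {x\<in>S'. x \<subseteq> t})"
  using j
proof (induction j rule: nat_induct_at_least)
  case base
  show ?case
    by (rule exI[of _ "{e}"], rule exI[of _ "{}"]) (use S(2) pair_tree.leaf[of n e] in auto)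
next
  case (Suc j)
  then obtain S' A where IH: "pair_tree n e j S' A" "S' \<subseteq> S" "card S' = j" "card A = j - 1" "A \<subseteq> T"
    "finite A" "\<And>t. t \<in> A \<Longrightarrow> 2 \<le> card {x\<in>S'. x \<subseteq> t}" by auto
  note facts = minimal_cocycle_facts[OF T S(1)]
  have finS': "finite S'" using IH(2) facts(2) finite_subset by blast
  have "S' \<noteq> S" using IH(3) Suc.prems by auto
  then have "S' \<subset> S" using IH(2) by blast
  moreover have "S' \<noteq> {}" using IH(3) Suc.hyps by auto
  ultimately obtain s s' t where s: "s \<in> S'" "s' \<in> S" "s' \<notin> S'" "t \<in> T" "s \<subseteq> t" "s' \<subseteq> t"
    using minimal_cocycle_connected[OF T S(1), of S'] by blast
  have t: "card t = 3" "finite t" using triple_facts[OF T s(4)] by auto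
  have c: "card s = 2" "card s' = 2" using facts(5) s IH(2) by auto
  have fs: "finite s" "finite s'" using s t finite_subset by auto
  have union: "s \<union> s' = t"
  proof -
    have "s \<noteq> s'" using s by auto
    then have "\<not> s' \<subseteq> s" using c fs card_subset_eq[of s s'] by auto
    then have "card s < card (s \<union> s')" using fs by (intro psubset_card_mono) auto
    then have "3 \<le> card (s \<union> s')" using c by simp
    then show ?thesis using t s by (intro card_seteq) auto
  qed
  have "s' \<in> nbrs n s" using union t s facts(4) by (auto simp: nbrs_def)
  then have tree: "pair_tree n e (Suc j) (insert s' S') (insert t A)"
    using pair_tree_grow[OF IH(1) s(1), of s'] union by simp
  have sub: "insert s' S' \<subseteq> S" using IH(2) s by auto
  \<comment> \<open>A face already in \<open>A\<close> holds two pairs of \<open>S'\<close>;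
    together with \<open>s'\<close> it would hold exactly three pairs of \<open>S\<close>,
    contradicting evenness.\<close>
  have tA: "t \<notin> A"
  proof
    assume "t \<in> A"
    then have "2 \<le> card {x\<in>S'. x \<subseteq> t}" by (rule IH(7))
    moreover have "{x\<in>insert s' S'. x \<subseteq> t} = insert s' {x\<in>S'. x \<subseteq> t}" using s by auto
    ultimately have "3 \<le> card {x\<in>insert s' S'. x \<subseteq> t}" using s(3) finS' by simp
    also have "\<dots> \<le> card {x\<in>S. x \<subseteq> t}" using sub facts(2) by (intro card_mono) auto
    finally have ge: "3 \<le> card {x\<in>S. x \<subseteq> t}" .
    have "card {x\<in>S. x \<subseteq> t} \<le> 3"
    proof -
      obtain x y z where xyz: "t = {x, y, z}" "distinct [x, y, z]" using t by (auto simp: card_3_iff)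
      show ?thesis unfolding xyz(1) using card_pairs_in_triple[OF xyz(2), of S] facts(5) by simp
    qed
    then have "card {x\<in>S. x \<subseteq> t} = 3" using ge by simp
    moreover have "even (card {x\<in>S. x \<subseteq> t})" by (rule facts(6)[OF s(4)])
    ultimately show False by simp
  qed
  have "2 \<le> card {x\<in>insert s' S'. x \<subseteq> u}" if u: "u \<in> insert t A" for u
  proof (cases "u = t")
    case True
    have "card {s, s'} \<le> card {x\<in>insert s' S'. x \<subseteq> u}" using s True finS' by (intro card_mono) auto
    moreover have "s \<noteq> s'" using s(1,3) by blast
    then have "card {s, s'} = 2" by simp
    ultimately show ?thesis by simp
  next
    case False
    then have "2 \<le> card {x\<in>S'. x \<subseteq> u}" using u IH(7) by simp
    also have "\<dots> \<le> card {x\<in>insert s' S'. x \<subseteq> u}" using finS' by (intro card_mono) auto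
    finally show ?thesis .
  qed
  moreover have "card (insert s' S') = Suc j" using IH(3) s finS' by simp
  moreover have "card (insert t A) = Suc j - 1" using IH(4,6) tA Suc.hyps by simp
  ultimately show ?case using tree sub s(4) IH(5,6) by blast
qed

text \<open>Size 2 would produce a copy of \<open>M\<close>, so a minimal cocycle has size at least
  3; a tree grown to that size uses all of its pairs.\<close>

lemma obstruction_if_no_M:
  assumes T: "T \<subseteq> triples n"
    and "\<not> trivial_group (reduced_homology_F2 (complex_of_triples n T) 1)"
    and "\<nexists>a b c. copy_of_M (complex_of_triples n T) a b c"
  shows "\<exists>k\<ge>3. \<exists>e\<in>pairs n. \<exists>(S, A)\<in>pair_trees n e k. obstruction n T k S A"
proof -
  obtain S where S: "minimal_cocycle T S" using minimal_cocycle_exists[OF T assms(2)] by blast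
  note facts = minimal_cocycle_facts[OF T S]
  have "card S \<noteq> 2" using minimal_cocycle_card_2[OF T S] assms(3) by blast
  then have k: "3 \<le> card S" using minimal_cocycle_card_ge_2[OF T S] by simp
  obtain e where e: "e \<in> S" using facts(7) by blast
  obtain S' A where A: "pair_tree n e (card S) S' A" "S' \<subseteq> S" "card S' = card S" "card A = card S - 1" "A \<subseteq> T"
    using minimal_cocycle_tree[OF T S e, of "card S"] k by auto
  have "S' = S" using A(2,3) facts(2) by (simp add: card_subset_eq)
  moreover have "odd_triples n S \<inter> T = {}" using facts(6) by (auto simp: odd_triples_def)
  ultimately have "obstruction n T (card S) S A" "(S, A) \<in> pair_trees n e (card S)"
    using A odd_triples_ge_cone[OF T S] odd_triples_ge_private[OF facts(4)]
    by (auto simp: obstruction_def pair_trees_def)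
  then show ?thesis using k e facts(4) by blast
qed

section \<open>Weak copies of \<open>M\<close> and cuts\<close>

text \<open>For \<open>t\<close> in \<open>triples n\<close> with \<open>a\<close> in
  \<open>t\<close>: the triples whose arrival ends the privacy of one of the two edges of
  \<open>t\<close> at \<open>a\<close>.\<close>

definition wing :: "nat \<Rightarrow> nat \<Rightarrow> nat set \<Rightarrow> nat set set" where
  "wing n a t = {u\<in>triples n. u \<noteq> t \<and> a \<in> u \<and> u \<inter> (t - {a}) \<noteq> {}}"

definition apexed :: "nat \<Rightarrow> (nat set \<times> nat) set" where
  "apexed n = Sigma (triples n) (\<lambda>t. t)"

text \<open>\<open>M\<close> without its path condition. It only asks one triple to be present and
  its wing to be absent, so its probability is accessible; the cuts supply the path later.\<close>

definition weak_M :: "nat \<Rightarrow> nat set set \<Rightarrow> nat set \<times> nat \<Rightarrow> bool" where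
  "weak_M n T = (\<lambda>(t, a). t \<in> T \<and> wing n a t \<inter> T = {})"

lemma tripleD: "t \<in> triples n \<Longrightarrow> card t = 3 \<and> finite t \<and> t \<subseteq> {1..n}"
  using triple_facts[of "triples n" n t] by simp

lemma finite_wing [simp]: "finite (wing n a t)"
  by (simp add: wing_def)

lemma wing_subset: "wing n a t \<subseteq> triples n"
  by (auto simp: wing_def)

lemma finite_apexed [simp]: "finite (apexed n)"
  unfolding apexed_def using tripleD by (intro finite_SigmaI) auto

lemma card_apexed: "card (apexed n) = 3 * (n choose 3)"
proof -
  have "card (apexed n) = (\<Sum>t\<in>triples n. card t)"
    unfolding apexed_def using tripleD by (intro card_SigmaI) auto
  also have "\<dots> = (\<Sum>t\<in>triples n. 3)" by (rule sum.cong) (use tripleD in auto)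
  finally show ?thesis by simp
qed

lemma wing_eq:
  assumes "{a, b, c} \<in> triples n" "distinct [a, b, c]"
  shows "wing n a {a, b, c} = (\<lambda>x. {a, b, x}) ` ({1..n} - {a, b, c}) \<union> (\<lambda>x. {a, c, x}) ` ({1..n} - {a, b, c})"
proof (intro equalityI subsetI)
  fix u assume "u \<in> wing n a {a, b, c}"
  then have u: "u \<in> triples n" "u \<noteq> {a, b, c}" "a \<in> u" "b \<in> u \<or> c \<in> u" by (auto simp: wing_def)
  have cu: "card u = 3" "u \<subseteq> {1..n}" using tripleD[OF u(1)] by auto
  show "u \<in> (\<lambda>x. {a, b, x}) ` ({1..n} - {a, b, c}) \<union> (\<lambda>x. {a, c, x}) ` ({1..n} - {a, b, c})"
  proof -
    obtain y z where yz: "u = {a, y, z}" "distinct [a, y, z]" using triple_obtain[OF cu(1) u(3)] .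
    have "y \<in> {1..n}" "z \<in> {1..n}" using yz cu by auto
    consider "b = y" | "b = z" | "c = y" | "c = z" using u(4) yz assms(2) by auto
    then show ?thesis
    proof cases
      case 1
      then have "z \<in> {1..n} - {a, b, c}" using yz u(2) \<open>z \<in> {1..n}\<close> by auto
      then show ?thesis using yz(1) 1 by (intro UnI1 image_eqI[of _ _ z]) auto
    next
      case 2
      then have "y \<in> {1..n} - {a, b, c}" using yz u(2) \<open>y \<in> {1..n}\<close> by (auto simp: insert_commute)
      then show ?thesis using yz(1) 2 by (intro UnI1 image_eqI[of _ _ y]) auto
    next
      case 3
      then have "z \<in> {1..n} - {a, b, c}" using yz u(2) \<open>z \<in> {1..n}\<close> by (auto simp: insert_commute)
      then show ?thesis using yz(1) 3 by (intro UnI2 image_eqI[of _ _ z]) auto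
    next
      case 4
      then have "y \<in> {1..n} - {a, b, c}" using yz u(2) \<open>y \<in> {1..n}\<close> by (auto simp: insert_commute)
      then show ?thesis using yz(1) 4 by (intro UnI2 image_eqI[of _ _ y]) auto
    qed
  qed
next
  fix u assume u: "u \<in> (\<lambda>x. {a, b, x}) ` ({1..n} - {a, b, c}) \<union> (\<lambda>x. {a, c, x}) ` ({1..n} - {a, b, c})"
  have abc: "a \<in> {1..n}" "b \<in> {1..n}" "c \<in> {1..n}" using tripleD[OF assms(1)] by auto
  from u obtain x where x: "x \<in> {1..n}" "x \<notin> {a, b, c}" "u = {a, b, x} \<or> u = {a, c, x}" by blast
  then show "u \<in> wing n a {a, b, c}" using abc assms(2) by (auto simp: wing_def triples_def)
qed

lemma card_wing:
  assumes "(t, a) \<in> apexed n"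
  shows "card (wing n a t) = 2 * n - 6"
proof -
  have t: "t \<in> triples n" "a \<in> t" using assms by (auto simp: apexed_def)
  have "card t = 3" using tripleD[OF t(1)] by simp
  then obtain b c where bc: "t = {a, b, c}" "distinct [a, b, c]" using triple_obtain[OF _ t(2)] by blast
  let ?X = "{1..n} - {a, b, c}"
  have X: "card ?X = n - 3" using tripleD[OF t(1)] bc by (simp add: card_Diff_subset)
  have inj: "inj_on (\<lambda>x. {a, b, x}) ?X" "inj_on (\<lambda>x. {a, c, x}) ?X"
    using bc(2) by (auto simp: inj_on_def dest: equalityD1)
  have disj: "(\<lambda>x. {a, b, x}) ` ?X \<inter> (\<lambda>x. {a, c, x}) ` ?X = {}"
    using bc(2) by (auto dest: equalityD1)
  have "card (wing n a t) = card ((\<lambda>x. {a, b, x}) ` ?X \<union> (\<lambda>x. {a, c, x}) ` ?X)"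
    using wing_eq[of a b c n] t bc by simp
  also have "\<dots> = card ((\<lambda>x. {a, b, x}) ` ?X) + card ((\<lambda>x. {a, c, x}) ` ?X)"
    by (rule card_Un_disjoint) (use disj in auto)
  also have "\<dots> = 2 * n - 6" using X inj by (simp add: card_image)
  finally show ?thesis .
qed

text \<open>A triple in both wings contains an edge of \<open>t\<close> at \<open>a\<close> and an
  edge of \<open>t'\<close> at \<open>a'\<close>. These edges differ, since otherwise
  \<open>t'\<close> would lie in the wing of \<open>t\<close>; so they span the triple, and there
  are 2 choices for each.\<close>

lemma card_wing_Int_le:
  assumes "(t, a) \<in> apexed n" "(t', a') \<in> apexed n" "t \<noteq> t'" "t' \<notin> wing n a t"
  shows "card (wing n a t \<inter> wing n a' t') \<le> 4"
proof -
  have t: "t \<in> triples n" "a \<in> t" "card t = 3" "finite t" and t': "t' \<in> triples n" "a' \<in> t'" "card t' = 3" "finite t'"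
    using assms(1,2) tripleD by (auto simp: apexed_def)
  let ?P = "(t - {a}) \<times> (t' - {a'})"
  have "wing n a t \<inter> wing n a' t' \<subseteq> (\<lambda>(x, y). {a, x} \<union> {a', y}) ` ?P"
  proof
    fix u assume "u \<in> wing n a t \<inter> wing n a' t'"
    then obtain x y where u: "u \<in> triples n" "a \<in> u" "a' \<in> u" "x \<in> u" "x \<in> t - {a}" "y \<in> u" "y \<in> t' - {a'}"
      by (auto simp: wing_def)
    have "{a, x} \<noteq> {a', y}"
    proof
      assume "{a, x} = {a', y}"
      then have "a \<in> t'" "x \<in> t'" using u t' by (auto simp: doubleton_eq_iff)
      then have "t' \<in> wing n a t" using t' assms(3) u by (auto simp: wing_def)
      then show False using assms(4) by simp
    qed
    moreover have "card {a, x} = 2" "card {a', y} = 2" using u by auto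
    ultimately have "\<not> {a', y} \<subseteq> {a, x}" using card_subset_eq[of "{a, x}" "{a', y}"] by auto
    then have "card {a, x} < card ({a, x} \<union> {a', y})" by (intro psubset_card_mono) auto
    then have "card u \<le> card ({a, x} \<union> {a', y})" using tripleD[OF u(1)] \<open>card {a, x} = 2\<close> by simp
    then have "{a, x} \<union> {a', y} = u" using tripleD[OF u(1)] u by (intro card_seteq) auto
    then show "u \<in> (\<lambda>(x, y). {a, x} \<union> {a', y}) ` ?P" using u by (intro image_eqI[of _ _ "(x, y)"]) auto
  qed
  then have "card (wing n a t \<inter> wing n a' t') \<le> card ?P" by (rule surj_card_le[rotated]) (use t t' in auto)
  also have "card ?P = 4" using t t' by (simp add: card_cartesian_product)
  finally show ?thesis .
qed

lemma weak_M_if_copy_of_M: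
  assumes T: "T \<subseteq> triples n" and M: "copy_of_M (complex_of_triples n T) a b c"
  shows "({a, b, c}, a) \<in> apexed n" "weak_M n T ({a, b, c}, a)"
proof -
  have abc: "{a, b, c} \<in> T" and only: "\<And>f. f \<in> T \<Longrightarrow> {a, b} \<subseteq> f \<or> {a, c} \<subseteq> f \<Longrightarrow> f = {a, b, c}"
    using M[unfolded copy_of_M_iff[OF T]] by blast+
  show "({a, b, c}, a) \<in> apexed n" using T abc by (auto simp: apexed_def)
  have "u \<notin> T" if "u \<in> wing n a {a, b, c}" for u
  proof
    assume "u \<in> T"
    moreover have "{a, b} \<subseteq> u \<or> {a, c} \<subseteq> u" "u \<noteq> {a, b, c}" using that unfolding wing_def by blast+
    ultimately show False using only by blast
  qed
  then show "weak_M n T ({a, b, c}, a)" using abc unfolding weak_M_def by blast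
qed

lemma copy_of_M_if_weak_M:
  assumes T: "T \<subseteq> triples n" and w: "(t, a) \<in> apexed n" "weak_M n T (t, a)"
    and cuts: "\<And>A. \<lbrakk>A \<subseteq> {1..n}; A \<noteq> {}; A \<noteq> {1..n}\<rbrakk> \<Longrightarrow> 2 \<le> card (T \<inter> crossing n A)"
  shows "\<exists>b c. copy_of_M (complex_of_triples n T) a b c"
proof -
  have t: "t \<in> T" "a \<in> t" "card t = 3" using w tripleD by (auto simp: weak_M_def apexed_def)
  obtain b c where bc: "t = {a, b, c}" "distinct [a, b, c]" using triple_obtain[OF t(3,2)] by blast
  have only: "f = {a, b, c}" if f: "f \<in> T" "{a, b} \<subseteq> f \<or> {a, c} \<subseteq> f" for f
  proof (rule ccontr)
    assume "f \<noteq> {a, b, c}"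
    then have "f \<in> wing n a t" using f T bc by (auto simp: wing_def)
    then show False using f w by (auto simp: weak_M_def)
  qed
  have "copy_of_M (complex_of_triples n T) a b c"
    by (rule copy_of_M_if_cuts[OF T bc(2) _ only cuts]) (use t bc in simp_all)
  then show ?thesis by blast
qed

lemma real_choose_3: "real (k choose 3) = real k * (real k - 1) * (real k - 2) / 6"
proof (induction k)
  case (Suc k)
  have "real (k choose 2) = real k * (real k - 1) / 2"
    using choose_two[of k] by (cases k) (auto simp: real_of_nat_div algebra_simps)
  then show ?case using Suc by (simp add: numeral_3_eq_3 numeral_2_eq_2 field_simps)
qed simp

text \<open>The triples that do not cross lie inside \<open>A\<close> or inside its complement, so
  the count is C(n,3) - C(a,3) - C(n-a,3) with a = card A.\<close>

lemma card_crossing: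
  assumes "A \<subseteq> {1..n}"
  shows "real (card (crossing n A)) = real (card A) * (real n - real (card A)) * (real n - 2) / 2"
proof -
  let ?B = "{1..n} - A"
  let ?X = "{t. t \<subseteq> A \<and> card t = 3}" and ?Y = "{t. t \<subseteq> ?B \<and> card t = 3}"
  have finA: "finite A" using assms finite_subset by blast
  have le: "card A \<le> n" using card_mono[OF _ assms] by simp
  have X: "card ?X = card A choose 3" by (rule n_subsets[OF finA])
  have Y: "card ?Y = (n - card A) choose 3"
    using n_subsets[of ?B 3] card_Diff_subset[OF finA assms] by simp
  have "triples n = crossing n A \<union> (?X \<union> ?Y)" using assms by (auto simp: crossing_def triples_def)
  moreover have fin: "finite ?X" "finite ?Y" "finite (crossing n A)" using finA by (auto simp: crossing_def)
  moreover have "crossing n A \<inter> (?X \<union> ?Y) = {}" by (auto simp: crossing_def)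
  ultimately have "n choose 3 = card (crossing n A) + card (?X \<union> ?Y)"
    using card_Un_disjoint[of "crossing n A" "?X \<union> ?Y"] card_triples[of n] by simp
  moreover have "?X \<inter> ?Y = {}"
  proof -
    have "t = {}" if "t \<subseteq> A" "t \<subseteq> ?B" for t using that by auto
    then have "card t = 0" if "t \<subseteq> A" "t \<subseteq> ?B" for t using that by (metis card.empty)
    then show ?thesis by fastforce
  qed
  then have "card (?X \<union> ?Y) = (card A choose 3) + ((n - card A) choose 3)"
    using card_Un_disjoint[OF fin(1,2)] X Y by simp
  ultimately have "real (n choose 3) = real (card (crossing n A)) + real (card A choose 3) + real ((n - card A) choose 3)"
    by simp
  then show ?thesis using le by (simp add: real_choose_3 of_nat_diff field_simps)
qed

text \<open>Adding a triple t covers three new pairs, except for pairs already covered by some u.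
  Each exception e equals the intersection of t and u, so it can be charged to the ordered pair (t,
  u), injectively in e.\<close>

lemma three_card_le_covered:
  assumes "T \<subseteq> triples n"
  shows "3 * card T \<le> card (covered_pairs T) + card {(t, u). t \<in> T \<and> u \<in> T \<and> card (t \<inter> u) = 2}"
proof -
  have "finite T" using assms finite_subset finite_triples by blast
  then show ?thesis using assms
  proof (induction T rule: finite_induct)
    case empty
    then show ?case by simp
  next
    case (insert t T)
    let ?P = "\<lambda>T. {(t, u). t \<in> T \<and> u \<in> T \<and> card (t \<inter> u) = 2}"
    let ?e = "{e. e \<subseteq> t \<and> card e = 2}"
    have T: "T \<subseteq> triples n" and t: "t \<in> triples n" using insert by auto
    have ct: "card t = 3" "finite t" using tripleD[OF t] by auto
    have fe: "finite ?e" using ct by simp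
    have ce: "card ?e = 3" using n_subsets[OF ct(2), of 2] ct(1) by (simp add: numeral_eq_Suc)
    have fc: "finite (covered_pairs T)" by (rule finite_covered[OF T])
    have cov: "covered_pairs (insert t T) = covered_pairs T \<union> ?e" by (auto simp: covered_pairs_def)
    have 1: "card (covered_pairs (insert t T)) + card (covered_pairs T \<inter> ?e) = card (covered_pairs T) + 3"
      unfolding cov using card_Un_Int[OF fc fe] ce by simp
    have ex: "\<forall>e\<in>covered_pairs T \<inter> ?e. \<exists>u. u \<in> T \<and> t \<inter> u = e"
    proof
      fix e assume e: "e \<in> covered_pairs T \<inter> ?e"
      then obtain u where u: "u \<in> T" "e \<subseteq> u" by (auto simp: covered_pairs_def)
      have "u \<in> triples n" using u(1) T by blast
      then have "card u = 3" "finite u" using tripleD by auto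
      have "u \<noteq> t" using u(1) insert.hyps(2) by blast
      have "\<not> t \<subseteq> u"
        using ct card_subset_eq[of u t] \<open>card u = 3\<close> \<open>finite u\<close> \<open>u \<noteq> t\<close> by simp blast
      then have "t \<inter> u \<subset> t" by auto
      then have "card (t \<inter> u) \<le> 2" using psubset_card_mono[OF ct(2), of "t \<inter> u"] ct(1) by simp
      moreover have "e \<subseteq> t \<inter> u" "card e = 2" using e u by auto
      ultimately have "e = t \<inter> u" using ct(2) by (intro card_seteq) simp_all
      then show "\<exists>u. u \<in> T \<and> t \<inter> u = e" using u(1) by blast
    qed
    obtain g where gg: "\<forall>e\<in>covered_pairs T \<inter> ?e. g e \<in> T \<and> t \<inter> g e = e" using bchoice[OF ex] ..
    have g: "g e \<in> T \<and> t \<inter> g e = e" if "e \<in> covered_pairs T \<inter> ?e" for e using gg that by (rule bspec)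
    have finP: "finite (?P X)" if "finite X" for X :: "nat set set"
      by (rule finite_subset[of _ "X \<times> X"]) (use that in auto)
    have inj: "inj_on (\<lambda>e. (t, g e)) (covered_pairs T \<inter> ?e)"
    proof (rule inj_onI)
      fix e f assume e: "e \<in> covered_pairs T \<inter> ?e" and f: "f \<in> covered_pairs T \<inter> ?e"
        and eq: "(t, g e) = (t, g f)"
      have "e = t \<inter> g e" using g[OF e] by (rule conjunct2[THEN sym])
      also have "\<dots> = t \<inter> g f" using eq by simp
      also have "\<dots> = f" using g[OF f] by (rule conjunct2)
      finally show "e = f" .
    qed
    have "card (?P T) + card (covered_pairs T \<inter> ?e) = card (?P T) + card ((\<lambda>e. (t, g e)) ` (covered_pairs T \<inter> ?e))"
      using card_image[OF inj] by simp
    also have "\<dots> = card (?P T \<union> (\<lambda>e. (t, g e)) ` (covered_pairs T \<inter> ?e))"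
      by (rule card_Un_disjoint[symmetric]) (use insert.hyps finP[of T] fc in auto)
    also have "\<dots> \<le> card (?P (insert t T))"
    proof (rule card_mono)
      show "finite (?P (insert t T))" using insert by (intro finP) simp
      show "?P T \<union> (\<lambda>e. (t, g e)) ` (covered_pairs T \<inter> ?e) \<subseteq> ?P (insert t T)"
      proof -
        have "card (t \<inter> g e) = 2 \<and> g e \<in> T" if "e \<in> covered_pairs T \<inter> ?e" for e
        proof -
          have "card e = 2" using that by simp
          then show ?thesis using g[OF that] by (simp only: simp_thms)
        qed
        then show ?thesis by auto
      qed
    qed
    finally have 2: "card (?P T) + card (covered_pairs T \<inter> ?e) \<le> card (?P (insert t T))" .
    have "3 * card T \<le> card (covered_pairs T) + card (?P T)" by (rule insert.IH[OF T])
    moreover have "card (insert t T) = Suc (card T)" using insert by simp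
    ultimately show ?case using 1 2 by linarith
  qed
qed

section \<open>Probability bounds\<close>

lemma one_minus_power_le_exp:
  fixes p :: real
  assumes "0 \<le> p" "p \<le> 1"
  shows "(1 - p) ^ k \<le> exp (- p * real k)"
proof -
  have "(1 - p) ^ k \<le> exp (- p) ^ k"
    using exp_ge_add_one_self[of "- p"] assms by (intro power_mono) auto
  also have "\<dots> = exp (- p * real k)" by (simp add: exp_of_nat_mult[symmetric] mult.commute)
  finally show ?thesis .
qed

lemma ratio_le_1: "m \<le> k \<Longrightarrow> real m / real k \<le> 1"
  by (cases "k = 0") auto

lemma Pr_absent_le:
  assumes "B \<subseteq> triples n" "card B < n choose 3" "m \<le> n choose 3" "k \<le> card B"
  shows "Pr n {ts. B \<inter> set (take m ts) = {}} \<le> (1 - real m / real (n choose 3)) ^ k"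
proof -
  have "Pr n {ts. B \<inter> set (take m ts) = {}} = Pr n {ts. {} \<subseteq> set (take 0 ts) \<and> B \<inter> set (take m ts) = {}}"
    by simp
  also have "\<dots> \<le> (1 - real m / real (n choose 3)) ^ card B *
      (real 0 / real ((n choose 3) - card B)) ^ card ({} :: nat set set)"
    by (rule Pr_present_absent_le) (use assms in auto)
  also have "\<dots> = (1 - real m / real (n choose 3)) ^ card B" by simp
  also have "\<dots> \<le> (1 - real m / real (n choose 3)) ^ k"
    using assms ratio_le_1[OF assms(3)] by (intro power_decreasing) auto
  finally show ?thesis .
qed

lemma Pr_absent_le_exp:
  assumes "B \<subseteq> triples n" "m \<le> n choose 3" "k \<le> card B" "k < n choose 3"
  shows "Pr n {ts. B \<inter> set (take m ts) = {}} \<le> exp (- (real m / real (n choose 3)) * real k)"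
proof -
  obtain B' where B': "B' \<subseteq> B" "card B' = k" using obtain_subset_with_card_n[OF assms(3)] by blast
  have "Pr n {ts. B \<inter> set (take m ts) = {}} \<le> Pr n {ts. B' \<inter> set (take m ts) = {}}"
    by (rule measure_pmf.finite_measure_mono) (use B' in auto)
  also have "\<dots> \<le> (1 - real m / real (n choose 3)) ^ k"
    by (rule Pr_absent_le) (use assms B' in auto)
  also have "\<dots> \<le> exp (- (real m / real (n choose 3)) * real k)"
    by (rule one_minus_power_le_exp) (use ratio_le_1[OF assms(2)] in auto)
  finally show ?thesis .
qed

definition star :: "nat \<Rightarrow> nat \<Rightarrow> nat set set" where
  "star n v = {t\<in>triples n. v \<in> t}"

lemma card_star:
  assumes "v \<in> {1..n}"
  shows "card (star n v) = (n - 1) choose 2"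
proof -
  let ?P = "{e. e \<subseteq> {1..n} - {v} \<and> card e = 2}"
  have "bij_betw (insert v) ?P (star n v)"
  proof (rule bij_betwI[where g = "\<lambda>t. t - {v}"])
    show "insert v \<in> ?P \<rightarrow> star n v"
    proof
      fix e assume "e \<in> ?P"
      then have e: "e \<subseteq> {1..n}" "v \<notin> e" "card e = 2" "finite e" by (auto intro: card_ge_0_finite)
      then show "insert v e \<in> star n v" using assms by (auto simp: star_def triples_def)
    qed
    show "(\<lambda>t. t - {v}) \<in> star n v \<rightarrow> ?P" using tripleD by (fastforce simp: star_def)
  qed (auto simp: star_def)
  then have "card (star n v) = card ?P" by (simp add: bij_betw_same_card)
  also have "\<dots> = card ({1..n} - {v}) choose 2" by (rule n_subsets) simp
  finally show ?thesis using assms by simp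
qed

lemma card_star_Int_le:
  assumes "u \<in> {1..n}" "v \<in> {1..n}" "u \<noteq> v"
  shows "card (star n u \<inter> star n v) \<le> n"
proof -
  have "star n u \<inter> star n v \<subseteq> (\<lambda>w. {u, v, w}) ` {1..n}"
  proof
    fix t assume "t \<in> star n u \<inter> star n v"
    then have t: "t \<in> triples n" "u \<in> t" "v \<in> t" by (auto simp: star_def)
    have "card t = 3" using tripleD[OF t(1)] by simp
    then obtain x y where xy: "t = {u, x, y}" "distinct [u, x, y]" using triple_obtain[OF _ t(2)] by blast
    then have "t = {u, v, x} \<or> t = {u, v, y}" using t(3) assms(3) by auto
    moreover have "x \<in> {1..n}" "y \<in> {1..n}" using xy tripleD[OF t(1)] by auto
    ultimately show "t \<in> (\<lambda>w. {u, v, w}) ` {1..n}" by blast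
  qed
  then have "card (star n u \<inter> star n v) \<le> card {1..n}" by (rule surj_card_le[rotated]) simp
  then show ?thesis by simp
qed

text \<open>Second moment for the vertices whose star is missed by the first n triples. Two stars
  share at most n triples, so two vertices being isolated requires at least \<open>2 * b - n\<close>
  absences.\<close>

lemma Pr_no_isolated_le:
  fixes n :: nat
  defines "N \<equiv> n choose 3" and "b \<equiv> (n - 1) choose 2"
  assumes "n \<ge> 1" "n + b \<le> N" "2 * b < N" "b + 1 \<le> N" "n < N - b"
  shows "Pr n {ts. \<forall>v\<in>{1..n}. \<exists>t\<in>set (take n ts). v \<in> t} \<le>
    1 / (real n * (1 - real n / real (N - b)) ^ b) +
    (1 - real n / real N) ^ (2 * b - n) / ((1 - real n / real (N - b)) ^ b)\<^sup>2 - 1"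
proof -
  let ?q = "(1 - real n / real (N - b)) ^ b"
  let ?r = "(1 - real n / real N) ^ (2 * b - n)"
  let ?S = "\<lambda>v. {ts. star n v \<inter> set (take n ts) = {}}"
  have sub: "star n v \<subseteq> triples n" for v by (auto simp: star_def)
  have "Pr n {ts. \<forall>v\<in>{1..n}. \<exists>t\<in>set (take n ts). v \<in> t} \<le> Pr n {ts. \<forall>v\<in>{1..n}. ts \<notin> ?S v}"
  proof (rule Pr_mono_on_process)
    fix ts assume ts: "set ts = triples n" "ts \<in> {ts. \<forall>v\<in>{1..n}. \<exists>t\<in>set (take n ts). v \<in> t}"
    have "set (take n ts) \<subseteq> triples n" using ts(1) set_take_subset[of n ts] by simp
    then show "ts \<in> {ts. \<forall>v\<in>{1..n}. ts \<notin> ?S v}" using ts(2) by (fastforce simp: star_def)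
  qed
  also have "\<dots> \<le> real 1 / (real (card {1..n}) * ?q) + ?r / ?q\<^sup>2 - 1"
  proof (rule Pr_none_le_second_moment[where R = "(=)"])
    have "real n / real (N - b) < 1" using assms by simp
    then show "0 < ?q" by simp
    have "real n / real N \<le> 1" using assms(4) by (intro ratio_le_1) simp
    then show "0 \<le> ?r" by simp
    show "card {j\<in>{1..n}. i = j} \<le> 1" for i
      using card_mono[of "{i}" "{j\<in>{1..n}. i = j}"] by auto
    show "?q \<le> Pr n (?S v)" if "v \<in> {1..n}" for v
      using Pr_present_absent_ge[of "{}" n "star n v" n n] sub card_star[OF that] assms by simp
    show "Pr n (?S u \<inter> ?S v) \<le> ?r" if uv: "u \<in> {1..n}" "v \<in> {1..n}" "u \<noteq> v" for u v
    proof -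
      have fin: "finite (star n u)" "finite (star n v)" by (auto simp: star_def)
      have eq: "card (star n u \<union> star n v) + card (star n u \<inter> star n v) = 2 * b"
        using card_Un_Int[OF fin] card_star uv unfolding b_def by simp
      have "?S u \<inter> ?S v = {ts. (star n u \<union> star n v) \<inter> set (take n ts) = {}}" by auto
      then show ?thesis
        using Pr_absent_le[of "star n u \<union> star n v" n n "2 * b - n"] sub eq card_star_Int_le[OF uv] assms
        by simp
    qed
  qed (use assms in auto)
  finally show ?thesis by simp
qed

lemma weak_M_between:
  assumes "t \<in> T" "wing n a t \<inter> T' = {}" "T \<subseteq> X" "X \<subseteq> T'"
  shows "weak_M n X (t, a)"
  using assms unfolding weak_M_def by blast

text \<open>Second moment over triples with a chosen apex. Only choices with the same triple count
  as dependent; for different triples the wings share at most four triples, so the joint probability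
  is nearly a product.\<close>

lemma Pr_no_survivor_le:
  fixes n m m' :: nat
  defines "N \<equiv> n choose 3" and "b \<equiv> 2 * n - 6"
  assumes "n \<ge> 5" "1 \<le> m" "m \<le> m'" "m' + 2 * b < N"
  defines "q \<equiv> real m / real N * (1 - real m' / real (N - b)) ^ b"
    and "r \<equiv> (real m / real (N - 2 * b))\<^sup>2 * (1 - real m' / real N) ^ (2 * b - 4)"
  shows "Pr n {ts. \<not> (\<exists>(t, a)\<in>apexed n. t \<in> set (take m ts) \<and> wing n a t \<inter> set (take m' ts) = {})} \<le>
    1 / (real N * q) + r / q\<^sup>2 - 1"
proof -
  let ?S = "\<lambda>(t, a). {ts. {t} \<subseteq> set (take m ts) \<and> wing n a t \<inter> set (take m' ts) = {}}"
  let ?R = "\<lambda>(t :: nat set, a :: nat) (t', a' :: nat). t = t'"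
  have N: "N > 0" using assms by simp
  have mN: "real m' / real N \<le> 1" using assms by (intro ratio_le_1) simp
  have tw: "t \<notin> wing n a t" for t a by (simp add: wing_def)
  have "Pr n {ts. \<not> (\<exists>(t, a)\<in>apexed n. t \<in> set (take m ts) \<and> wing n a t \<inter> set (take m' ts) = {})} =
      Pr n {ts. \<forall>c\<in>apexed n. ts \<notin> ?S c}"
    by (rule arg_cong[of _ _ "Pr n"]) auto
  also have "\<dots> \<le> real 3 / (real (card (apexed n)) * q) + r / q\<^sup>2 - 1"
  proof (rule Pr_none_le_second_moment[where R = ?R])
    show "finite (apexed n)" by simp
    show "apexed n \<noteq> {}" using card_apexed[of n] N unfolding N_def by force
    have "real m' / real (N - b) < 1" using assms by simp
    then show "0 < q" unfolding q_def using N assms by simp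
    show "0 \<le> r" unfolding r_def using mN by simp
    show "q \<le> Pr n (?S c)" if "c \<in> apexed n" for c
    proof -
      obtain t a where c: "c = (t, a)" by (cases c)
      have t: "t \<in> triples n" using that c by (auto simp: apexed_def)
      have cw: "card (wing n a t) = b" using card_wing[of t a n] that c by (simp add: b_def)
      have le: "m \<le> m'" "m' + b \<le> N" "b + 1 \<le> N" using assms(4-6) by linarith+
      have "(real m / real N) ^ card {t} * (1 - real m' / real (N - card (wing n a t))) ^ card (wing n a t) \<le>
          Pr n {ts. {t} \<subseteq> set (take m ts) \<and> wing n a t \<inter> set (take m' ts) = {}}"
        unfolding N_def
        by (rule Pr_present_absent_ge) (use t tw[of t a] wing_subset cw le in \<open>auto simp: N_def\<close>)
      then show ?thesis unfolding cw c q_def by simp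
    qed
    show "card {d\<in>apexed n. ?R c d} \<le> 3" if "c \<in> apexed n" for c
    proof -
      obtain t a where c: "c = (t, a)" by (cases c)
      have "{d\<in>apexed n. ?R c d} \<subseteq> Pair t ` t" using c by (auto simp: apexed_def)
      moreover have "card t = 3" "finite t" using that c tripleD by (auto simp: apexed_def)
      ultimately show ?thesis using surj_card_le[of t _ "Pair t"] by simp
    qed
    show "Pr n (?S c \<inter> ?S d) \<le> r" if cd: "c \<in> apexed n" "d \<in> apexed n" "\<not> ?R c d" for c d
    proof -
      obtain t a where c: "c = (t, a)" by (cases c)
      obtain t' a' where d: "d = (t', a')" by (cases d)
      have tt: "t \<noteq> t'" "t \<in> triples n" "t' \<in> triples n" using cd c d by (auto simp: apexed_def)
      show ?thesis
      proof (cases "t' \<in> wing n a t \<or> t \<in> wing n a' t'")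
        case True
        \<comment> \<open>A triple lying in the wing of the other would have to be present at
          \<open>m\<close> and still absent at the later time \<open>m'\<close>.\<close>
        have "set (take m ts) \<subseteq> set (take m' ts)" for ts :: "nat set list"
          using assms by (intro set_take_subset_set_take)
        then have "?S c \<inter> ?S d = {}" using True c d by fastforce
        then show ?thesis using \<open>0 \<le> r\<close> by simp
      next
        case False
        let ?W = "wing n a t \<union> wing n a' t'"
        have le4: "card (wing n a t \<inter> wing n a' t') \<le> 4"
          using card_wing_Int_le[of t a n t' a'] cd c d tt False by simp
        have W: "card ?W + card (wing n a t \<inter> wing n a' t') = 2 * b"
          using card_Un_Int[of "wing n a t" "wing n a' t'"] card_wing cd c d by (simp add: b_def)
        have W2: "card ?W \<le> 2 * b" "2 * b - 4 \<le> card ?W" using W le4 by linarith+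
        have "?S c \<inter> ?S d = {ts. {t, t'} \<subseteq> set (take m ts) \<and> ?W \<inter> set (take m' ts) = {}}"
          using c d by auto
        also have "Pr n \<dots> \<le> (1 - real m' / real N) ^ card ?W * (real m / real (N - card ?W)) ^ card {t, t'}"
          unfolding N_def
          by (rule Pr_present_absent_le) (use tt tw False wing_subset W2 assms in auto)
        also have "\<dots> \<le> (1 - real m' / real N) ^ (2 * b - 4) * (real m / real (N - 2 * b)) ^ 2"
        proof (rule mult_mono)
          show "(1 - real m' / real N) ^ card ?W \<le> (1 - real m' / real N) ^ (2 * b - 4)"
            using mN W2 by (intro power_decreasing) auto
          have "real m / real (N - card ?W) \<le> real m / real (N - 2 * b)"
            using W2 assms by (intro divide_left_mono) auto
          moreover have "card {t, t'} = 2" using tt(1) by simp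
          ultimately show "(real m / real (N - card ?W)) ^ card {t, t'} \<le> (real m / real (N - 2 * b)) ^ 2"
            by (simp add: power_mono del: power2_eq_square)
        qed (use mN in auto)
        finally show ?thesis unfolding r_def by (simp add: mult.commute)
      qed
    qed
  qed
  \<comment> \<open>The three apexes per triple cancel against
    \<open>card (apexed n) = 3 * N\<close>.\<close>
  also have "real 3 / (real (card (apexed n)) * q) = 1 / (real N * q)"
    by (simp add: card_apexed N_def)
  finally show ?thesis .
qed

text \<open>Absence of the wing can only be lost in time, so a weak copy can appear only when its
  triple arrives before the whole wing. The first-arrival bound treats all arrival times together
  and gains the factor 1/(2n-5).\<close>

lemma Pr_weak_M_born_le:
  assumes "n \<ge> 4" "2 * n - 5 < n choose 3" "m \<le> n choose 3"
  shows "Pr n {ts. \<exists>(t, a)\<in>apexed n. \<exists>s. m \<le> s \<and> s < length ts \<and> ts ! s = t \<and> wing n a t \<inter> set (take s ts) = {}} \<le>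
    3 * real (n choose 3) * ((1 - real m / real (n choose 3)) ^ (2 * n - 5) / real (2 * n - 5))"
proof -
  let ?S = "\<lambda>(t, a). {ts. \<exists>s. m \<le> s \<and> s < length ts \<and> ts ! s = t \<and> wing n a t \<inter> set (take s ts) = {}}"
  have "Pr n {ts. \<exists>(t, a)\<in>apexed n. \<exists>s. m \<le> s \<and> s < length ts \<and> ts ! s = t \<and> wing n a t \<inter> set (take s ts) = {}} =
      Pr n {ts. \<exists>c\<in>apexed n. ts \<in> ?S c}"
    by (rule arg_cong[of _ _ "Pr n"]) auto
  also have "\<dots> \<le> (\<Sum>c\<in>apexed n. (1 - real m / real (n choose 3)) ^ (2 * n - 5) / real (2 * n - 5))"
  proof (rule Pr_union_bound)
    fix c assume c: "c \<in> apexed n"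
    obtain t a where ta: "c = (t, a)" by (cases c)
    have "2 * n - 6 + 1 = 2 * n - 5" using assms by simp
    then have "card (wing n a t) + 1 = 2 * n - 5" using card_wing[of t a n] c ta by simp
    then show "Pr n (?S c) \<le> (1 - real m / real (n choose 3)) ^ (2 * n - 5) / real (2 * n - 5)"
      using Pr_first_after_le[of t n "wing n a t" m] c ta wing_subset assms
      by (auto simp: apexed_def wing_def)
  qed simp
  finally show ?thesis by (simp add: card_apexed)
qed

lemma Pr_weak_M_le:
  fixes n m :: nat
  defines "N \<equiv> n choose 3" and "b \<equiv> 2 * n - 6"
  assumes "b < N" "m \<le> N - b"
  shows "Pr n {ts. \<exists>c\<in>apexed n. weak_M n (set (take m ts)) c} \<le>
    3 * real N * ((1 - real m / real N) ^ b * (real m / real (N - b)))"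
proof -
  have "Pr n {ts. \<exists>c\<in>apexed n. ts \<in> {ts. weak_M n (set (take m ts)) c}} \<le>
      (\<Sum>c\<in>apexed n. (1 - real m / real N) ^ b * (real m / real (N - b)))"
  proof (rule Pr_union_bound)
    fix c assume c: "c \<in> apexed n"
    obtain t a where ta: "c = (t, a)" by (cases c)
    have "{ts. weak_M n (set (take m ts)) c} = {ts. {t} \<subseteq> set (take m ts) \<and> wing n a t \<inter> set (take m ts) = {}}"
      by (simp add: weak_M_def ta)
    then show "Pr n {ts. weak_M n (set (take m ts)) c} \<le> (1 - real m / real N) ^ b * (real m / real (N - b))"
      using Pr_present_absent_le[of "{t}" n "wing n a t" m m] card_wing[of t a n] c ta wing_subset assms
      by (auto simp: apexed_def wing_def)
  qed simp
  then show ?thesis by (simp add: card_apexed N_def)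
qed

lemma Pr_markov:
  assumes "finite I" "c > 0" "\<And>i. i \<in> I \<Longrightarrow> Pr n (S i) \<le> p"
  shows "Pr n {ts. c \<le> real (card {i\<in>I. ts \<in> S i})} \<le> real (card I) * p / c"
proof -
  define X where "X ts = (\<Sum>i\<in>I. indicator (S i) ts :: real)" for ts
  have X: "X ts = real (card {i\<in>I. ts \<in> S i})" for ts
    using assms(1) by (simp add: X_def indicator_def sum.If_cases Int_def)
  have int: "integrable (measure_pmf (full_process n)) X"
    unfolding X_def by (intro Bochner_Integration.integrable_sum) (auto intro!: measure_pmf.integrable_const_bound[where B = 1])
  have EX: "measure_pmf.expectation (full_process n) X = (\<Sum>i\<in>I. Pr n (S i))"
    unfolding X_def by (subst Bochner_Integration.integral_sum) (auto intro!: measure_pmf.integrable_const_bound[where B = 1])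
  have "Pr n {ts. c \<le> X ts} \<le> measure_pmf.expectation (full_process n) X / c"
  proof -
    have "0 \<le> X ts" for ts by (simp add: X)
    then show ?thesis using integral_Markov_inequality_measure[OF int, of UNIV c] assms(2) by simp
  qed
  also have "\<dots> \<le> real (card I) * p / c"
    unfolding EX using sum_mono[of I "\<lambda>i. Pr n (S i)" "\<lambda>_. p"] assms by (intro divide_right_mono) auto
  finally show ?thesis by (simp add: X)
qed

text \<open>Markov with threshold n: there are at most 3nN ordered pairs of triples sharing an edge
  (3 vertices to drop, n to add), and each pair is present with probability at most (m/N)^2.\<close>

lemma Pr_overlaps_le:
  assumes "n \<ge> 3" "m \<le> n choose 3"
  shows "Pr n {ts. n \<le> card {(t, u). t \<in> set (take m ts) \<and> u \<in> set (take m ts) \<and> card (t \<inter> u) = 2}} \<le>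
    3 * (real m)\<^sup>2 / real (n choose 3)"
proof -
  let ?I = "{(t, u). t \<in> triples n \<and> u \<in> triples n \<and> card (t \<inter> u) = 2}"
  let ?S = "\<lambda>(t, u). {ts. {t, u} \<subseteq> set (take m ts)}"
  let ?N = "n choose 3"
  have N: "real ?N > 0" using assms by simp
  have fin: "finite ?I" by (rule finite_subset[of _ "triples n \<times> triples n"]) auto
  have cardI: "card ?I \<le> ?N * (3 * n)"
  proof -
    have "?I \<subseteq> (\<Union>t\<in>triples n. Pair t ` (\<lambda>(x, w). insert w (t - {x})) ` (t \<times> {1..n}))"
    proof clarify
      fix t u assume tu: "t \<in> triples n" "u \<in> triples n" "card (t \<inter> u) = 2"
      have t: "card t = 3" "finite t" and u: "card u = 3" "finite u" "u \<subseteq> {1..n}" using tripleD tu by auto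
      have "card (t - u) = 1" "card (u - t) = 1"
        using card_Int_Diff[OF t(2), of u] card_Int_Diff[OF u(2), of t] t u tu(3) by (auto simp: Int_commute)
      then obtain x w where xw: "t - u = {x}" "u - t = {w}" by (auto simp: card_1_singleton_iff)
      then have "u = insert w (t - {x})" by blast
      moreover have "x \<in> t" "w \<in> {1..n}" using xw u by auto
      ultimately have "u \<in> (\<lambda>(x, w). insert w (t - {x})) ` (t \<times> {1..n})"
        by (intro image_eqI[of _ _ "(x, w)"]) simp_all
      then show "(t, u) \<in> (\<Union>t\<in>triples n. Pair t ` (\<lambda>(x, w). insert w (t - {x})) ` (t \<times> {1..n}))"
        using tu(1) by blast
    qed
    then have "card ?I \<le> card (\<Union>t\<in>triples n. Pair t ` (\<lambda>(x, w). insert w (t - {x})) ` (t \<times> {1..n}))"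
      using tripleD by (intro card_mono) auto
    also have "\<dots> \<le> (\<Sum>t\<in>triples n. card (Pair t ` (\<lambda>(x, w). insert w (t - {x})) ` (t \<times> {1..n})))"
      by (rule card_UN_le) simp
    also have "\<dots> \<le> (\<Sum>t\<in>triples n. 3 * n)"
    proof (rule sum_mono)
      fix t assume "t \<in> triples n"
      then have t: "finite t" "card t = 3" using tripleD by auto
      have "card (Pair t ` (\<lambda>(x, w). insert w (t - {x})) ` (t \<times> {1..n})) \<le> card (t \<times> {1..n})"
        using t by (meson card_image_le finite_SigmaI finite_atLeastAtMost finite_imageI order_trans)
      then show "card (Pair t ` (\<lambda>(x, w). insert w (t - {x})) ` (t \<times> {1..n})) \<le> 3 * n"
        using t by (simp add: card_cartesian_product)
    qed
    finally show ?thesis by simp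
  qed
  have "Pr n {ts. n \<le> card {(t, u). t \<in> set (take m ts) \<and> u \<in> set (take m ts) \<and> card (t \<inter> u) = 2}} \<le>
      Pr n {ts. real n \<le> real (card {i\<in>?I. ts \<in> ?S i})}"
  proof (rule Pr_mono_on_process)
    fix ts assume ts: "set ts = triples n"
      "ts \<in> {ts. n \<le> card {(t, u). t \<in> set (take m ts) \<and> u \<in> set (take m ts) \<and> card (t \<inter> u) = 2}}"
    have sub: "set (take m ts) \<subseteq> triples n" using ts(1) set_take_subset[of m ts] by simp
    have "{(t, u). t \<in> set (take m ts) \<and> u \<in> set (take m ts) \<and> card (t \<inter> u) = 2} = {i\<in>?I. ts \<in> ?S i}"
      using sub by auto
    then show "ts \<in> {ts. real n \<le> real (card {i\<in>?I. ts \<in> ?S i})}" using ts(2) by simp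
  qed
  also have "\<dots> \<le> real (card ?I) * (real m / real ?N)\<^sup>2 / real n"
  proof (rule Pr_markov[OF fin])
    show "0 < real n" using assms by simp
    fix i assume i: "i \<in> ?I"
    obtain t u where tu: "i = (t, u)" by (cases i)
    have "t \<noteq> u" using i tu tripleD[of t n] by auto
    then have "Pr n {ts. {t, u} \<subseteq> set (take m ts) \<and> {} \<inter> set (take m ts) = {}} \<le>
        (1 - real m / real ?N) ^ card ({} :: nat set set) * (real m / real (?N - card ({} :: nat set set))) ^ card {t, u}"
      using i tu assms by (intro Pr_present_absent_le) auto
    then show "Pr n (?S i) \<le> (real m / real ?N)\<^sup>2"
      using tu \<open>t \<noteq> u\<close> by (simp add: power2_eq_square)
  qed
  also have "\<dots> \<le> (real ?N * (3 * real n)) * (real m / real ?N)\<^sup>2 / real n"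
  proof -
    have "real (card ?I) \<le> real ?N * (3 * real n)" using of_nat_mono[OF cardI, where 'a = real] by simp
    then show ?thesis by (intro divide_right_mono mult_right_mono) auto
  qed
  also have "\<dots> = 3 * (real m)\<^sup>2 / real ?N" using N assms by (simp add: field_simps power2_eq_square)
  finally show ?thesis .
qed

lemma sum_Pow_power_card:
  fixes y :: real
  assumes "finite X"
  shows "(\<Sum>A\<in>Pow X. y ^ card A) = (1 + y) ^ card X" "(\<Sum>A\<in>Pow X. y ^ (card X - card A)) = (1 + y) ^ card X"
proof -
  have "(\<Sum>A\<in>Pow X. y ^ card A) = (\<Sum>A\<in>Pow X. (\<Prod>x\<in>A. y) * (\<Prod>x\<in>X - A. 1))" by simp
  also have "\<dots> = (\<Prod>x\<in>X. y + 1)" by (rule prod_add[OF assms, symmetric])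
  finally show 1: "(\<Sum>A\<in>Pow X. y ^ card A) = (1 + y) ^ card X" by (simp add: add.commute)
  have "(\<Sum>A\<in>Pow X. y ^ (card X - card A)) = (\<Sum>A\<in>Pow X. (\<Prod>x\<in>A. 1) * (\<Prod>x\<in>X - A. y))"
    by (rule sum.cong) (auto simp: card_Diff_subset finite_subset[OF _ assms])
  also have "\<dots> = (\<Prod>x\<in>X. 1 + y)" by (rule prod_add[OF assms, symmetric])
  finally show "(\<Sum>A\<in>Pow X. y ^ (card X - card A)) = (1 + y) ^ card X" by simp
qed

text \<open>A cut with a vertices on one side is crossed by a(n-a)(n-2)/2 triples, and a(n-a) is at
  least n/2 times the smaller side. So \<open>y\<close> is the cost per vertex of the smaller
  side.\<close>

lemma Pr_bad_cut_le:
  fixes n m :: nat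
  defines "N \<equiv> n choose 3" and "y \<equiv> exp (- (real m / real (n choose 3) * (real n * (real n - 2) / 4)))"
  assumes "n \<ge> 3" "m \<le> N"
  shows "Pr n {ts. \<exists>A. A \<subseteq> {1..n} \<and> A \<noteq> {} \<and> A \<noteq> {1..n} \<and> card (set (take m ts) \<inter> crossing n A) < 2} \<le>
    2 * exp 1 * real N * ((1 + y) ^ n - 1)"
proof -
  let ?p = "real m / real N"
  let ?\<A> = "Pow {1..n} - {{}, {1..n}}"
  have N: "N > 0" using assms by simp
  have p: "0 \<le> ?p" "?p \<le> 1" using ratio_le_1[OF assms(4)] by auto
  have y: "y > 0" by (simp add: y_def)
  have fin: "finite (crossing n A)" for A by (simp add: crossing_def)
  have bound: "Pr n {ts. card (set (take m ts) \<inter> crossing n A) < 2} \<le>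
      exp 1 * real N * (y ^ card A + y ^ (n - card A))" if A: "A \<in> ?\<A>" for A
  proof -
    let ?a = "card A" and ?C = "crossing n A"
    have sub: "A \<subseteq> {1..n}" and finA: "finite A" using A finite_subset by auto
    have a: "1 \<le> ?a" "?a < n"
    proof -
      show "1 \<le> ?a" using A finA by (auto simp: Suc_le_eq card_gt_0_iff)
      show "?a < n" using psubset_card_mono[of "{1..n}" A] A by auto
    qed
    have cC: "real (card ?C) = real ?a * (real n - real ?a) * (real n - 2) / 2" by (rule card_crossing[OF sub])
    have mins: "real ?a * (real n - real ?a) \<ge> real n / 2 * real (min ?a (n - ?a))"
    proof (cases "2 * ?a \<le> n")
      case True
      then have "min ?a (n - ?a) = ?a" by simp
      moreover have "real n - real ?a \<ge> real n / 2" using True by linarith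
      ultimately show ?thesis using mult_left_mono[of "real n / 2" "real n - real ?a" "real ?a"] by (simp add: mult.commute)
    next
      case False
      then have "min ?a (n - ?a) = n - ?a" by simp
      moreover have "real ?a \<ge> real n / 2" using False by linarith
      moreover have "real (n - ?a) = real n - real ?a" using a by simp
      ultimately show ?thesis using mult_right_mono[of "real n / 2" "real ?a" "real n - real ?a"] a by simp
    qed
    have C1: "1 \<le> card ?C"
    proof -
      have "real ?a * (real n - real ?a) * (real n - 2) > 0" using a assms(3) by simp
      then have "real (card ?C) > 0" unfolding cC by simp
      then show ?thesis by simp
    qed
    have CN: "card ?C \<le> N" unfolding N_def card_triples[symmetric] by (rule card_mono) (auto simp: crossing_def)
    have yk: "exp (- ?p * real (card ?C)) \<le> y ^ min ?a (n - ?a)"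
    proof -
      have "real n * (real n - 2) / 4 * real (min ?a (n - ?a)) \<le> real (card ?C)"
      proof -
        have "real n / 2 * real (min ?a (n - ?a)) * ((real n - 2) / 2) \<le> real ?a * (real n - real ?a) * ((real n - 2) / 2)"
          using mins assms(3) by (intro mult_right_mono) auto
        then show ?thesis unfolding cC by (simp add: field_simps)
      qed
      then have "?p * (real n * (real n - 2) / 4 * real (min ?a (n - ?a))) \<le> ?p * real (card ?C)"
        using p by (intro mult_left_mono) auto
      moreover have "y ^ min ?a (n - ?a) = exp (- (?p * (real n * (real n - 2) / 4 * real (min ?a (n - ?a)))))"
        unfolding y_def N_def[symmetric] exp_of_nat_mult[symmetric] by (simp add: algebra_simps)
      ultimately show ?thesis by simp
    qed
    \<comment> \<open>The minimum is traded for a sum so that summation over all \<open>A\<close>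
      becomes a binomial expansion.\<close>
    also have "y ^ min ?a (n - ?a) \<le> y ^ ?a + y ^ (n - ?a)" using y by (simp add: min_def)
    finally have e: "exp (- ?p * real (card ?C)) \<le> y ^ ?a + y ^ (n - ?a)" .
    \<comment> \<open>Fewer than two crossing faces means that all crossing triples but one are
      missing; the union over the exceptional one costs at most a factor \<open>N\<close>.\<close>
    have "Pr n {ts. card (set (take m ts) \<inter> ?C) < 2} \<le> Pr n {ts. \<exists>t\<in>?C. ts \<in> {ts. (?C - {t}) \<inter> set (take m ts) = {}}}"
    proof (rule measure_pmf.finite_measure_mono)
      show "{ts. card (set (take m ts) \<inter> ?C) < 2} \<subseteq> {ts. \<exists>t\<in>?C. ts \<in> {ts. (?C - {t}) \<inter> set (take m ts) = {}}}"
      proof clarify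
        fix ts :: "nat set list" assume lt: "card (set (take m ts) \<inter> ?C) < 2"
        obtain t0 where t0: "t0 \<in> ?C" using C1 by fastforce
        show "\<exists>t\<in>?C. ts \<in> {ts. (?C - {t}) \<inter> set (take m ts) = {}}"
        proof (cases "set (take m ts) \<inter> ?C = {}")
          case True
          then show ?thesis using t0 by blast
        next
          case False
          then have "card (set (take m ts) \<inter> ?C) \<noteq> 0" by simp
          then have "card (set (take m ts) \<inter> ?C) = 1" using lt by linarith
          then obtain t where "set (take m ts) \<inter> ?C = {t}" by (auto simp: card_1_singleton_iff)
          then show ?thesis by blast
        qed
      qed
    qed simp
    also have "\<dots> \<le> (\<Sum>t\<in>?C. exp (- ?p * real (card ?C - 1)))"
    proof (rule Pr_union_bound[OF fin])
      fix t assume t: "t \<in> ?C"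
      show "Pr n {ts. (?C - {t}) \<inter> set (take m ts) = {}} \<le> exp (- ?p * real (card ?C - 1))"
        unfolding N_def
        by (rule Pr_absent_le_exp) (use t C1 CN assms in \<open>auto simp: crossing_def\<close>)
    qed
    also have "\<dots> = real (card ?C) * exp (- ?p * real (card ?C - 1))" by simp
    also have "\<dots> \<le> real N * (exp 1 * exp (- ?p * real (card ?C)))"
    proof (rule mult_mono)
      \<comment> \<open>Exempting one triple costs exp(p), which is at most e.\<close>
      have "- ?p * real (card ?C - 1) = ?p - ?p * real (card ?C)" using C1 by (simp add: of_nat_diff algebra_simps)
      also have "\<dots> \<le> 1 + - ?p * real (card ?C)" using p by simp
      finally show "exp (- ?p * real (card ?C - 1)) \<le> exp 1 * exp (- ?p * real (card ?C))"
        unfolding exp_add[symmetric] by simp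
    qed (use CN in auto)
    also have "\<dots> \<le> real N * (exp 1 * (y ^ ?a + y ^ (n - ?a)))"
      using e by (intro mult_left_mono) auto
    finally show ?thesis by (simp add: mult_ac)
  qed
  have "Pr n {ts. \<exists>A. A \<subseteq> {1..n} \<and> A \<noteq> {} \<and> A \<noteq> {1..n} \<and> card (set (take m ts) \<inter> crossing n A) < 2} =
      Pr n {ts. \<exists>A\<in>?\<A>. ts \<in> {ts. card (set (take m ts) \<inter> crossing n A) < 2}}"
    by (rule arg_cong[of _ _ "Pr n"]) auto
  also have "\<dots> \<le> (\<Sum>A\<in>?\<A>. exp 1 * real N * (y ^ card A + y ^ (n - card A)))"
    by (rule Pr_union_bound) (use bound in auto)
  also have "\<dots> = exp 1 * real N * ((\<Sum>A\<in>?\<A>. y ^ card A) + (\<Sum>A\<in>?\<A>. y ^ (n - card A)))"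
    by (simp add: sum_distrib_left[symmetric] sum.distrib)
  also have "\<dots> \<le> exp 1 * real N * (((1 + y) ^ n - 1) + ((1 + y) ^ n - 1))"
  proof (intro mult_left_mono add_mono)
    have "(\<Sum>A\<in>?\<A>. y ^ card A) \<le> (\<Sum>A\<in>Pow {1..n} - {{}}. y ^ card A)"
      by (rule sum_mono2) (use y in auto)
    also have "\<dots> = (1 + y) ^ n - 1"
      using sum_Pow_power_card(1)[of "{1..n}" y] by (simp add: sum_diff1)
    finally show "(\<Sum>A\<in>?\<A>. y ^ card A) \<le> (1 + y) ^ n - 1" .
    have "(\<Sum>A\<in>?\<A>. y ^ (n - card A)) \<le> (\<Sum>A\<in>Pow {1..n} - {{1..n}}. y ^ (n - card A))"
      by (rule sum_mono2) (use y in auto)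
    also have "\<dots> = (1 + y) ^ n - 1"
      using sum_Pow_power_card(2)[of "{1..n}" y] by (simp add: sum_diff1)
    finally show "(\<Sum>A\<in>?\<A>. y ^ (n - card A)) \<le> (1 + y) ^ n - 1" .
  qed auto
  finally show ?thesis by (simp add: algebra_simps)
qed

section \<open>Union bound over trees of pairs\<close>

lemma sum_pair_trees_le:
  fixes c :: real
  assumes "n \<ge> 1" "c \<ge> 0"
  shows "(\<Sum>e\<in>pairs n. \<Sum>x\<in>pair_trees n e k. c) \<le> real n / 4 * (8 * real n) ^ k * c"
proof -
  have "(\<Sum>e\<in>pairs n. \<Sum>x\<in>pair_trees n e k. c) = (\<Sum>e\<in>pairs n. real (card (pair_trees n e k)) * c)" by simp
  also have "\<dots> \<le> (\<Sum>e\<in>pairs n. (8 * real n) ^ k / (4 * real n) * c)"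
    by (intro sum_mono mult_right_mono card_pair_trees_le assms)
  also have "\<dots> = real (card (pairs n)) * ((8 * real n) ^ k / (4 * real n) * c)" by simp
  also have "\<dots> \<le> (real n)\<^sup>2 * ((8 * real n) ^ k / (4 * real n) * c)"
  proof (rule mult_right_mono)
    show "real (card (pairs n)) \<le> (real n)\<^sup>2"
      using of_nat_mono[OF card_pairs_le[of n], where 'a = real] by simp
  qed (use assms in simp)
  also have "\<dots> = real n / 4 * (8 * real n) ^ k * c" using assms by (simp add: field_simps power2_eq_square)
  finally show ?thesis .
qed

text \<open>An obstruction at any time of the window forces its tree faces to be present at the end
  \<open>m3\<close> and its odd triples to be absent at the start \<open>me\<close>, so one event
  per tree serves the whole window.\<close>

lemma Pr_obstruction_early_le:
  fixes n me m3 k \<beta> :: nat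
  defines "N \<equiv> n choose 3"
  assumes "n \<ge> 1" "N > 0" "2 * m3 \<le> N" "2 * \<beta> \<le> N" "me \<le> m3"
    and \<beta>: "\<And>T S A. \<lbrakk>T \<subseteq> triples n; obstruction n T k S A\<rbrakk> \<Longrightarrow> \<beta> \<le> card (odd_triples n S)"
  shows "Pr n {ts. \<exists>e\<in>pairs n. \<exists>(S, A)\<in>pair_trees n e k. \<exists>m\<in>{me..m3}. obstruction n (set (take m ts)) k S A} \<le>
    real n / 4 * (8 * real n) ^ k * (exp (- (real me / real N) * real \<beta>) * (2 * real m3 / real N) ^ (k - 1))"
proof -
  define c where "c = exp (- (real me / real N) * real \<beta>) * (2 * real m3 / real N) ^ (k - 1)"
  have c0: "c \<ge> 0" by (simp add: c_def)
  let ?E = "\<lambda>(S, A). {ts. \<exists>m\<in>{me..m3}. obstruction n (set (take m ts)) k S A}"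
  have one: "Pr n (?E x) \<le> c" for x
  proof -
    obtain S A where x: "x = (S, A)" by (cases x)
    let ?O = "odd_triples n S"
    show ?thesis
    proof (cases "card A = k - 1 \<and> A \<subseteq> triples n \<and> A \<inter> ?O = {} \<and> \<beta> \<le> card ?O")
      case True
      \<comment> \<open>Only \<beta> of the odd triples are kept: \<open>2 * \<beta> \<le> N\<close>
        leaves at least N/2 triples to compete for the positions of \<open>A\<close>, which is the
        origin of the 2 in 2 m3/N.\<close>
      obtain B where B: "B \<subseteq> ?O" "card B = \<beta>" using True obtain_subset_with_card_n[of \<beta> ?O] by blast
      have "Pr n (?E x) \<le> Pr n {ts. A \<subseteq> set (take m3 ts) \<and> B \<inter> set (take me ts) = {}}"
      proof (rule measure_pmf.finite_measure_mono)
        show "?E x \<subseteq> {ts. A \<subseteq> set (take m3 ts) \<and> B \<inter> set (take me ts) = {}}"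
        proof
          fix ts assume "ts \<in> ?E x"
          then obtain m where m: "me \<le> m" "m \<le> m3" "A \<subseteq> set (take m ts)" "?O \<inter> set (take m ts) = {}"
            by (auto simp: x obstruction_def)
          have "set (take m ts) \<subseteq> set (take m3 ts)" "set (take me ts) \<subseteq> set (take m ts)"
            using m by (auto intro!: set_take_subset_set_take)
          then show "ts \<in> {ts. A \<subseteq> set (take m3 ts) \<and> B \<inter> set (take me ts) = {}}" using m B by blast
        qed
      qed simp
      also have "\<dots> \<le> (1 - real me / real N) ^ card B * (real m3 / real (N - card B)) ^ card A"
        unfolding N_def
      proof (rule Pr_present_absent_le)
        show "B \<subseteq> triples n" using B by (auto simp: odd_triples_def)
        show "card B < n choose 3" "me \<le> n choose 3" "m3 \<le> (n choose 3) - card B"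
          using assms(3-6) B unfolding N_def by linarith+
      qed (use True B in auto)
      also have "\<dots> \<le> c"
        unfolding c_def
      proof (rule mult_mono)
        have "real me / real N \<le> 1" using assms(4,6) by (intro ratio_le_1) linarith
        then show "(1 - real me / real N) ^ card B \<le> exp (- (real me / real N) * real \<beta>)"
          using one_minus_power_le_exp[of "real me / real N" \<beta>] B by simp
        have "2 * card B \<le> N" using B assms(5) by simp
        then have "real N \<le> 2 * real (N - card B)" by linarith
        then have "real m3 / real (N - card B) \<le> 2 * real m3 / real N"
          using assms(3) mult_left_mono[of "real N" "2 * real (N - card B)" "real m3"]
          by (simp add: divide_simps mult_ac)
        then show "(real m3 / real (N - card B)) ^ card A \<le> (2 * real m3 / real N) ^ (k - 1)"
          using True by (auto intro!: power_mono)
      qed auto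
      finally show ?thesis .
    next
      case False
      have "Pr n (?E x) \<le> Pr n {}"
      proof (rule Pr_mono_on_process)
        fix ts assume ts: "set ts = triples n" "ts \<in> ?E x"
        then obtain m where m: "obstruction n (set (take m ts)) k S A" by (auto simp: x)
        have sub: "set (take m ts) \<subseteq> triples n" using ts(1) set_take_subset[of m ts] by simp
        have "\<beta> \<le> card ?O" by (rule \<beta>[OF sub m])
        moreover have "card A = k - 1" "A \<subseteq> triples n" "A \<inter> ?O = {}"
          using m sub by (auto simp: obstruction_def)
        ultimately show "ts \<in> {}" using False by blast
      qed
      then show ?thesis using c0 by simp
    qed
  qed
  have "Pr n {ts. \<exists>e\<in>pairs n. \<exists>(S, A)\<in>pair_trees n e k. \<exists>m\<in>{me..m3}. obstruction n (set (take m ts)) k S A} =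
      Pr n {ts. \<exists>e\<in>pairs n. ts \<in> {ts. \<exists>x\<in>pair_trees n e k. ts \<in> ?E x}}"
    by (rule arg_cong[of _ _ "Pr n"]) auto
  also have "\<dots> \<le> (\<Sum>e\<in>pairs n. \<Sum>x\<in>pair_trees n e k. c)"
    by (intro Pr_union_bound one) simp_all
  also have "\<dots> \<le> real n / 4 * (8 * real n) ^ k * c" by (rule sum_pair_trees_le[OF assms(2) c0])
  finally show ?thesis unfolding c_def .
qed

text \<open>With no upper limit on the time, the presence of tree faces has no price; from
  \<open>m3\<close> on the absence of the odd triples has to outweigh the (8n)^k trees by
  itself.\<close>

lemma Pr_obstruction_late_le:
  fixes n m3 k \<beta> :: nat
  defines "N \<equiv> n choose 3"
  assumes "n \<ge> 1" "N > 0" "m3 \<le> N" "2 * \<beta> \<le> N"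
    and \<beta>: "\<And>T S A. \<lbrakk>T \<subseteq> triples n; obstruction n T k S A\<rbrakk> \<Longrightarrow> \<beta> \<le> card (odd_triples n S)"
  shows "Pr n {ts. \<exists>e\<in>pairs n. \<exists>(S, A)\<in>pair_trees n e k. \<exists>m\<ge>m3. obstruction n (set (take m ts)) k S A} \<le>
    real n / 4 * (8 * real n) ^ k * exp (- (real m3 / real N) * real \<beta>)"
proof -
  define c where "c = exp (- (real m3 / real N) * real \<beta>)"
  have c0: "c \<ge> 0" by (simp add: c_def)
  let ?E = "\<lambda>(S, A). {ts. \<exists>m\<ge>m3. obstruction n (set (take m ts)) k S A}"
  have one: "Pr n (?E x) \<le> c" for x
  proof -
    obtain S A where x: "x = (S, A)" by (cases x)
    let ?O = "odd_triples n S"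
    have ex: "\<beta> \<le> card ?O \<and> ?O \<inter> set (take m3 ts) = {}" if ts: "set ts = triples n" "ts \<in> ?E x" for ts
    proof -
      obtain m where m: "m3 \<le> m" "obstruction n (set (take m ts)) k S A" using ts by (auto simp: x)
      have sub: "set (take m ts) \<subseteq> triples n" using ts(1) set_take_subset[of m ts] by simp
      have "set (take m3 ts) \<subseteq> set (take m ts)" using m by (auto intro!: set_take_subset_set_take)
      then show ?thesis using \<beta>[OF sub m(2)] m(2) by (auto simp: obstruction_def)
    qed
    show ?thesis
    proof (cases "\<beta> \<le> card ?O")
      case True
      have "Pr n (?E x) \<le> Pr n {ts. ?O \<inter> set (take m3 ts) = {}}"
        by (rule Pr_mono_on_process) (use ex in blast)
      also have "\<dots> \<le> c"
        unfolding c_def N_def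
      proof (rule Pr_absent_le_exp)
        show "?O \<subseteq> triples n" by (auto simp: odd_triples_def)
        show "m3 \<le> n choose 3" "\<beta> < n choose 3" using assms(3-5) unfolding N_def by linarith+
      qed (rule True)
      finally show ?thesis .
    next
      case False
      have "Pr n (?E x) \<le> Pr n {}" by (rule Pr_mono_on_process) (use ex False in blast)
      then show ?thesis using c0 by simp
    qed
  qed
  have "Pr n {ts. \<exists>e\<in>pairs n. \<exists>(S, A)\<in>pair_trees n e k. \<exists>m\<ge>m3. obstruction n (set (take m ts)) k S A} =
      Pr n {ts. \<exists>e\<in>pairs n. ts \<in> {ts. \<exists>x\<in>pair_trees n e k. ts \<in> ?E x}}"
    by (rule arg_cong[of _ _ "Pr n"]) auto
  also have "\<dots> \<le> (\<Sum>e\<in>pairs n. \<Sum>x\<in>pair_trees n e k. c)"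
    by (intro Pr_union_bound one) simp_all
  also have "\<dots> \<le> real n / 4 * (8 * real n) ^ k * c" by (rule sum_pair_trees_le[OF assms(2) c0])
  finally show ?thesis unfolding c_def .
qed

section \<open>Limits\<close>

lemma power_eq_exp_ln: "0 < x \<Longrightarrow> (x :: real) ^ k = exp (real k * ln x)"
  by (simp add: exp_of_nat_mult)

lemma real_choose_2: "real (k choose 2) = real k * (real k - 1) / 2"
  using choose_two[of k] by (cases k) (auto simp: real_of_nat_div algebra_simps)

lemma nat_ceiling_bounds:
  fixes x :: real
  assumes "0 \<le> x"
  shows "x \<le> real (nat \<lceil>x\<rceil>)" "real (nat \<lceil>x\<rceil>) \<le> x + 1"
proof -
  have "real (nat \<lceil>x\<rceil>) = of_int \<lceil>x\<rceil>" using assms by (simp add: of_nat_nat)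
  then show "x \<le> real (nat \<lceil>x\<rceil>)" "real (nat \<lceil>x\<rceil>) \<le> x + 1" by linarith+
qed

lemma nat_floor_bounds:
  fixes x :: real
  assumes "0 \<le> x"
  shows "x - 1 \<le> real (nat \<lfloor>x\<rfloor>)" "real (nat \<lfloor>x\<rfloor>) \<le> x"
proof -
  have "real (nat \<lfloor>x\<rfloor>) = of_int \<lfloor>x\<rfloor>" using assms by (simp add: of_nat_nat)
  then show "x - 1 \<le> real (nat \<lfloor>x\<rfloor>)" "real (nat \<lfloor>x\<rfloor>) \<le> x" by linarith+
qed

lemma Pr_tendsto_0I:
  assumes "\<forall>\<^sub>F n in sequentially. Pr n (S n) \<le> f n" "f \<longlonglongrightarrow> 0"
  shows "(\<lambda>n. Pr n (S n)) \<longlonglongrightarrow> 0"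
  by (rule tendsto_sandwich[OF _ assms(1) tendsto_const assms(2)]) auto

lemma exp_le_one_minus:
  fixes v :: real
  assumes "v < 1"
  shows "exp (- (v / (1 - v))) \<le> 1 - v"
proof -
  have "1 / (1 - v) = 1 + v / (1 - v)" using assms by (simp add: field_simps)
  also have "\<dots> \<le> exp (v / (1 - v))" by simp
  finally show ?thesis using assms by (simp add: exp_minus field_simps)
qed

lemma odds_eq:
  fixes D m :: real
  assumes "0 < D"
  shows "(m / D) / (1 - m / D) = m / (D - m)"
proof -
  have "1 - m / D = (D - m) / D" using assms by (simp add: field_simps)
  then show ?thesis using assms by simp
qed

lemma real_choose_3_diff:
  assumes "2 * real n - 6 < real n * (real n - 1) * (real n - 2) / 6" "5 \<le> n"
  shows "real ((n choose 3) - (2 * n - 6)) = real n * (real n - 1) * (real n - 2) / 6 - (2 * real n - 6)"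
proof -
  have b: "real (2 * n - 6) = 2 * real n - 6" using assms by (simp add: of_nat_diff)
  then have "real (2 * n - 6) < real (n choose 3)" using assms by (simp only: real_choose_3)
  then have "2 * n - 6 \<le> n choose 3" by linarith
  from of_nat_diff[OF this, where 'a = real] show ?thesis by (simp only: b real_choose_3)
qed

text \<open>At time n a vertex expects exactly b n / N = 3 triples, so about n exp(-3) vertices are
  isolated. The ratio exp(-6) / exp(-3)^2 = 1 shows that pairs are asymptotically
  uncorrelated.\<close>

lemma no_isolated_tendsto_0:
  "(\<lambda>n. Pr n {ts. \<forall>v\<in>{1..n}. \<exists>t\<in>set (take n ts). v \<in> t}) \<longlonglongrightarrow> 0"
proof (rule Pr_tendsto_0I)
  define NR where "NR n = real n * (real n - 1) * (real n - 2) / 6" for n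
  define bR where "bR n = (real n - 1) * (real n - 2) / 2" for n
  define F where "F n = 1 / (real n * exp (bR n * ln (1 - real n / (NR n - bR n)))) +
      exp ((2 * bR n - real n) * ln (1 - real n / NR n)) / (exp (bR n * ln (1 - real n / (NR n - bR n))))\<^sup>2 - 1" for n
  have "F \<longlonglongrightarrow> exp (- 6) * inverse ((exp (- 3))\<^sup>2) - 1"
    unfolding F_def NR_def bR_def by real_asymp
  moreover have "(exp (- 3 :: real))\<^sup>2 = exp (- 6)" by (simp add: exp_of_nat_mult[symmetric])
  ultimately show "F \<longlonglongrightarrow> 0" by simp
  have ev: "\<forall>\<^sub>F n in sequentially. real n + 2 * bR n < NR n" "\<forall>\<^sub>F n in sequentially. real n < 2 * bR n"
    "\<forall>\<^sub>F n in sequentially. real n < NR n - bR n"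
    unfolding NR_def bR_def by real_asymp+
  show "\<forall>\<^sub>F n in sequentially. Pr n {ts. \<forall>v\<in>{1..n}. \<exists>t\<in>set (take n ts). v \<in> t} \<le> F n"
    using ev eventually_ge_at_top[of "1::nat"]
  proof eventually_elim
    case (elim n)
    let ?N = "n choose 3" and ?b = "(n - 1) choose 2"
    have N: "real ?N = NR n" by (simp add: NR_def real_choose_3)
    have b: "real ?b = bR n" using elim(4) by (simp add: bR_def real_choose_2 of_nat_diff)
    have bpos: "0 \<le> bR n" using b by (metis of_nat_0_le_iff)
    have le: "n + 2 * ?b < ?N" "n < 2 * ?b"
    proof -
      have "real (n + 2 * ?b) < real ?N" "real n < real (2 * ?b)" using elim N b by simp_all
      then show "n + 2 * ?b < ?N" "n < 2 * ?b" by linarith+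
    qed
    have Nb: "real (?N - ?b) = NR n - bR n" using le N b by (simp add: of_nat_diff)
    have "real (2 * ?b - n) = 2 * bR n - real n" using le b by (simp add: of_nat_diff)
    moreover have "0 < 1 - real n / (NR n - bR n)" "0 < 1 - real n / NR n"
      using elim bpos by (auto simp: field_simps)
    ultimately have Fn: "F n = 1 / (real n * (1 - real n / real (?N - ?b)) ^ ?b) +
        (1 - real n / real ?N) ^ (2 * ?b - n) / ((1 - real n / real (?N - ?b)) ^ ?b)\<^sup>2 - 1"
      using b unfolding F_def Nb N by (simp add: power_eq_exp_ln)
    show ?case unfolding Fn by (rule Pr_no_isolated_le) (use le elim(4) in linarith)+
  qed
qed

text \<open>Bounds the correlation ratio of two survivors uniformly for m up to \<open>X\<close>.
  The numerator has base 1 - m/N, slightly larger than the base 1 - m/(N-b) of the denominator, and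
  four factors fewer; the exponential and the fourth power pay for these two defects.\<close>

lemma survivor_ratio_le:
  fixes N b m X :: real and j :: nat
  assumes "0 \<le> m" "m \<le> X" "0 < b" "X < N - b" "real j \<le> 2 * b" "4 \<le> k" "k - 4 = j" "real k = 2 * b"
  shows "(1 - m / N) ^ j / (1 - m / (N - b)) ^ k \<le>
    exp (2 * b * (X * b / (N * (N - b))) / (1 - X / (N - b))) / (1 - X / (N - b)) ^ 4"
proof -
  let ?u = "m / N" and ?v = "m / (N - b)" and ?V = "X / (N - b)"
  have pos: "0 < N - b" "0 < N" using assms by auto
  have V: "?V < 1" using assms pos by simp
  have vV: "?v \<le> ?V" using assms pos by (intro divide_right_mono) auto
  have v1: "0 < 1 - ?v" "0 < 1 - ?V" using vV V by auto
  have diff: "?v - ?u = m * b / (N * (N - b))" using pos by (simp add: field_simps)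
  have "?v - ?u \<ge> 0" unfolding diff using assms pos by simp
  have "1 - ?u = (1 - ?v) * (1 + (?v - ?u) / (1 - ?v))"
    using v1(1) by (simp only: distrib_left times_divide_eq_right nonzero_mult_div_cancel_left) simp
  also have "\<dots> \<le> (1 - ?v) * exp ((?v - ?u) / (1 - ?v))" using v1 by (intro mult_left_mono) auto
  also have "\<dots> \<le> (1 - ?v) * exp ((X * b / (N * (N - b))) / (1 - ?V))"
  proof -
    have "?v - ?u \<le> X * b / (N * (N - b))"
      unfolding diff using assms pos by (intro divide_right_mono mult_right_mono) auto
    then have "(?v - ?u) / (1 - ?v) \<le> (X * b / (N * (N - b))) / (1 - ?V)"
      using v1 vV \<open>?v - ?u \<ge> 0\<close> by (intro frac_le) auto
    then show ?thesis using v1 by simp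
  qed
  finally have 1: "1 - ?u \<le> (1 - ?v) * exp ((X * b / (N * (N - b))) / (1 - ?V))" .
  have u0: "0 \<le> 1 - ?u" using assms pos by (simp add: field_simps)
  have "(1 - ?u) ^ j \<le> ((1 - ?v) * exp ((X * b / (N * (N - b))) / (1 - ?V))) ^ j"
    by (rule power_mono[OF 1 u0])
  also have "\<dots> = (1 - ?v) ^ j * exp (real j * ((X * b / (N * (N - b))) / (1 - ?V)))"
    unfolding power_mult_distrib exp_of_nat_mult ..
  also have "\<dots> \<le> (1 - ?v) ^ j * exp (2 * b * (X * b / (N * (N - b))) / (1 - ?V))"
  proof -
    have "0 \<le> (X * b / (N * (N - b))) / (1 - ?V)" using assms pos v1 by simp
    then have "real j * ((X * b / (N * (N - b))) / (1 - ?V)) \<le> 2 * b * ((X * b / (N * (N - b))) / (1 - ?V))"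
      using assms by (intro mult_right_mono)
    then show ?thesis using v1 by simp
  qed
  finally have "(1 - ?u) ^ j / (1 - ?v) ^ k \<le>
      (1 - ?v) ^ j * exp (2 * b * (X * b / (N * (N - b))) / (1 - ?V)) / (1 - ?v) ^ k"
    using v1 by (intro divide_right_mono) auto
  also have "\<dots> = exp (2 * b * (X * b / (N * (N - b))) / (1 - ?V)) / (1 - ?v) ^ 4"
  proof -
    have "k = j + 4" using assms(6,7) by simp
    then show ?thesis using v1(1) by (simp add: power_add)
  qed
  also have "\<dots> \<le> exp (2 * b * (X * b / (N * (N - b))) / (1 - ?V)) / (1 - ?V) ^ 4"
    using v1 vV by (intro divide_left_mono power_mono mult_pos_pos zero_less_power) auto
  finally show ?thesis .
qed

text \<open>The correlation ratio tends to 1 for all times up to n^2 log n, so it is enough that the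
  expression in \<open>inf\<close> diverges; up to the apex factor 3 it is a lower estimate of the
  expected number of survivors.\<close>

lemma no_survivor_tendsto_0:
  fixes m m' :: "nat \<Rightarrow> nat"
  assumes "\<forall>\<^sub>F n in sequentially. 1 \<le> m n \<and> m n \<le> m' n \<and> real (m' n) \<le> (real n)\<^sup>2 * ln (real n)"
    and inf: "filterlim (\<lambda>n. real (m n) * (1 - real (m' n) / real ((n choose 3) - (2 * n - 6))) ^ (2 * n - 6))
      at_top sequentially"
  shows "(\<lambda>n. Pr n {ts. \<not> (\<exists>(t, a)\<in>apexed n. t \<in> set (take (m n) ts) \<and>
      wing n a t \<inter> set (take (m' n) ts) = {})}) \<longlonglongrightarrow> 0"
proof (rule Pr_tendsto_0I)
  define NR where "NR n = real n * (real n - 1) * (real n - 2) / 6" for n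
  define bR where "bR n = 2 * real n - 6" for n
  define X where "X n = (real n)\<^sup>2 * ln (real n)" for n
  define G where "G n = (NR n / (NR n - 2 * bR n))\<^sup>2 *
      (exp (2 * bR n * (X n * bR n / (NR n * (NR n - bR n))) / (1 - X n / (NR n - bR n))) /
       (1 - X n / (NR n - bR n)) ^ 4)" for n
  define H where "H n = real (m n) * (1 - real (m' n) / real ((n choose 3) - (2 * n - 6))) ^ (2 * n - 6)" for n
  have G: "G \<longlonglongrightarrow> 1" unfolding G_def NR_def bR_def X_def by real_asymp
  have "(\<lambda>n. inverse (H n)) \<longlonglongrightarrow> 0"
    using inf unfolding H_def[symmetric] by (rule tendsto_inverse_0_at_top)
  then show "(\<lambda>n. inverse (H n) + G n - 1) \<longlonglongrightarrow> 0"
    using tendsto_diff[OF tendsto_add[OF _ G] tendsto_const[of 1]] by fastforce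
  have ev: "\<forall>\<^sub>F n in sequentially. X n + 2 * bR n < NR n" unfolding NR_def bR_def X_def by real_asymp
  show "\<forall>\<^sub>F n in sequentially. Pr n {ts. \<not> (\<exists>(t, a)\<in>apexed n. t \<in> set (take (m n) ts) \<and>
      wing n a t \<inter> set (take (m' n) ts) = {})} \<le> inverse (H n) + G n - 1"
    using ev assms(1) eventually_ge_at_top[of "5::nat"]
  proof eventually_elim
    case (elim n)
    let ?N = "n choose 3" and ?b = "2 * n - 6"
    have N: "real ?N = NR n" by (simp add: NR_def real_choose_3)
    have b: "real ?b = bR n" using elim(3) by (simp add: bR_def of_nat_diff)
    have b4: "4 \<le> ?b" using elim(3) by simp
    have m'X: "real (m' n) \<le> X n" using elim(2) by (simp add: X_def)
    have "real (m' n + 2 * ?b) < real ?N" using elim(1) m'X N b by simp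
    then have lt: "m' n + 2 * ?b < ?N" by linarith
    have Nb: "real (?N - ?b) = NR n - bR n" "real (?N - 2 * ?b) = NR n - 2 * bR n"
      using lt N b by (simp_all add: of_nat_diff)
    have NR: "0 < NR n" "0 < NR n - 2 * bR n" "0 < bR n" "0 < NR n - bR n" using Nb N lt b b4 by linarith+
    define w where "w = 1 - real (m' n) / (NR n - bR n)"
    have w: "w > 0" unfolding w_def using NR elim(1) m'X by (simp add: field_simps)
    let ?q = "real (m n) / real ?N * (1 - real (m' n) / real (?N - ?b)) ^ ?b"
    let ?r = "(real (m n) / real (?N - 2 * ?b))\<^sup>2 * (1 - real (m' n) / real ?N) ^ (2 * ?b - 4)"
    have A: "real ?N * ?q = H n" using N NR by (simp add: H_def)
    have B: "?r / ?q\<^sup>2 = (NR n / (NR n - 2 * bR n))\<^sup>2 *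
        ((1 - real (m' n) / NR n) ^ (2 * ?b - 4) / (1 - real (m' n) / (NR n - bR n)) ^ (2 * ?b))"
    proof -
      have "?r / ?q\<^sup>2 = (real (m n) / (NR n - 2 * bR n))\<^sup>2 * (1 - real (m' n) / NR n) ^ (2 * ?b - 4) /
          ((real (m n) / NR n)\<^sup>2 * w ^ (2 * ?b))"
        unfolding Nb N w_def[symmetric] power_mult_distrib power_mult[symmetric] mult.commute[of _ 2] ..
      also have "\<dots> = (NR n / (NR n - 2 * bR n))\<^sup>2 * ((1 - real (m' n) / NR n) ^ (2 * ?b - 4) / w ^ (2 * ?b))"
        using elim(2) NR w by (simp add: field_simps power_divide)
      finally show ?thesis unfolding w_def .
    qed
    have C: "(NR n / (NR n - 2 * bR n))\<^sup>2 *
        ((1 - real (m' n) / NR n) ^ (2 * ?b - 4) / (1 - real (m' n) / (NR n - bR n)) ^ (2 * ?b)) \<le> G n"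
      unfolding G_def
    proof (rule mult_left_mono)
      show "(1 - real (m' n) / NR n) ^ (2 * ?b - 4) / (1 - real (m' n) / (NR n - bR n)) ^ (2 * ?b) \<le>
        exp (2 * bR n * (X n * bR n / (NR n * (NR n - bR n))) / (1 - X n / (NR n - bR n))) /
       (1 - X n / (NR n - bR n)) ^ 4"
      proof (rule survivor_ratio_le)
        show "real (2 * ?b - 4) \<le> 2 * bR n" "real (2 * ?b) = 2 * bR n" using b b4 by (simp_all add: of_nat_diff)
        show "X n < NR n - bR n" using elim(1) NR by linarith
      qed (use m'X NR b4 in auto)
    qed simp
    have "Pr n {ts. \<not> (\<exists>(t, a)\<in>apexed n. t \<in> set (take (m n) ts) \<and> wing n a t \<inter> set (take (m' n) ts) = {})}
        \<le> 1 / (real ?N * ?q) + ?r / ?q\<^sup>2 - 1"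
      by (rule Pr_no_survivor_le) (use elim(2,3) lt in auto)
    also have "\<dots> \<le> inverse (H n) + G n - 1"
      unfolding A B using C by (simp only: inverse_eq_divide)
    finally show ?case .
  qed
qed

text \<open>
  Writing \<open>x = 6m/n\<^sup>2\<close>, a weak copy of \<open>M\<close> present at \<open>x\<close> and surviving until \<open>x'\<close> is expected about
  \<open>n\<^sup>2 x exp(-2x') / 2\<close> times. This is large both for \<open>m_b\<close>, \<open>m_c\<close> and for \<open>m_c\<close>, \<open>m_lo \<omega>\<close>, so these
  two intervals already bridge the range from \<open>m_b\<close>, where cuts are robust, to the critical window.
  The factors of \<open>m_e\<close> and \<open>m_3\<close> only need room to spare in the union bound over trees.
\<close>

definition crit :: "nat \<Rightarrow> real" where
  "crit n = ln (real n) + 1 / 2 * ln (ln (real n))"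

definition m_b :: "nat \<Rightarrow> nat" where
  "m_b n = nat \<lceil>real n * (ln (real n))\<^sup>2\<rceil>"

definition m_c :: "nat \<Rightarrow> nat" where
  "m_c n = nat \<lceil>(real n)\<^sup>2 * ln (real n) / 12\<rceil>"

definition m_e :: "nat \<Rightarrow> nat" where
  "m_e n = nat \<lceil>(real n)\<^sup>2 * ln (real n) / 6\<rceil>"

definition m_3 :: "nat \<Rightarrow> nat" where
  "m_3 n = nat \<lceil>2 * (real n)\<^sup>2 * ln (real n)\<rceil>"

definition m_lo :: "(nat \<Rightarrow> real) \<Rightarrow> nat \<Rightarrow> nat" where
  "m_lo \<omega> n = nat \<lfloor>(real n)\<^sup>2 / 6 * (crit n - \<omega> n)\<rfloor>"

definition m_hi :: "(nat \<Rightarrow> real) \<Rightarrow> nat \<Rightarrow> nat" where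
  "m_hi \<omega> n = nat \<lfloor>(real n)\<^sup>2 / 6 * (crit n + \<omega> n)\<rfloor>"

lemma ln_nonneg_nat: "0 \<le> ln (real n)"
  by (cases "n = 0") auto

lemma m_b_bounds: "real n * (ln (real n))\<^sup>2 \<le> real (m_b n)" "real (m_b n) \<le> real n * (ln (real n))\<^sup>2 + 1"
  unfolding m_b_def by (rule nat_ceiling_bounds; simp)+

lemma m_c_bounds: "(real n)\<^sup>2 * ln (real n) / 12 \<le> real (m_c n)" "real (m_c n) \<le> (real n)\<^sup>2 * ln (real n) / 12 + 1"
  unfolding m_c_def by (rule nat_ceiling_bounds; simp add: ln_nonneg_nat)+

lemma m_e_bounds: "(real n)\<^sup>2 * ln (real n) / 6 \<le> real (m_e n)" "real (m_e n) \<le> (real n)\<^sup>2 * ln (real n) / 6 + 1"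
  unfolding m_e_def by (rule nat_ceiling_bounds; simp add: ln_nonneg_nat)+

lemma m_3_bounds: "2 * (real n)\<^sup>2 * ln (real n) \<le> real (m_3 n)" "real (m_3 n) \<le> 2 * (real n)\<^sup>2 * ln (real n) + 1"
  unfolding m_3_def by (rule nat_ceiling_bounds; simp add: ln_nonneg_nat)+

text \<open>The origin of the second-order term: near x = log n the expected number of weak copies
  is of order n^2 log n exp(-2x), and \<open>crit\<close> is the point where this product is exactly
  1.\<close>

lemma exp_minus_2_crit:
  assumes "n \<ge> 3"
  shows "exp (- 2 * crit n) = 1 / ((real n)\<^sup>2 * ln (real n))"
proof -
  have n: "0 < real n" "0 < ln (real n)" using assms by auto
  have "2 * crit n = ln (real n) + ln (real n) + ln (ln (real n))" by (simp add: crit_def)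
  then have "exp (2 * crit n) = (real n)\<^sup>2 * ln (real n)"
    using n by (simp only: exp_add exp_ln power2_eq_square)
  then show ?thesis by (simp add: exp_minus inverse_eq_divide)
qed

text \<open>At \<open>m_c\<close>, where x = (log n)/2, a wing is still empty with probability about
  exp(-log n) = 1/n. Against the n log^2 n triples present at \<open>m_b\<close> this leaves about
  log^2 n survivors.\<close>

lemma early_survivor_tendsto_0:
  "(\<lambda>n. Pr n {ts. \<not> (\<exists>(t, a)\<in>apexed n. t \<in> set (take (m_b n) ts) \<and>
      wing n a t \<inter> set (take (m_c n) ts) = {})}) \<longlonglongrightarrow> 0"
proof (rule no_survivor_tendsto_0)
  have ev: "\<forall>\<^sub>F n::nat in sequentially. 1 \<le> real n * (ln (real n))\<^sup>2"
    "\<forall>\<^sub>F n::nat in sequentially. real n * (ln (real n))\<^sup>2 + 1 \<le> (real n)\<^sup>2 * ln (real n) / 12"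
    "\<forall>\<^sub>F n::nat in sequentially. (real n)\<^sup>2 * ln (real n) / 12 + 1 \<le> (real n)\<^sup>2 * ln (real n)"
    by real_asymp+
  then show "\<forall>\<^sub>F n in sequentially. 1 \<le> m_b n \<and> m_b n \<le> m_c n \<and> real (m_c n) \<le> (real n)\<^sup>2 * ln (real n)"
  proof eventually_elim
    case (elim n)
    then show ?case using m_b_bounds[of n] m_c_bounds[of n] by linarith
  qed
  define NR where "NR n = real n * (real n - 1) * (real n - 2) / 6" for n
  define bR where "bR n = 2 * real n - 6" for n
  define X where "X n = (real n)\<^sup>2 * ln (real n) / 12 + 1" for n
  have lim: "filterlim (\<lambda>n. real n * (ln (real n))\<^sup>2 * exp (bR n * ln (1 - X n / (NR n - bR n)))) at_top sequentially"
    unfolding NR_def bR_def X_def by real_asymp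
  have ev2: "\<forall>\<^sub>F n in sequentially. X n < NR n - bR n" "\<forall>\<^sub>F n in sequentially. bR n < NR n"
    unfolding NR_def bR_def X_def by real_asymp+
  show "filterlim (\<lambda>n. real (m_b n) * (1 - real (m_c n) / real ((n choose 3) - (2 * n - 6))) ^ (2 * n - 6))
      at_top sequentially"
  proof (rule filterlim_at_top_mono[OF lim])
    show "\<forall>\<^sub>F n in sequentially. real n * (ln (real n))\<^sup>2 * exp (bR n * ln (1 - X n / (NR n - bR n))) \<le>
        real (m_b n) * (1 - real (m_c n) / real ((n choose 3) - (2 * n - 6))) ^ (2 * n - 6)"
      using ev2 eventually_ge_at_top[of "5::nat"]
    proof eventually_elim
      case (elim n)
      have b: "real (2 * n - 6) = bR n" using elim by (simp add: bR_def of_nat_diff)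
      have Nb: "real ((n choose 3) - (2 * n - 6)) = NR n - bR n"
        using real_choose_3_diff[of n] elim by (simp only: NR_def bR_def)
      have X: "real (m_c n) \<le> X n" using m_c_bounds(2)[of n] by (simp add: X_def)
      have "0 < 1 - X n / (NR n - bR n)" using elim X by (simp add: divide_less_eq)
      then have "exp (bR n * ln (1 - X n / (NR n - bR n))) = (1 - X n / (NR n - bR n)) ^ (2 * n - 6)"
        by (simp only: power_eq_exp_ln b)
      also have "\<dots> \<le> (1 - real (m_c n) / (NR n - bR n)) ^ (2 * n - 6)"
        using elim X \<open>0 < 1 - X n / (NR n - bR n)\<close> by (intro power_mono diff_mono divide_right_mono) auto
      finally show ?case unfolding Nb using m_b_bounds(1)[of n] by (intro mult_mono) auto
    qed
  qed
qed

text \<open>The cap (log log n)/4 keeps the lower end \<open>m_lo\<close> of the window beyond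
  \<open>m_e\<close>, and it gives exp(2 \<omega>) \<le> sqrt(log n), which makes births in the
  window rare. Shrinking \<omega> only strengthens the final claim.\<close>

locale slow_window =
  fixes \<omega> :: "nat \<Rightarrow> real"
  assumes omega_lim: "filterlim \<omega> at_top sequentially"
    and omega_le: "\<forall>\<^sub>F n in sequentially. \<omega> n \<le> ln (ln (real n)) / 4"
begin

lemma omega_nonneg: "\<forall>\<^sub>F n in sequentially. 0 \<le> \<omega> n"
  using omega_lim by (simp add: filterlim_at_top)

lemma m_lo_ge: "\<forall>\<^sub>F n in sequentially. m_e n \<le> m_lo \<omega> n"
proof -
  have "\<forall>\<^sub>F n::nat in sequentially. (real n)\<^sup>2 * ln (real n) / 6 + 2 \<le> (real n)\<^sup>2 / 6 * (ln (real n) + 1 / 4 * ln (ln (real n)))"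
    by real_asymp
  then show ?thesis using omega_le
  proof eventually_elim
    case (elim n)
    have "(real n)\<^sup>2 / 6 * (ln (real n) + 1 / 4 * ln (ln (real n))) \<le> (real n)\<^sup>2 / 6 * (crit n - \<omega> n)"
      using elim(2) by (intro mult_left_mono) (auto simp: crit_def)
    then have 1: "(real n)\<^sup>2 * ln (real n) / 6 + 2 \<le> (real n)\<^sup>2 / 6 * (crit n - \<omega> n)" using elim(1) by linarith
    moreover have "0 \<le> (real n)\<^sup>2 * ln (real n) / 6" using ln_nonneg_nat[of n] by simp
    ultimately have "(real n)\<^sup>2 / 6 * (crit n - \<omega> n) - 1 \<le> real (m_lo \<omega> n)"
      unfolding m_lo_def by (intro nat_floor_bounds(1)) linarith
    then have "real (m_e n) \<le> real (m_lo \<omega> n)" using 1 m_e_bounds(2)[of n] by linarith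
    then show ?case by simp
  qed
qed

lemma crit_facts: "\<forall>\<^sub>F n in sequentially. 0 \<le> crit n - \<omega> n \<and> 0 \<le> crit n + \<omega> n \<and> crit n + \<omega> n \<le> 2 * ln (real n)"
proof -
  have "\<forall>\<^sub>F n::nat in sequentially. 0 \<le> ln (real n) + 1 / 4 * ln (ln (real n))"
    "\<forall>\<^sub>F n::nat in sequentially. ln (real n) + 3 / 4 * ln (ln (real n)) \<le> 2 * ln (real n)"
    by real_asymp+
  then show ?thesis using omega_le omega_nonneg
    by eventually_elim (auto simp: crit_def)
qed

lemma m_lo_bounds: "\<forall>\<^sub>F n in sequentially. (real n)\<^sup>2 / 6 * (crit n - \<omega> n) - 1 \<le> real (m_lo \<omega> n) \<and>
    real (m_lo \<omega> n) \<le> (real n)\<^sup>2 / 6 * (crit n - \<omega> n)"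
  using crit_facts
proof eventually_elim
  case (elim n)
  then have "0 \<le> (real n)\<^sup>2 / 6 * (crit n - \<omega> n)" by simp
  then show ?case unfolding m_lo_def using nat_floor_bounds by blast
qed

lemma m_hi_bounds: "\<forall>\<^sub>F n in sequentially. (real n)\<^sup>2 / 6 * (crit n + \<omega> n) - 1 \<le> real (m_hi \<omega> n) \<and>
    real (m_hi \<omega> n) \<le> (real n)\<^sup>2 / 6 * (crit n + \<omega> n)"
  using crit_facts
proof eventually_elim
  case (elim n)
  then have "0 \<le> (real n)\<^sup>2 / 6 * (crit n + \<omega> n)" by simp
  then show ?case unfolding m_hi_def using nat_floor_bounds by blast
qed

text \<open>About n^2 log n / 12 triples are present at \<open>m_c\<close>, and a wing is empty at
  \<open>m_lo\<close> with probability about exp(-2(crit - \<omega>)) = exp(2 \<omega>)/(n^2 log n).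
  The mean is thus of order exp(2 \<omega>).\<close>

lemma late_survivor_tendsto_0:
  "(\<lambda>n. Pr n {ts. \<not> (\<exists>(t, a)\<in>apexed n. t \<in> set (take (m_c n) ts) \<and>
      wing n a t \<inter> set (take (m_lo \<omega> n) ts) = {})}) \<longlonglongrightarrow> 0"
proof (rule no_survivor_tendsto_0)
  have ev: "\<forall>\<^sub>F n::nat in sequentially. 1 \<le> (real n)\<^sup>2 * ln (real n) / 12"
    "\<forall>\<^sub>F n::nat in sequentially. (real n)\<^sup>2 * ln (real n) / 12 + 1 \<le> (real n)\<^sup>2 * ln (real n) / 6"
    by real_asymp+
  have hi: "\<forall>\<^sub>F n in sequentially. real (m_lo \<omega> n) \<le> (real n)\<^sup>2 * ln (real n)"
    using m_lo_bounds crit_facts omega_nonneg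
  proof eventually_elim
    case (elim n)
    have "crit n - \<omega> n \<le> 2 * ln (real n)" using elim by linarith
    then have "(real n)\<^sup>2 / 6 * (crit n - \<omega> n) \<le> (real n)\<^sup>2 / 6 * (2 * ln (real n))" by (intro mult_left_mono) auto
    moreover have "0 \<le> (real n)\<^sup>2 * ln (real n)" using ln_nonneg_nat[of n] by simp
    ultimately show ?case using elim(1) by (simp only: mult.commute mult.left_commute) simp
  qed
  show "\<forall>\<^sub>F n in sequentially. 1 \<le> m_c n \<and> m_c n \<le> m_lo \<omega> n \<and> real (m_lo \<omega> n) \<le> (real n)\<^sup>2 * ln (real n)"
    using ev m_lo_ge hi
  proof eventually_elim
    case (elim n)
    then show ?case using m_c_bounds[of n] m_e_bounds[of n] by linarith
  qed
  define NR where "NR n = real n * (real n - 1) * (real n - 2) / 6" for n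
  define bR where "bR n = 2 * real n - 6" for n
  define X where "X n = (real n)\<^sup>2 * ln (real n)" for n
  \<comment> \<open>\<kappa> is the coefficient of \<open>crit n - \<omega> n\<close> in the
    exponent. It exceeds its limit 2 by so little that, for arguments up to 2 log n, the error is at
    most 1.\<close>
  define \<kappa> where "\<kappa> n = bR n * ((real n)\<^sup>2 / 6) / (NR n - bR n - X n)" for n
  have ev2: "\<forall>\<^sub>F n in sequentially. X n < NR n - bR n" "\<forall>\<^sub>F n in sequentially. bR n < NR n"
    "\<forall>\<^sub>F n in sequentially. 2 \<le> \<kappa> n" "\<forall>\<^sub>F n in sequentially. (\<kappa> n - 2) * (2 * ln (real n)) \<le> 1"
    unfolding NR_def bR_def X_def \<kappa>_def by real_asymp+
  have "filterlim (\<lambda>n. 2 * \<omega> n - 1) at_top sequentially"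
    using filterlim_tendsto_add_at_top[OF tendsto_const[of "-1"] filterlim_tendsto_pos_mult_at_top[OF tendsto_const[of 2] _ omega_lim]]
    by simp
  then have "filterlim (\<lambda>n. exp (2 * \<omega> n - 1)) at_top sequentially"
    by (rule filterlim_compose[OF exp_at_top])
  then have lim: "filterlim (\<lambda>n. 1 / 12 * exp (2 * \<omega> n - 1)) at_top sequentially"
    by (rule filterlim_tendsto_pos_mult_at_top[OF tendsto_const, rotated]) simp
  show "filterlim (\<lambda>n. real (m_c n) * (1 - real (m_lo \<omega> n) / real ((n choose 3) - (2 * n - 6))) ^ (2 * n - 6))
      at_top sequentially"
  proof (rule filterlim_at_top_mono[OF lim])
    show "\<forall>\<^sub>F n in sequentially. 1 / 12 * exp (2 * \<omega> n - 1) \<le>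
        real (m_c n) * (1 - real (m_lo \<omega> n) / real ((n choose 3) - (2 * n - 6))) ^ (2 * n - 6)"
      using ev2 hi m_lo_bounds crit_facts omega_nonneg eventually_ge_at_top[of "5::nat"]
    proof eventually_elim
      case (elim n)
      have b: "real (2 * n - 6) = bR n" using elim by (simp add: bR_def of_nat_diff)
      have Nb: "real ((n choose 3) - (2 * n - 6)) = NR n - bR n"
        using real_choose_3_diff[of n] elim by (simp only: NR_def bR_def)
      let ?D = "NR n - bR n" and ?m = "real (m_lo \<omega> n)"
      let ?v = "?m / ?D"
      have b0: "0 < bR n" using elim by (simp add: bR_def)
      have D: "0 < ?D" "?m \<le> X n" "X n < ?D" using elim by (auto simp: X_def)
      have v: "0 \<le> ?v" "?v < 1" using D by auto
      have "exp (- (?v / (1 - ?v))) \<le> 1 - ?v" by (rule exp_le_one_minus[OF v(2)])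
      then have "exp (- (?v / (1 - ?v))) ^ (2 * n - 6) \<le> (1 - ?v) ^ (2 * n - 6)" by (intro power_mono) auto
      then have 1: "exp (- (bR n * (?v / (1 - ?v)))) \<le> (1 - ?v) ^ (2 * n - 6)"
        by (simp add: exp_of_nat_mult[symmetric] b[symmetric])
      have "bR n * (?v / (1 - ?v)) = bR n * ?m / (?D - ?m)"
        using odds_eq[of ?D ?m] D by (simp only: times_divide_eq_right)
      also have "\<dots> \<le> bR n * ((real n)\<^sup>2 / 6 * (crit n - \<omega> n)) / (?D - X n)"
        using D elim b0 by (intro frac_le mult_left_mono) auto
      also have "\<dots> = \<kappa> n * (crit n - \<omega> n)" by (simp add: \<kappa>_def)
      also have "\<dots> = 2 * (crit n - \<omega> n) + (\<kappa> n - 2) * (crit n - \<omega> n)" by (simp add: algebra_simps)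
      also have "(\<kappa> n - 2) * (crit n - \<omega> n) \<le> (\<kappa> n - 2) * (2 * ln (real n))"
        using elim by (intro mult_left_mono) auto
      also have "\<dots> \<le> 1" using elim by simp
      finally have 2: "bR n * (?v / (1 - ?v)) \<le> 2 * (crit n - \<omega> n) + 1" by simp
      have "exp (2 * \<omega> n - 1) * exp (- 2 * crit n) = exp (- (2 * (crit n - \<omega> n) + 1))"
        by (simp add: exp_add[symmetric] algebra_simps)
      also have "\<dots> \<le> exp (- (bR n * (?v / (1 - ?v))))" using 2 by simp
      also note 1
      finally have 3: "exp (2 * \<omega> n - 1) * (1 / ((real n)\<^sup>2 * ln (real n))) \<le> (1 - ?v) ^ (2 * n - 6)"
        using exp_minus_2_crit[of n] elim by simp
      have ln0: "0 < ln (real n)" using elim by simp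
      have "1 / 12 * exp (2 * \<omega> n - 1) = ((real n)\<^sup>2 * ln (real n) / 12) * (exp (2 * \<omega> n - 1) * (1 / ((real n)\<^sup>2 * ln (real n))))"
        using ln0 elim by simp
      also have "\<dots> \<le> real (m_c n) * (1 - ?v) ^ (2 * n - 6)"
        using 3 m_c_bounds(1)[of n] ln0 by (intro mult_mono) auto
      finally show ?case unfolding Nb .
    qed
  qed
qed

end

section \<open>The two properties at time \<open>m_b\<close>: few shared edges, robust cuts\<close>

lemma overlaps_tendsto_0:
  "(\<lambda>n. Pr n {ts. n \<le> card {(t, u). t \<in> set (take (m_b n) ts) \<and> u \<in> set (take (m_b n) ts) \<and> card (t \<inter> u) = 2}})
    \<longlonglongrightarrow> 0"
proof (rule Pr_tendsto_0I)
  define NR where "NR n = real n * (real n - 1) * (real n - 2) / 6" for n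
  let ?F = "\<lambda>n. 3 * (real n * (ln (real n))\<^sup>2 + 1)\<^sup>2 / NR n"
  show "?F \<longlonglongrightarrow> 0" unfolding NR_def by real_asymp
  have "\<forall>\<^sub>F n in sequentially. real n * (ln (real n))\<^sup>2 + 1 \<le> NR n" unfolding NR_def by real_asymp
  then show "\<forall>\<^sub>F n in sequentially. Pr n {ts. n \<le> card {(t, u). t \<in> set (take (m_b n) ts) \<and>
      u \<in> set (take (m_b n) ts) \<and> card (t \<inter> u) = 2}} \<le> ?F n"
    using eventually_ge_at_top[of "3::nat"]
  proof eventually_elim
    case (elim n)
    have N: "real (n choose 3) = NR n" by (simp add: NR_def real_choose_3)
    have "real (m_b n) \<le> real (n choose 3)" using m_b_bounds(2)[of n] elim N by linarith
    then have "Pr n {ts. n \<le> card {(t, u). t \<in> set (take (m_b n) ts) \<and>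
        u \<in> set (take (m_b n) ts) \<and> card (t \<inter> u) = 2}} \<le> 3 * (real (m_b n))\<^sup>2 / real (n choose 3)"
      using elim by (intro Pr_overlaps_le) auto
    also have "\<dots> \<le> ?F n" unfolding N
    proof (rule divide_right_mono)
      show "3 * (real (m_b n))\<^sup>2 \<le> 3 * (real n * (ln (real n))\<^sup>2 + 1)\<^sup>2"
        using m_b_bounds(2)[of n] by (intro mult_left_mono power_mono) auto
      show "0 \<le> NR n" using N by (metis of_nat_0_le_iff)
    qed
    finally show ?case .
  qed
qed

text \<open>The square of the logarithm in \<open>m_b\<close> makes \<open>Y\<close> about
  exp(-(3/2) log^2 n), smaller than any power of 1/n; this beats the n vertices as well as the
  prefactor \<open>NR\<close>.\<close>

lemma bad_cut_tendsto_0: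
  "(\<lambda>n. Pr n {ts. \<exists>A. A \<subseteq> {1..n} \<and> A \<noteq> {} \<and> A \<noteq> {1..n} \<and> card (set (take (m_b n) ts) \<inter> crossing n A) < 2})
    \<longlonglongrightarrow> 0"
proof (rule Pr_tendsto_0I)
  define NR where "NR n = real n * (real n - 1) * (real n - 2) / 6" for n
  define Y where "Y n = exp (- (real n * (ln (real n))\<^sup>2 / NR n * (real n * (real n - 2) / 4)))" for n
  let ?F = "\<lambda>n. 2 * exp 1 * NR n * (exp (real n * Y n) - 1)"
  show "?F \<longlonglongrightarrow> 0" unfolding NR_def Y_def by real_asymp
  have "\<forall>\<^sub>F n in sequentially. real n * (ln (real n))\<^sup>2 + 1 \<le> NR n" unfolding NR_def by real_asymp
  then show "\<forall>\<^sub>F n in sequentially. Pr n {ts. \<exists>A. A \<subseteq> {1..n} \<and> A \<noteq> {} \<and> A \<noteq> {1..n} \<and>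
      card (set (take (m_b n) ts) \<inter> crossing n A) < 2} \<le> ?F n"
    using eventually_ge_at_top[of "3::nat"]
  proof eventually_elim
    case (elim n)
    have N: "real (n choose 3) = NR n" by (simp add: NR_def real_choose_3)
    then have NR0: "0 \<le> NR n" by (metis of_nat_0_le_iff)
    have le: "real (m_b n) \<le> real (n choose 3)" using m_b_bounds(2)[of n] elim N by linarith
    define y where "y = exp (- (real (m_b n) / real (n choose 3) * (real n * (real n - 2) / 4)))"
    have "y \<le> Y n"
      unfolding y_def Y_def N exp_le_cancel_iff neg_le_iff_le
      using m_b_bounds(1)[of n] NR0 elim by (intro mult_right_mono divide_right_mono) auto
    have "(1 + y) ^ n \<le> exp y ^ n" using exp_ge_add_one_self[of y] by (intro power_mono) (auto simp: y_def)
    also have "\<dots> = exp (real n * y)" by (simp add: exp_of_nat_mult)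
    also have "\<dots> \<le> exp (real n * Y n)" using \<open>y \<le> Y n\<close> by (simp add: mult_left_mono)
    finally have 1: "(1 + y) ^ n \<le> exp (real n * Y n)" .
    have "Pr n {ts. \<exists>A. A \<subseteq> {1..n} \<and> A \<noteq> {} \<and> A \<noteq> {1..n} \<and>
        card (set (take (m_b n) ts) \<inter> crossing n A) < 2} \<le> 2 * exp 1 * real (n choose 3) * ((1 + y) ^ n - 1)"
      unfolding y_def using elim le by (intro Pr_bad_cut_le) auto
    also have "\<dots> \<le> ?F n" unfolding N using 1 NR0 by (intro mult_left_mono) auto
    finally show ?case .
  qed
qed

section \<open>No cocycle obstruction of size at least 3 from \<open>m_e\<close> on\<close>

lemma geometric_tail_le:
  fixes \<theta> :: real
  assumes "finite K" "\<And>k. k \<in> K \<Longrightarrow> k0 \<le> k" "0 \<le> \<theta>" "\<theta> \<le> 1 / 2"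
  shows "(\<Sum>k\<in>K. \<theta> ^ k) \<le> 2 * \<theta> ^ k0"
proof -
  have inj: "inj_on (\<lambda>k. k - k0) K"
  proof (rule inj_onI)
    fix x y assume "x \<in> K" "y \<in> K" "x - k0 = y - k0"
    then show "x = y" using assms(2)[of x] assms(2)[of y] by linarith
  qed
  have "(\<Sum>k\<in>K. \<theta> ^ k) = (\<Sum>k\<in>K. \<theta> ^ k0 * \<theta> ^ (k - k0))"
    by (rule sum.cong) (auto simp: power_add[symmetric] assms(2))
  also have "\<dots> = \<theta> ^ k0 * (\<Sum>j\<in>(\<lambda>k. k - k0) ` K. \<theta> ^ j)"
    by (simp add: sum_distrib_left sum.reindex[OF inj])
  also have "\<dots> \<le> \<theta> ^ k0 * 2"
  proof (rule mult_left_mono)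
    have "(\<Sum>j\<in>(\<lambda>k. k - k0) ` K. \<theta> ^ j) \<le> (\<Sum>j. \<theta> ^ j)"
      using assms by (intro sum_le_suminf) auto
    also have "(\<Sum>j. \<theta> ^ j) = 1 / (1 - \<theta>)" using assms by (intro suminf_geometric) auto
    also have "\<dots> \<le> 2" using assms by (simp add: field_simps)
    finally show "(\<Sum>j\<in>(\<lambda>k. k - k0) ` K. \<theta> ^ j) \<le> 2" .
  qed (use assms(3) in simp)
  finally show ?thesis by simp
qed

text \<open>Three geometric series: sizes 3 to 12 up to \<open>m_3\<close> with the
  private-extension bound, sizes from 13 up to \<open>m_3\<close> with the cone bound, and all sizes
  from \<open>m_3\<close> on with the cone bound.\<close>

lemma obstruction_tendsto_0:
  "(\<lambda>n. Pr n {ts. \<exists>m\<ge>m_e n. \<exists>k\<ge>3. \<exists>e\<in>pairs n. \<exists>(S, A)\<in>pair_trees n e k. obstruction n (set (take m ts)) k S A})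
    \<longlonglongrightarrow> 0"
proof (rule Pr_tendsto_0I)
  define NR where "NR n = real n * (real n - 1) * (real n - 2) / 6" for n
  \<comment> \<open>\<open>R\<close> bounds 2 m_3/N and is of order (log n)/n, so the prefactor
    n/(4R) is of order n^2/log n. The ratios \<theta>1, \<theta>2, \<theta>3 belong to the three
    series.\<close>
  define R where "R n = 2 * (2 * (real n)\<^sup>2 * ln (real n) + 1) / NR n" for n
  define \<theta>1 where "\<theta>1 n = 8 * real n * R n * exp (- (ln (real n) / real n) * (real n - 13))" for n
  define \<theta>2 where "\<theta>2 n = 8 * real n * R n * exp (- ln (real n) / 6)" for n
  define \<theta>3 where "\<theta>3 n = 8 * real n * exp (- 2 * ln (real n))" for n
  \<comment> \<open>\<theta>1 is of order (log n)/n, so its cube beats n^2. \<theta>2 is of order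
    n^(-1/6) log n, and 13 is the first exponent with 13/6 > 2. \<theta>3 is 8/n, against a
    prefactor of order n.\<close>
  define F where "F n = real n / (4 * R n) * (2 * \<theta>1 n ^ 3) + exp 1 * (real n / (4 * R n)) * (2 * \<theta>2 n ^ 13) +
      exp 1 * (real n / 4) * (2 * \<theta>3 n ^ 3)" for n
  show "F \<longlonglongrightarrow> 0" unfolding F_def \<theta>1_def \<theta>2_def \<theta>3_def R_def NR_def by real_asymp
  have ev: "\<forall>\<^sub>F n in sequentially. \<theta>1 n \<le> 1 / 2" "\<forall>\<^sub>F n in sequentially. \<theta>2 n \<le> 1 / 2"
    "\<forall>\<^sub>F n in sequentially. \<theta>3 n \<le> 1 / 2" "\<forall>\<^sub>F n in sequentially. 0 < R n"
    "\<forall>\<^sub>F n in sequentially. 2 * (2 * (real n)\<^sup>2 * ln (real n) + 1) \<le> NR n"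
    "\<forall>\<^sub>F n::nat in sequentially. (real n)\<^sup>2 * ln (real n) / 6 + 1 \<le> 2 * (real n)\<^sup>2 * ln (real n)"
    "\<forall>\<^sub>F n in sequentially. 24 * real n \<le> NR n"
    "\<forall>\<^sub>F n::nat in sequentially. 12 * ln (real n) / real n \<le> 1"
    unfolding \<theta>1_def \<theta>2_def \<theta>3_def R_def NR_def by real_asymp+
  show "\<forall>\<^sub>F n in sequentially. Pr n {ts. \<exists>m\<ge>m_e n. \<exists>k\<ge>3. \<exists>e\<in>pairs n. \<exists>(S, A)\<in>pair_trees n e k.
      obstruction n (set (take m ts)) k S A} \<le> F n"
    using ev eventually_ge_at_top[of "20::nat"]
  proof eventually_elim
    case (elim n)
    let ?N = "n choose 3"
    have N: "real ?N = NR n" by (simp add: NR_def real_choose_3)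
    have n: "20 \<le> n" by (rule elim(9))
    have NR0: "0 < NR n" using elim(7) n by simp
    have Npos: "0 < ?N" using NR0 N by (metis of_nat_0_less_iff)
    have NR_le: "NR n \<le> (real n) ^ 3 / 6"
    proof -
      have "(real n - 1) * (real n - 2) \<le> real n * real n" using n by (intro mult_mono) auto
      then have "real n * ((real n - 1) * (real n - 2)) \<le> real n * (real n * real n)" by (rule mult_left_mono) simp
      then have "real n * ((real n - 1) * (real n - 2)) / 6 \<le> real n * (real n * real n) / 6" by (rule divide_right_mono) simp
      then show ?thesis by (simp only: NR_def power3_eq_cube mult.assoc)
    qed
    have ln0: "0 \<le> ln (real n)" by (rule ln_nonneg_nat)
    have m3: "2 * m_3 n \<le> ?N"
    proof -
      have "real (2 * m_3 n) \<le> real ?N" using m_3_bounds(2)[of n] elim(5) N by simp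
      then show ?thesis by linarith
    qed
    have me3: "m_e n \<le> m_3 n" using m_e_bounds(2)[of n] m_3_bounds(1)[of n] elim(6) by linarith
    have pe: "ln (real n) / real n \<le> real (m_e n) / real ?N"
    proof -
      have "ln (real n) / real n = ((real n)\<^sup>2 * ln (real n) / 6) / ((real n) ^ 3 / 6)"
        using n by (simp add: field_simps power2_eq_square power3_eq_cube)
      also have "\<dots> \<le> real (m_e n) / NR n" using m_e_bounds(1)[of n] NR_le NR0 ln0 by (intro frac_le) auto
      finally show ?thesis by (simp add: N)
    qed
    have p3: "12 * ln (real n) / real n \<le> real (m_3 n) / real ?N"
    proof -
      have "12 * ln (real n) / real n = (2 * (real n)\<^sup>2 * ln (real n)) / ((real n) ^ 3 / 6)"
        using n by (simp add: field_simps power2_eq_square power3_eq_cube)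
      also have "\<dots> \<le> real (m_3 n) / NR n" using m_3_bounds(1)[of n] NR_le NR0 ln0 by (intro frac_le) auto
      finally show ?thesis by (simp add: N)
    qed
    have rho: "2 * real (m_3 n) / real ?N \<le> R n"
      unfolding R_def N using m_3_bounds(2)[of n] NR0 by (intro divide_right_mono) auto
    \<comment> \<open>The cone bound n k \<le> 3 card (odd_triples n S) confines k to a finite
      range, which the union bound requires.\<close>
    define K where "K = {k. 3 \<le> k \<and> n * k \<le> 3 * ?N}"
    have finK: "finite K"
    proof (rule finite_subset)
      show "K \<subseteq> {..3 * ?N}"
      proof
        fix k assume "k \<in> K"
        then have "n * k \<le> 3 * ?N" by (simp add: K_def)
        moreover have "k \<le> n * k" using n by (cases n) auto
        ultimately have "k \<le> 3 * ?N" by linarith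
        then show "k \<in> {..3 * ?N}" by simp
      qed
    qed simp
    have Kob: "k \<in> K" if "3 \<le> k" "obstruction n T k S A" for k T S A
    proof -
      have "card (odd_triples n S) \<le> ?N"
        using card_mono[of "triples n" "odd_triples n S"] by (auto simp: odd_triples_def)
      then show ?thesis using that by (auto simp: K_def obstruction_def)
    qed
    let ?early = "\<lambda>k. {ts. \<exists>e\<in>pairs n. \<exists>(S, A)\<in>pair_trees n e k. \<exists>m\<in>{m_e n..m_3 n}. obstruction n (set (take m ts)) k S A}"
    let ?late = "\<lambda>k. {ts. \<exists>e\<in>pairs n. \<exists>(S, A)\<in>pair_trees n e k. \<exists>m\<ge>m_3 n. obstruction n (set (take m ts)) k S A}"
    \<comment> \<open>Half of the cone bound nk/3 is used, so that
      \<open>2 * \<beta> \<le> N\<close> follows from n k \<le> 3N. The loss is affordable for k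
      \<ge> 13 and after \<open>m_3\<close>.\<close>
    have div6: "(n * k) div 6 \<le> card (odd_triples n S)" if "obstruction n T k S A" for T k S A
      using that by (auto simp: obstruction_def)
    have div6N: "2 * ((n * k) div 6) \<le> ?N" if "k \<in> K" for k using that by (auto simp: K_def)
    have div6r: "real (n * k) / 6 - 1 \<le> real ((n * k) div 6)" for k
    proof -
      have "x < 6 * (x div 6) + 6" for x :: nat by presburger
      then have "real (n * k) < real (6 * ((n * k) div 6) + 6)" by (rule of_nat_less_iff[THEN iffD2])
      then show ?thesis by simp
    qed
    have split: "real n / 4 * (8 * real n) ^ k * (c ^ k * R n ^ (k - 1)) = real n / (4 * R n) * (8 * real n * R n * c) ^ k"
      if "1 \<le> k" for k and c :: real
    proof -
      have "R n ^ k = R n * R n ^ (k - 1)" using that by (simp add: power_eq_if)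
      then show ?thesis using elim(4) by (simp add: power_mult_distrib field_simps)
    qed
    have early_small: "Pr n (?early k) \<le> real n / (4 * R n) * \<theta>1 n ^ k" if k: "k \<in> K" "k \<le> 12" for k
    proof -
      let ?\<beta> = "k * (n - 1 - k)"
      have k3: "3 \<le> k" using k by (simp add: K_def)
      have \<beta>2: "2 * ?\<beta> \<le> ?N"
      proof -
        have "k * (n - 1 - k) \<le> 12 * n" using k by (intro mult_mono) auto
        moreover have "real (24 * n) \<le> real ?N" using elim(7) N by simp
        then have "24 * n \<le> ?N" by linarith
        ultimately show ?thesis by linarith
      qed
      have "Pr n (?early k) \<le> real n / 4 * (8 * real n) ^ k *
          (exp (- (real (m_e n) / real ?N) * real ?\<beta>) * (2 * real (m_3 n) / real ?N) ^ (k - 1))"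
        by (rule Pr_obstruction_early_le) (use n Npos m3 \<beta>2 me3 in \<open>auto simp: obstruction_def\<close>)
      also have "\<dots> \<le> real n / 4 * (8 * real n) ^ k *
          (exp (- (ln (real n) / real n) * (real n - 13)) ^ k * R n ^ (k - 1))"
      proof (intro mult_left_mono mult_mono power_mono rho)
        \<comment> \<open>k \<le> 12 gives n - 1 - k \<ge> n - 13.\<close>
        have "real k * (real n - 13) \<le> real ?\<beta>"
        proof -
          have "real n - 13 \<le> real (n - 1 - k)" using k n by linarith
          then show ?thesis unfolding of_nat_mult by (rule mult_left_mono) simp
        qed
        then have "(ln (real n) / real n) * (real k * (real n - 13)) \<le> (real (m_e n) / real ?N) * real ?\<beta>"
          using pe ln0 n by (intro mult_mono) auto
        then show "exp (- (real (m_e n) / real ?N) * real ?\<beta>) \<le> exp (- (ln (real n) / real n) * (real n - 13)) ^ k"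
          unfolding exp_of_nat_mult[symmetric] by (simp add: mult_ac)
      qed (use elim(4) in auto)
      also have "\<dots> = real n / (4 * R n) * \<theta>1 n ^ k"
        using split[of k] k3 by (simp add: \<theta>1_def)
      finally show ?thesis .
    qed
    have early_large: "Pr n (?early k) \<le> exp 1 * (real n / (4 * R n)) * \<theta>2 n ^ k" if k: "k \<in> K" for k
    proof -
      let ?\<beta> = "(n * k) div 6"
      have nk: "0 \<le> real (n * k) / 6 - 1"
      proof -
        have "20 * 3 \<le> n * k" using n k by (intro mult_mono) (auto simp: K_def)
        then have "real (20 * 3) \<le> real (n * k)" by (rule of_nat_mono)
        then show ?thesis by simp
      qed
      have k3: "3 \<le> k" using k by (simp add: K_def)
      have "Pr n (?early k) \<le> real n / 4 * (8 * real n) ^ k *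
          (exp (- (real (m_e n) / real ?N) * real ?\<beta>) * (2 * real (m_3 n) / real ?N) ^ (k - 1))"
        by (rule Pr_obstruction_early_le) (use n Npos m3 div6N[OF k] me3 div6 in auto)
      also have "\<dots> \<le> real n / 4 * (8 * real n) ^ k *
          ((exp 1 * exp (- ln (real n) / 6) ^ k) * R n ^ (k - 1))"
      proof (intro mult_left_mono mult_mono power_mono rho)
        have "(ln (real n) / real n) * (real (n * k) / 6 - 1) \<le> (real (m_e n) / real ?N) * real ?\<beta>"
          using pe ln0 n div6r[of k] nk by (intro mult_mono) auto
        moreover have "(ln (real n) / real n) * (real (n * k) / 6 - 1) = real k * ln (real n) / 6 - ln (real n) / real n"
          using n by (simp add: field_simps)
        moreover have "ln (real n) / real n \<le> 1" using elim(8) ln0 n by (simp add: field_simps)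
        ultimately have "- (real (m_e n) / real ?N) * real ?\<beta> \<le> 1 + real k * (- ln (real n) / 6)"
          by simp
        then show "exp (- (real (m_e n) / real ?N) * real ?\<beta>) \<le> exp 1 * exp (- ln (real n) / 6) ^ k"
          unfolding exp_of_nat_mult[symmetric] exp_add[symmetric] by simp
      qed (use elim(4) in auto)
      also have "\<dots> = exp 1 * (real n / 4 * (8 * real n) ^ k * (exp (- ln (real n) / 6) ^ k * R n ^ (k - 1)))"
        by (simp only: mult_ac)
      also have "\<dots> = exp 1 * (real n / (4 * R n)) * \<theta>2 n ^ k"
        using split[of k] k3 by (simp add: \<theta>2_def)
      finally show ?thesis .
    qed
    have late: "Pr n (?late k) \<le> exp 1 * (real n / 4) * \<theta>3 n ^ k" if k: "k \<in> K" for k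
    proof -
      let ?\<beta> = "(n * k) div 6"
      have nk: "0 \<le> real (n * k) / 6 - 1"
      proof -
        have "20 * 3 \<le> n * k" using n k by (intro mult_mono) (auto simp: K_def)
        then have "real (20 * 3) \<le> real (n * k)" by (rule of_nat_mono)
        then show ?thesis by simp
      qed
      have "Pr n (?late k) \<le> real n / 4 * (8 * real n) ^ k * exp (- (real (m_3 n) / real ?N) * real ?\<beta>)"
        by (rule Pr_obstruction_late_le) (use n Npos m3 div6N[OF k] div6 in auto)
      also have "\<dots> \<le> real n / 4 * (8 * real n) ^ k * (exp 1 * exp (- 2 * ln (real n)) ^ k)"
      proof (rule mult_left_mono)
        have "(12 * ln (real n) / real n) * (real (n * k) / 6 - 1) \<le> (real (m_3 n) / real ?N) * real ?\<beta>"
          using p3 ln0 n div6r[of k] nk by (intro mult_mono) auto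
        moreover have "(12 * ln (real n) / real n) * (real (n * k) / 6 - 1) = real k * (2 * ln (real n)) - 12 * ln (real n) / real n"
          using n by (simp add: field_simps)
        ultimately have "- (real (m_3 n) / real ?N) * real ?\<beta> \<le> 1 + real k * (- 2 * ln (real n))"
          using elim(8) by simp
        then show "exp (- (real (m_3 n) / real ?N) * real ?\<beta>) \<le> exp 1 * exp (- 2 * ln (real n)) ^ k"
          unfolding exp_of_nat_mult[symmetric] exp_add[symmetric] by simp
      qed simp
      also have "\<dots> = exp 1 * (real n / 4) * \<theta>3 n ^ k" by (simp add: \<theta>3_def power_mult_distrib mult_ac)
      finally show ?thesis .
    qed
    let ?f = "\<lambda>k. (if k \<le> 12 then real n / (4 * R n) * \<theta>1 n ^ k else exp 1 * (real n / (4 * R n)) * \<theta>2 n ^ k) +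
        exp 1 * (real n / 4) * \<theta>3 n ^ k"
    have "Pr n {ts. \<exists>m\<ge>m_e n. \<exists>k\<ge>3. \<exists>e\<in>pairs n. \<exists>(S, A)\<in>pair_trees n e k. obstruction n (set (take m ts)) k S A} \<le>
        Pr n {ts. \<exists>k\<in>K. ts \<in> ?early k \<union> ?late k}"
    proof (rule measure_pmf.finite_measure_mono)
      show "{ts. \<exists>m\<ge>m_e n. \<exists>k\<ge>3. \<exists>e\<in>pairs n. \<exists>(S, A)\<in>pair_trees n e k. obstruction n (set (take m ts)) k S A} \<subseteq>
          {ts. \<exists>k\<in>K. ts \<in> ?early k \<union> ?late k}"
      proof
        fix ts assume "ts \<in> {ts. \<exists>m\<ge>m_e n. \<exists>k\<ge>3. \<exists>e\<in>pairs n. \<exists>(S, A)\<in>pair_trees n e k. obstruction n (set (take m ts)) k S A}"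
        then obtain m k e S A where *: "m_e n \<le> m" "3 \<le> k" "e \<in> pairs n" "(S, A) \<in> pair_trees n e k"
          "obstruction n (set (take m ts)) k S A" by blast
        have "k \<in> K" by (rule Kob[OF *(2,5)])
        moreover have "ts \<in> ?early k \<union> ?late k"
        proof (cases "m \<le> m_3 n")
          case True
          then have "m \<in> {m_e n..m_3 n}" using *(1) by simp
          then have "ts \<in> ?early k" using *(3-5) by blast
          then show ?thesis ..
        next
          case False
          then have "m_3 n \<le> m" by simp
          then have "ts \<in> ?late k" using *(3-5) by blast
          then show ?thesis ..
        qed
        ultimately show "ts \<in> {ts. \<exists>k\<in>K. ts \<in> ?early k \<union> ?late k}" by blast
      qed
    qed simp
    also have "\<dots> \<le> (\<Sum>k\<in>K. ?f k)"
    proof (rule Pr_union_bound[OF finK])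
      fix k assume k: "k \<in> K"
      have "Pr n (?early k \<union> ?late k) \<le> Pr n (?early k) + Pr n (?late k)"
        by (rule measure_subadditive) simp_all
      then show "Pr n (?early k \<union> ?late k) \<le> ?f k"
        using early_small[OF k] early_large[OF k] late[OF k] by (cases "k \<le> 12") simp_all
    qed
    also have "\<dots> = (\<Sum>k\<in>K. if k \<le> 12 then real n / (4 * R n) * \<theta>1 n ^ k else exp 1 * (real n / (4 * R n)) * \<theta>2 n ^ k) +
        exp 1 * (real n / 4) * (\<Sum>k\<in>K. \<theta>3 n ^ k)"
      by (simp add: sum.distrib sum_distrib_left)
    also have "(\<Sum>k\<in>K. if k \<le> 12 then real n / (4 * R n) * \<theta>1 n ^ k else exp 1 * (real n / (4 * R n)) * \<theta>2 n ^ k) =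
        real n / (4 * R n) * (\<Sum>k\<in>K \<inter> {k. k \<le> 12}. \<theta>1 n ^ k) + exp 1 * (real n / (4 * R n)) * (\<Sum>k\<in>K \<inter> - {k. k \<le> 12}. \<theta>2 n ^ k)"
      by (simp only: sum.If_cases[OF finK] sum_distrib_left)
    also have "real n / (4 * R n) * (\<Sum>k\<in>K \<inter> {k. k \<le> 12}. \<theta>1 n ^ k) + exp 1 * (real n / (4 * R n)) * (\<Sum>k\<in>K \<inter> - {k. k \<le> 12}. \<theta>2 n ^ k) +
        exp 1 * (real n / 4) * (\<Sum>k\<in>K. \<theta>3 n ^ k) \<le> F n"
      unfolding F_def
    proof (intro add_mono mult_left_mono geometric_tail_le)
      show "0 \<le> \<theta>1 n" "0 \<le> \<theta>2 n" "0 \<le> \<theta>3 n" using elim(4) by (auto simp: \<theta>1_def \<theta>2_def \<theta>3_def)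
    qed (use finK elim(1-4) in \<open>auto simp: K_def\<close>)
    finally show ?case .
  qed
qed

section \<open>The critical window: no births inside, no copies at its end\<close>

context slow_window
begin

text \<open>At x = crit - \<omega> the bound is about 3N exp(-2x)/(2n), of order exp(2 \<omega>)/log
  n. Without the division by 2n - 5 from the first-arrival bound it would diverge.\<close>

lemma born_tendsto_0:
  "(\<lambda>n. Pr n {ts. \<exists>(t, a)\<in>apexed n. \<exists>s. m_lo \<omega> n \<le> s \<and> s < length ts \<and> ts ! s = t \<and>
      wing n a t \<inter> set (take s ts) = {}}) \<longlonglongrightarrow> 0"
proof (rule Pr_tendsto_0I)
  define NR where "NR n = real n * (real n - 1) * (real n - 2) / 6" for n
  let ?F = "\<lambda>n::nat. exp 1 * (exp (ln (ln (real n)) / 2) / ln (real n))"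
  show "?F \<longlonglongrightarrow> 0" by real_asymp
  have ev: "\<forall>\<^sub>F n in sequentially. 2 * real n - 5 < NR n" 
    "\<forall>\<^sub>F n in sequentially. (real n)\<^sup>2 * ln (real n) \<le> NR n"
    "\<forall>\<^sub>F n in sequentially. 2 \<le> (2 * real n - 5) * ((real n)\<^sup>2 / 6) / NR n"
    "\<forall>\<^sub>F n in sequentially. 3 * NR n / ((2 * real n - 5) * (real n)\<^sup>2) \<le> 1"
    unfolding NR_def by real_asymp+
  show "\<forall>\<^sub>F n in sequentially. Pr n {ts. \<exists>(t, a)\<in>apexed n. \<exists>s. m_lo \<omega> n \<le> s \<and> s < length ts \<and> ts ! s = t \<and>
      wing n a t \<inter> set (take s ts) = {}} \<le> ?F n"
    using ev m_lo_bounds crit_facts omega_le omega_nonneg eventually_ge_at_top[of "5::nat"]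
  proof eventually_elim
    case (elim n)
    let ?N = "n choose 3" and ?m = "real (m_lo \<omega> n)"
    have N: "real ?N = NR n" by (simp add: NR_def real_choose_3)
    have n: "5 \<le> n" by (rule elim(9))
    have b: "real (2 * n - 5) = 2 * real n - 5" using n by (simp add: of_nat_diff)
    have NR0: "0 < NR n" using elim(1) n by linarith
    have ln0: "0 < ln (real n)" using n by simp
    have lt: "2 * n - 5 < ?N" using elim(1) N b by linarith
    have mN: "m_lo \<omega> n \<le> ?N"
    proof -
      have "(real n)\<^sup>2 / 6 * (crit n - \<omega> n) \<le> (real n)\<^sup>2 / 6 * (2 * ln (real n))"
        using elim(6,8) by (intro mult_left_mono) auto
      also have "\<dots> \<le> (real n)\<^sup>2 * ln (real n)" using ln0 by simp
      finally have "?m \<le> real ?N" using elim(2,5) N by linarith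
      then show ?thesis by simp
    qed
    have expo: "2 * (crit n - \<omega> n) - 1 \<le> ?m / NR n * (2 * real n - 5)"
    proof -
      define h where "h = (2 * real n - 5) / NR n"
      have "2 * (crit n - \<omega> n) \<le> (2 * real n - 5) * ((real n)\<^sup>2 / 6) / NR n * (crit n - \<omega> n)"
        using elim(3,6) by (intro mult_right_mono) auto
      also have "\<dots> = (real n)\<^sup>2 / 6 * (crit n - \<omega> n) * h" by (simp add: h_def)
      finally have 1: "2 * (crit n - \<omega> n) \<le> (real n)\<^sup>2 / 6 * (crit n - \<omega> n) * h" .
      have "h \<le> 1" "0 \<le> h" using elim(1) NR0 n by (auto simp: h_def)
      have "((real n)\<^sup>2 / 6 * (crit n - \<omega> n) - 1) * h \<le> ?m * h"
        using elim(5) \<open>0 \<le> h\<close> by (intro mult_right_mono) auto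
      then have "(real n)\<^sup>2 / 6 * (crit n - \<omega> n) * h - h \<le> ?m * h" by (simp only: left_diff_distrib mult_1)
      moreover have "?m / NR n * (2 * real n - 5) = ?m * h" by (simp add: h_def)
      ultimately show ?thesis using 1 \<open>h \<le> 1\<close> by linarith
    qed
    have "Pr n {ts. \<exists>(t, a)\<in>apexed n. \<exists>s. m_lo \<omega> n \<le> s \<and> s < length ts \<and> ts ! s = t \<and> wing n a t \<inter> set (take s ts) = {}} \<le>
        3 * real ?N * ((1 - ?m / real ?N) ^ (2 * n - 5) / real (2 * n - 5))"
      by (rule Pr_weak_M_born_le) (use n lt mN in auto)
    also have "\<dots> \<le> 3 * NR n * (exp (- (2 * (crit n - \<omega> n) - 1)) / (2 * real n - 5))"
      unfolding N b
    proof (intro mult_left_mono divide_right_mono)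
      have "?m / NR n \<le> 1" using ratio_le_1[OF mN] N by simp
      then have "(1 - ?m / NR n) ^ (2 * n - 5) \<le> exp (- (?m / NR n) * real (2 * n - 5))"
        using NR0 by (intro one_minus_power_le_exp) auto
      also have "\<dots> \<le> exp (- (2 * (crit n - \<omega> n) - 1))" using expo b by simp
      finally show "(1 - ?m / NR n) ^ (2 * n - 5) \<le> exp (- (2 * (crit n - \<omega> n) - 1))" .
    qed (use n NR0 in auto)
    also have "exp (- (2 * (crit n - \<omega> n) - 1)) = exp 1 * exp (2 * \<omega> n) * exp (- 2 * crit n)"
      by (simp add: exp_add[symmetric] algebra_simps)
    also have "exp (- 2 * crit n) = 1 / ((real n)\<^sup>2 * ln (real n))" using n by (intro exp_minus_2_crit) simp
    also have "3 * NR n * (exp 1 * exp (2 * \<omega> n) * (1 / ((real n)\<^sup>2 * ln (real n))) / (2 * real n - 5)) =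
        3 * NR n / ((2 * real n - 5) * (real n)\<^sup>2) * (exp 1 * (exp (2 * \<omega> n) / ln (real n)))"
      using n ln0 by (simp add: field_simps)
    also have "\<dots> \<le> 1 * (exp 1 * (exp (2 * \<omega> n) / ln (real n)))"
      using elim(4) ln0 by (intro mult_right_mono) auto
    also have "\<dots> \<le> ?F n"
      unfolding mult_1 using elim(7) ln0 by (intro mult_left_mono divide_right_mono) auto
    finally show ?case .
  qed
qed

text \<open>First moment: 3m candidate copies with m of order n^2 log n, each with an empty wing
  with probability about exp(-2 crit - 2 \<omega>), leave a mean of order exp(-2 \<omega>).\<close>

lemma weak_M_at_hi_tendsto_0:
  "(\<lambda>n. Pr n {ts. \<exists>c\<in>apexed n. weak_M n (set (take (m_hi \<omega> n) ts)) c}) \<longlonglongrightarrow> 0"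
proof (rule Pr_tendsto_0I)
  define NR where "NR n = real n * (real n - 1) * (real n - 2) / 6" for n
  define bR where "bR n = 2 * real n - 6" for n
  let ?F = "\<lambda>n::nat. 2 * exp 2 * exp (- (2 * \<omega> n))"
  have "filterlim (\<lambda>n. 2 * \<omega> n) at_top sequentially"
    by (rule filterlim_tendsto_pos_mult_at_top[OF tendsto_const[of 2] _ omega_lim]) simp
  then have "((\<lambda>n. exp (- (2 * \<omega> n))) \<longlongrightarrow> 0) sequentially"
    by (intro filterlim_compose[OF exp_at_bot] filterlim_compose[OF filterlim_uminus_at_bot_at_top])
  then show "?F \<longlonglongrightarrow> 0" using tendsto_mult_right_zero by blast
  have ev: "\<forall>\<^sub>F n in sequentially. 2 * bR n \<le> NR n"
    "\<forall>\<^sub>F n in sequentially. (real n)\<^sup>2 * ln (real n) / 3 \<le> NR n - bR n"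
    "\<forall>\<^sub>F n in sequentially. bR n * ((real n)\<^sup>2 / 6) / NR n \<le> 2"
    "\<forall>\<^sub>F n in sequentially. (2 - bR n * ((real n)\<^sup>2 / 6) / NR n) * (2 * ln (real n)) \<le> 1"
    unfolding NR_def bR_def by real_asymp+
  show "\<forall>\<^sub>F n in sequentially. Pr n {ts. \<exists>c\<in>apexed n. weak_M n (set (take (m_hi \<omega> n) ts)) c} \<le> ?F n"
    using ev m_hi_bounds crit_facts eventually_ge_at_top[of "5::nat"]
  proof eventually_elim
    case (elim n)
    let ?N = "n choose 3" and ?m = "real (m_hi \<omega> n)"
    have N: "real ?N = NR n" by (simp add: NR_def real_choose_3)
    have n: "5 \<le> n" by (rule elim(7))
    have b: "real (2 * n - 6) = bR n" using n by (simp add: bR_def of_nat_diff)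
    have b0: "0 < bR n" using n by (simp add: bR_def)
    have Nb: "real (?N - (2 * n - 6)) = NR n - bR n"
      using real_choose_3_diff[of n] n elim(1) b0 by (simp add: NR_def bR_def)
    have NR0: "0 < NR n" using elim(1) b0 by linarith
    have ln0: "0 < ln (real n)" using n by simp
    have lt: "2 * n - 6 < ?N" using elim(1) N b b0 by linarith
    have m_le: "?m \<le> (real n)\<^sup>2 * ln (real n) / 3"
    proof -
      have "(real n)\<^sup>2 / 6 * (crit n + \<omega> n) \<le> (real n)\<^sup>2 / 6 * (2 * ln (real n))"
        using elim(6) by (intro mult_left_mono) auto
      also have "\<dots> = (real n)\<^sup>2 * ln (real n) / 3" by simp
      finally show ?thesis using elim(5) by linarith
    qed
    then have "?m \<le> real (?N - (2 * n - 6))" using elim(2) Nb by linarith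
    then have mN: "m_hi \<omega> n \<le> ?N - (2 * n - 6)" by linarith
    define g where "g = bR n * ((real n)\<^sup>2 / 6) / NR n"
    have expo: "2 * crit n + 2 * \<omega> n - 2 \<le> ?m / NR n * bR n"
    proof -
      have "(2 - g) * (crit n + \<omega> n) \<le> (2 - g) * (2 * ln (real n))"
        using elim(3,6) unfolding g_def by (intro mult_left_mono) auto
      then have 1: "2 * (crit n + \<omega> n) - 1 \<le> g * (crit n + \<omega> n)" using elim(4) unfolding g_def by (simp add: algebra_simps)
      define h where "h = bR n / NR n"
      have h: "h \<le> 1" "0 \<le> h" using elim(1) NR0 b0 by (auto simp: h_def)
      have "(real n)\<^sup>2 / 6 * (crit n + \<omega> n) * h = g * (crit n + \<omega> n)" by (simp add: g_def h_def)
      then have "g * (crit n + \<omega> n) - h = ((real n)\<^sup>2 / 6 * (crit n + \<omega> n) - 1) * h"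
        by (simp only: left_diff_distrib mult_1)
      also have "\<dots> \<le> ?m * h" using elim(5) h by (intro mult_right_mono) auto
      also have "\<dots> = ?m / NR n * bR n" by (simp add: h_def)
      finally have "g * (crit n + \<omega> n) - h \<le> ?m / NR n * bR n" .
      with 1 h(1) have "2 * (crit n + \<omega> n) - 2 \<le> ?m / NR n * bR n" by linarith
      then show ?thesis by (simp only: distrib_left)
    qed
    have "Pr n {ts. \<exists>c\<in>apexed n. weak_M n (set (take (m_hi \<omega> n) ts)) c} \<le>
        3 * real ?N * ((1 - ?m / real ?N) ^ (2 * n - 6) * (?m / real (?N - (2 * n - 6))))"
      by (rule Pr_weak_M_le) (use lt mN in auto)
    also have "\<dots> = (1 - ?m / NR n) ^ (2 * n - 6) * (3 * NR n / (NR n - bR n) * ?m)"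
      unfolding N Nb by simp
    also have "\<dots> \<le> exp (- (2 * crit n + 2 * \<omega> n - 2)) * (6 * ((real n)\<^sup>2 * ln (real n) / 3))"
    proof (intro mult_mono m_le)
      have "?m / NR n \<le> 1" using ratio_le_1[of "m_hi \<omega> n" ?N] mN N by simp
      then have "(1 - ?m / NR n) ^ (2 * n - 6) \<le> exp (- (?m / NR n) * real (2 * n - 6))"
        using NR0 by (intro one_minus_power_le_exp) auto
      also have "\<dots> \<le> exp (- (2 * crit n + 2 * \<omega> n - 2))" using expo b by simp
      finally show "(1 - ?m / NR n) ^ (2 * n - 6) \<le> exp (- (2 * crit n + 2 * \<omega> n - 2))" .
      show "3 * NR n / (NR n - bR n) \<le> 6" using elim(1) b0 NR0 by (simp add: field_simps)
      show "0 \<le> 3 * NR n / (NR n - bR n) * ?m" using elim(1) b0 NR0 by simp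
    qed auto
    also have "exp (- (2 * crit n + 2 * \<omega> n - 2)) = exp 2 * exp (- (2 * \<omega> n)) * exp (- 2 * crit n)"
      by (simp add: exp_add[symmetric] algebra_simps)
    also have "exp (- 2 * crit n) = 1 / ((real n)\<^sup>2 * ln (real n))" using n by (intro exp_minus_2_crit) simp
    also have "exp 2 * exp (- (2 * \<omega> n)) * (1 / ((real n)\<^sup>2 * ln (real n))) * (6 * ((real n)\<^sup>2 * ln (real n) / 3)) = ?F n"
      using n ln0 by simp
    finally show ?case .
  qed
qed

end

section \<open>The hitting time\<close>

text \<open>A vertex isolated at time n is isolated at all earlier times, and pairs of triples
  sharing an edge only accumulate; so one condition at n and one at \<open>m_b\<close> settle all
  times up to \<open>m_b\<close>.\<close>

lemma complex_at_not_connected: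
  assumes "n \<ge> 2" "length ts = n choose 3" "distinct ts" "set ts = triples n" "m_b n \<le> n choose 3"
    and isolated: "\<not> (\<forall>v\<in>{1..n}. \<exists>t\<in>set (take n ts). v \<in> t)"
    and overlaps: "card {(t, u). t \<in> set (take (m_b n) ts) \<and> u \<in> set (take (m_b n) ts) \<and> card (t \<inter> u) = 2} < n"
    and "m \<le> m_b n"
  shows "\<not> homologically_connected (complex_at n ts m)"
proof -
  define T where "T = set (take m ts)"
  have T: "T \<subseteq> triples n" using assms(4) set_take_subset[of m ts] by (simp add: T_def)
  show ?thesis
  proof (cases "m \<le> n")
    case True
    obtain v where v: "v \<in> {1..n}" "\<And>t. t \<in> set (take n ts) \<Longrightarrow> v \<notin> t" using isolated by blast
    have "T \<subseteq> set (take n ts)" using True by (simp add: T_def set_take_subset_set_take)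
    then have vT: "v \<notin> t" if "t \<in> T" for t using v(2) that by blast
    obtain w where "w \<in> {1..n}" "v \<noteq> w"
    proof
      show "(if v = 1 then 2 else 1) \<in> {1..n}" "v \<noteq> (if v = 1 then 2 else 1)" using assms(1) by auto
    qed
    then have "\<not> trivial_group (reduced_homology_F2 (complex_of_triples n T) 0)"
      using not_homology_0_if_isolated[OF T v(1)] vT by blast
    then show ?thesis by (simp add: homologically_connected_def complex_at_def T_def)
  next
    case False
    let ?P = "\<lambda>T. {(t, u). t \<in> T \<and> u \<in> T \<and> card (t \<inter> u) = 2}"
    have "card T = m" using assms(2,3,5,8) by (simp add: T_def distinct_card)
    moreover have "card (?P T) < n"
    proof -
      have sub: "T \<subseteq> set (take (m_b n) ts)" using assms(8) by (simp add: T_def set_take_subset_set_take)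
      have fin: "finite (?P (set (take (m_b n) ts)))"
        by (rule finite_subset[of _ "set (take (m_b n) ts) \<times> set (take (m_b n) ts)"]) auto
      have "card (?P T) \<le> card (?P (set (take (m_b n) ts)))"
        using sub by (intro card_mono[OF fin]) blast
      then show ?thesis using overlaps by simp
    qed
    moreover have "3 * card T \<le> card (covered_pairs T) + card (?P T)" by (rule three_card_le_covered[OF T])
    \<comment> \<open>With m = card T > n and fewer than n overlaps, the covered pairs number more
      than 3m - n > m + n.\<close>
    ultimately have "card T + n < card (covered_pairs T)" using False by linarith
    then have "\<not> trivial_group (reduced_homology_F2 (complex_of_triples n T) 1)"
      by (rule not_homology_1_if_many_pairs[OF T])
    then show ?thesis by (simp add: homologically_connected_def complex_at_def T_def)
  qed
qed

text \<open>The deterministic core: outside the eight bad events, the full behaviour of a single run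
  follows without further probability.\<close>

lemma good_process:
  fixes n m1 m2 :: nat and ts :: "nat set list"
  defines "\<tau> \<equiv> last_M_disappears n ts"
  assumes "n \<ge> 2" "length ts = n choose 3" "distinct ts" "set ts = triples n" "m_b n \<le> n choose 3"
    and order: "m_b n \<le> m_c n" "m_c n \<le> m1" "m_e n \<le> m1" "m1 \<le> m2"
    and isolated: "\<not> (\<forall>v\<in>{1..n}. \<exists>t\<in>set (take n ts). v \<in> t)"
    and overlaps: "card {(t, u). t \<in> set (take (m_b n) ts) \<and> u \<in> set (take (m_b n) ts) \<and> card (t \<inter> u) = 2} < n"
    and cuts: "\<not> (\<exists>A. A \<subseteq> {1..n} \<and> A \<noteq> {} \<and> A \<noteq> {1..n} \<and> card (set (take (m_b n) ts) \<inter> crossing n A) < 2)"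
    and surv1: "\<exists>(t, a)\<in>apexed n. t \<in> set (take (m_b n) ts) \<and> wing n a t \<inter> set (take (m_c n) ts) = {}"
    and surv2: "\<exists>(t, a)\<in>apexed n. t \<in> set (take (m_c n) ts) \<and> wing n a t \<inter> set (take m1 ts) = {}"
    and born: "\<not> (\<exists>(t, a)\<in>apexed n. \<exists>s. m1 \<le> s \<and> s < length ts \<and> ts ! s = t \<and> wing n a t \<inter> set (take s ts) = {})"
    and obst: "\<not> (\<exists>m\<ge>m_e n. \<exists>k\<ge>3. \<exists>e\<in>pairs n. \<exists>(S, A)\<in>pair_trees n e k. obstruction n (set (take m ts)) k S A)"
    and none: "\<not> (\<exists>c\<in>apexed n. weak_M n (set (take m2 ts)) c)"
  shows "m1 < \<tau> \<and> \<tau> \<le> m2 \<and> (\<forall>m<\<tau>. \<not> homologically_connected (complex_at n ts m)) \<and>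
    (\<forall>m\<ge>\<tau>. homologically_connected (complex_at n ts m))"
proof -
  let ?T = "\<lambda>m. set (take m ts)"
  let ?M = "\<lambda>m. \<exists>a b c. copy_of_M (complex_at n ts m) a b c"
  have T: "?T m \<subseteq> triples n" for m using assms(5) set_take_subset[of m ts] by simp
  have mono: "?T m \<subseteq> ?T m'" if "m \<le> m'" for m m' using that by (rule set_take_subset_set_take)
  have cut2: "2 \<le> card (?T m \<inter> crossing n A)" if "m_b n \<le> m" "A \<subseteq> {1..n}" "A \<noteq> {}" "A \<noteq> {1..n}" for m A
  proof -
    have "2 \<le> card (?T (m_b n) \<inter> crossing n A)" using cuts that by (meson not_less)
    also have "\<dots> \<le> card (?T m \<inter> crossing n A)" using mono[OF that(1)] by (intro card_mono) auto
    finally show ?thesis .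
  qed
  have weak_imp_M: "?M m" if "m_b n \<le> m" "(t, a) \<in> apexed n" "weak_M n (?T m) (t, a)" for m t a
    using copy_of_M_if_weak_M[OF T that(2,3) cut2[OF that(1)]] unfolding complex_at_def by blast
  have M_imp_not: "\<not> homologically_connected (complex_at n ts m)" if "?M m" for m
    using not_homology_1_if_copy_of_M[OF T] that unfolding complex_at_def homologically_connected_def by blast
  have M_weak: "\<exists>c\<in>apexed n. weak_M n (?T m) c" if "?M m" for m
    using weak_M_if_copy_of_M[OF T[of m]] that unfolding complex_at_def by blast
  \<comment> \<open>A copy seen at time \<open>k\<close> had an empty wing when its triple arrived;
    by \<open>born\<close> that arrival precedes \<open>m1\<close>, so the copy is there at every
    time from \<open>m1\<close> to \<open>k\<close>.\<close>
  have persist: "weak_M n (?T m) (t, a)"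
    if ta: "(t, a) \<in> apexed n" "weak_M n (?T k) (t, a)" and m: "m1 \<le> m" "m \<le> k" for m k t a
  proof -
    have t: "t \<in> ?T k" "wing n a t \<inter> ?T k = {}" using ta(2) by (auto simp: weak_M_def)
    then obtain s where s: "s < k" "s < length ts" "ts ! s = t" by (auto simp: mem_take_iff_position)
    have "wing n a t \<inter> ?T s = {}" using t(2) mono[of s k] s(1) by auto
    have "s < m1"
    proof (rule ccontr)
      assume "\<not> s < m1"
      then have "\<exists>s. m1 \<le> s \<and> s < length ts \<and> ts ! s = t \<and> wing n a t \<inter> ?T s = {}"
        using s(2,3) \<open>wing n a t \<inter> ?T s = {}\<close> by (intro exI[of _ s]) simp
      then have "\<exists>(t, a)\<in>apexed n. \<exists>s. m1 \<le> s \<and> s < length ts \<and> ts ! s = t \<and> wing n a t \<inter> ?T s = {}"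
        using ta(1) by (intro bexI[where x = "(t, a)"]) (simp_all only: prod.case)
      with born show False by (rule notE)
    qed
    then have "t \<in> ?T m" using s m unfolding mem_take_iff_position by (intro exI[of _ s]) auto
    then show ?thesis using t(2) mono[OF m(2)] unfolding weak_M_def by blast
  qed
  have noM: "\<not> ?M k" if "m2 \<le> k" for k
  proof
    assume "?M k"
    from M_weak[OF this] obtain t a where ta: "(t, a) \<in> apexed n" "weak_M n (?T k) (t, a)" by auto
    have "weak_M n (?T m2) (t, a)" by (rule persist[OF ta order(4) that])
    then show False using none ta(1) by blast
  qed
  have \<tau>_eq: "\<tau> = (LEAST m. \<forall>k\<ge>m. \<not> ?M k)" unfolding \<tau>_def last_M_disappears_def ..
  have after: "\<forall>k\<ge>\<tau>. \<not> ?M k"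
    unfolding \<tau>_eq by (rule LeastI[of "\<lambda>m. \<forall>k\<ge>m. \<not> ?M k" m2]) (use noM in blast)
  have "\<tau> \<le> m2" unfolding \<tau>_eq by (rule Least_le) (use noM in blast)
  have mid: "?M m" if "m_b n \<le> m" "m \<le> m1" for m
  proof (cases "m \<le> m_c n")
    case True
    obtain t a where ta: "(t, a) \<in> apexed n" "t \<in> ?T (m_b n)" "wing n a t \<inter> ?T (m_c n) = {}" using surv1 by blast
    have "weak_M n (?T m) (t, a)" by (rule weak_M_between[OF ta(2,3) mono[OF that(1)] mono[OF True]])
    then show ?thesis by (rule weak_imp_M[OF that(1) ta(1)])
  next
    case False
    obtain t a where ta: "(t, a) \<in> apexed n" "t \<in> ?T (m_c n)" "wing n a t \<inter> ?T m1 = {}" using surv2 by blast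
    have "weak_M n (?T m) (t, a)"
      using weak_M_between[OF ta(2,3) mono mono] False that(2) by simp
    then show ?thesis by (rule weak_imp_M[OF that(1) ta(1)])
  qed
  have "?M m1" by (rule mid) (use order in linarith)+
  then have "m1 < \<tau>" using after by (meson not_less)
  have before: "\<not> homologically_connected (complex_at n ts m)" if m: "m < \<tau>" for m
  proof -
    consider "m \<le> m_b n" | "m_b n \<le> m" "m \<le> m1" | "m1 \<le> m" by linarith
    then show ?thesis
    proof cases
      case 1
      then show ?thesis by (rule complex_at_not_connected[OF assms(2-6) isolated overlaps])
    next
      case 2
      then show ?thesis using mid M_imp_not by blast
    next
      case 3
      \<comment> \<open>Minimality of \<tau> provides a copy at some time
        \<open>k \<ge> \<tau> - 1 \<ge> m\<close>. Persistence carries its weak form back to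
        \<open>m\<close>, and the cuts at \<open>m\<close> restore the path.\<close>
      have "\<tau> - 1 < (LEAST m. \<forall>k\<ge>m. \<not> ?M k)" unfolding \<tau>_eq[symmetric] using m by linarith
      from not_less_Least[OF this] have "\<not> (\<forall>k\<ge>\<tau> - 1. \<not> ?M k)" .
      then obtain k where k: "\<tau> - 1 \<le> k" "?M k" by blast
      then have "m \<le> k" using m by linarith
      obtain t a where ta: "(t, a) \<in> apexed n" "weak_M n (?T k) (t, a)" using M_weak[OF k(2)] by auto
      have "weak_M n (?T m) (t, a)" by (rule persist[OF ta 3 \<open>m \<le> k\<close>])
      moreover have "m_b n \<le> m" using order 3 by linarith
      ultimately show ?thesis by (intro M_imp_not weak_imp_M[OF _ ta(1)])
    qed
  qed
  have "homologically_connected (complex_at n ts m)" if m: "\<tau> \<le> m" for m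
  proof -
    have mb: "m_b n \<le> m" "m_e n \<le> m" using m \<open>m1 < \<tau>\<close> order by linarith+
    have "trivial_group (reduced_homology_F2 (complex_of_triples n (?T m)) 0)"
    proof (rule homology_0_if_crossing[OF T])
      fix A assume "A \<subseteq> {1..n}" "A \<noteq> {}" "A \<noteq> {1..n}"
      then have "2 \<le> card (?T m \<inter> crossing n A)" by (rule cut2[OF mb(1)])
      then show "?T m \<inter> crossing n A \<noteq> {}" by auto
    qed
    moreover have "trivial_group (reduced_homology_F2 (complex_of_triples n (?T m)) 1)"
    proof (rule ccontr)
      assume nontriv: "\<not> ?thesis"
      have "\<nexists>a b c. copy_of_M (complex_of_triples n (?T m)) a b c"
        using after m unfolding complex_at_def by blast
      from obstruction_if_no_M[OF T nontriv this] show False using obst mb(2) by blast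
    qed
    ultimately show ?thesis by (simp add: homologically_connected_def complex_at_def)
  qed
  then show ?thesis using \<open>m1 < \<tau>\<close> \<open>\<tau> \<le> m2\<close> before by blast
qed

context slow_window
begin

text \<open>The sets \<open>B1\<close> to \<open>B8\<close> are the negations of the eight random
  hypotheses of \<open>good_process\<close>; their probabilities add up to o(1).\<close>

lemma hitting_time:
  "(\<lambda>n. Pr n {ts. m_lo \<omega> n < last_M_disappears n ts \<and> last_M_disappears n ts \<le> m_hi \<omega> n \<and>
      (\<forall>m<last_M_disappears n ts. \<not> homologically_connected (complex_at n ts m)) \<and>
      (\<forall>m\<ge>last_M_disappears n ts. homologically_connected (complex_at n ts m))}) \<longlonglongrightarrow> 1"
  (is "(\<lambda>n. Pr n (?D n)) \<longlonglongrightarrow> 1")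
proof -
  define B1 where "B1 n = {ts. \<forall>v\<in>{1..n}. \<exists>t\<in>set (take n ts). v \<in> t}" for n
  define B2 where "B2 n = {ts :: nat set list. n \<le> card {(t, u). t \<in> set (take (m_b n) ts) \<and> u \<in> set (take (m_b n) ts) \<and> card (t \<inter> u) = 2}}" for n
  define B3 where "B3 n = {ts. \<exists>A. A \<subseteq> {1..n} \<and> A \<noteq> {} \<and> A \<noteq> {1..n} \<and> card (set (take (m_b n) ts) \<inter> crossing n A) < 2}" for n
  define B4 where "B4 n = {ts. \<not> (\<exists>(t, a)\<in>apexed n. t \<in> set (take (m_b n) ts) \<and> wing n a t \<inter> set (take (m_c n) ts) = {})}" for n
  define B5 where "B5 n = {ts. \<not> (\<exists>(t, a)\<in>apexed n. t \<in> set (take (m_c n) ts) \<and> wing n a t \<inter> set (take (m_lo \<omega> n) ts) = {})}" for n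
  define B6 where "B6 n = {ts. \<exists>(t, a)\<in>apexed n. \<exists>s. m_lo \<omega> n \<le> s \<and> s < length ts \<and> ts ! s = t \<and> wing n a t \<inter> set (take s ts) = {}}" for n
  define B7 where "B7 n = {ts. \<exists>m\<ge>m_e n. \<exists>k\<ge>3. \<exists>e\<in>pairs n. \<exists>(S, A)\<in>pair_trees n e k. obstruction n (set (take m ts)) k S A}" for n
  define B8 where "B8 n = {ts. \<exists>c\<in>apexed n. weak_M n (set (take (m_hi \<omega> n) ts)) c}" for n
  have lims: "(\<lambda>n. Pr n (B1 n)) \<longlonglongrightarrow> 0" "(\<lambda>n. Pr n (B2 n)) \<longlonglongrightarrow> 0" "(\<lambda>n. Pr n (B3 n)) \<longlonglongrightarrow> 0"
    "(\<lambda>n. Pr n (B4 n)) \<longlonglongrightarrow> 0" "(\<lambda>n. Pr n (B5 n)) \<longlonglongrightarrow> 0" "(\<lambda>n. Pr n (B6 n)) \<longlonglongrightarrow> 0"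
    "(\<lambda>n. Pr n (B7 n)) \<longlonglongrightarrow> 0" "(\<lambda>n. Pr n (B8 n)) \<longlonglongrightarrow> 0"
    unfolding B1_def B2_def B3_def B4_def B5_def B6_def B7_def B8_def
    by (fact no_isolated_tendsto_0 overlaps_tendsto_0 bad_cut_tendsto_0 early_survivor_tendsto_0
        late_survivor_tendsto_0 born_tendsto_0 obstruction_tendsto_0 weak_M_at_hi_tendsto_0)+
  define s where "s n = Pr n (B1 n) + (Pr n (B2 n) + (Pr n (B3 n) + (Pr n (B4 n) + (Pr n (B5 n) +
    (Pr n (B6 n) + (Pr n (B7 n) + Pr n (B8 n)))))))" for n
  have "s \<longlonglongrightarrow> 0 + (0 + (0 + (0 + (0 + (0 + (0 + 0))))))"
    unfolding s_def by (intro tendsto_add lims)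
  then have lim: "(\<lambda>n. 1 - s n) \<longlonglongrightarrow> 1" using tendsto_diff[OF tendsto_const[of 1], of s 0] by simp
  have ev: "\<forall>\<^sub>F n::nat in sequentially. real n * (ln (real n))\<^sup>2 + 1 \<le> real n * (real n - 1) * (real n - 2) / 6"
    "\<forall>\<^sub>F n::nat in sequentially. real n * (ln (real n))\<^sup>2 + 1 \<le> (real n)\<^sup>2 * ln (real n) / 12"
    "\<forall>\<^sub>F n::nat in sequentially. (real n)\<^sup>2 * ln (real n) / 12 + 1 \<le> (real n)\<^sup>2 * ln (real n) / 6"
    by real_asymp+
  have "\<forall>\<^sub>F n in sequentially. 1 - s n \<le> Pr n (?D n)"
    using ev m_lo_ge omega_nonneg eventually_ge_at_top[of "2::nat"]
  proof eventually_elim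
    case (elim n)
    let ?B = "B1 n \<union> (B2 n \<union> (B3 n \<union> (B4 n \<union> (B5 n \<union> (B6 n \<union> (B7 n \<union> B8 n))))))"
    have mb: "m_b n \<le> n choose 3"
    proof -
      have "real (m_b n) \<le> real (n choose 3)" using m_b_bounds(2)[of n] elim(1) by (simp add: real_choose_3)
      then show ?thesis by simp
    qed
    have bc: "m_b n \<le> m_c n" "m_c n \<le> m_e n"
      using m_b_bounds(2)[of n] m_c_bounds[of n] m_e_bounds(1)[of n] elim(2,3) by linarith+
    have ce: "m_c n \<le> m_lo \<omega> n" using bc(2) elim(4) by simp
    have lohi: "m_lo \<omega> n \<le> m_hi \<omega> n"
      unfolding m_lo_def m_hi_def using elim(5) by (intro nat_mono floor_mono mult_left_mono) auto
    have "1 - Pr n (?D n) = Pr n (UNIV - ?D n)"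
      using measure_pmf.prob_compl[of "?D n" "full_process n"] by simp
    also have "\<dots> \<le> Pr n ?B"
    proof (rule Pr_mono_on_process)
      fix ts :: "nat set list"
      assume ts: "length ts = n choose 3" "distinct ts" "set ts = triples n" "ts \<in> UNIV - ?D n"
      show "ts \<in> ?B"
      proof (rule ccontr)
        assume "ts \<notin> ?B"
        then have nB: "ts \<notin> B1 n" "ts \<notin> B2 n" "ts \<notin> B3 n" "ts \<notin> B4 n" "ts \<notin> B5 n" "ts \<notin> B6 n" "ts \<notin> B7 n" "ts \<notin> B8 n"
          by auto
        have "ts \<in> ?D n"
          unfolding mem_Collect_eq
          by (rule good_process[OF elim(6) ts(1-3) mb bc(1) ce elim(4) lohi
              nB(1)[unfolded B1_def mem_Collect_eq] nB(2)[unfolded B2_def mem_Collect_eq not_le]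
              nB(3)[unfolded B3_def mem_Collect_eq] nB(4)[unfolded B4_def mem_Collect_eq not_not]
              nB(5)[unfolded B5_def mem_Collect_eq not_not] nB(6)[unfolded B6_def mem_Collect_eq]
              nB(7)[unfolded B7_def mem_Collect_eq] nB(8)[unfolded B8_def mem_Collect_eq]])
        then show False using ts(4) by blast
      qed
    qed
    also have "\<dots> \<le> s n"
      unfolding s_def by (intro order_trans[OF measure_subadditive] add_left_mono) simp_all
    finally show ?case by linarith
  qed
  then show ?thesis
    by (rule tendsto_sandwich[OF _ _ lim tendsto_const[of 1]]) simp
qed

end

text \<open>The hitting-time statement itself does not mention \<omega>, so one admissible window is
  enough for it.\<close>

lemma slow_window_loglog: "slow_window (\<lambda>n. ln (ln (real n)) / 4)"
proof
  show "filterlim (\<lambda>n::nat. ln (ln (real n)) / 4) at_top sequentially" by real_asymp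
qed simp

lemma Pr_tendsto_1_mono:
  assumes "(\<lambda>n. Pr n (S n)) \<longlonglongrightarrow> 1" "\<forall>\<^sub>F n in sequentially. S n \<subseteq> S' n"
  shows "(\<lambda>n. Pr n (S' n)) \<longlonglongrightarrow> 1"
proof (rule tendsto_sandwich[OF _ _ assms(1) tendsto_const[of 1]])
  show "\<forall>\<^sub>F n in sequentially. Pr n (S n) \<le> Pr n (S' n)"
    using assms(2) by eventually_elim (auto intro!: measure_pmf.finite_measure_mono)
qed simp

theorem theorem1p2:
  shows "(\<lambda>n. measure_pmf.prob (full_process n)
            {ts. (\<forall>m < last_M_disappears n ts. \<not> homologically_connected (complex_at n ts m)) \<and>
                 (\<forall>m \<in> {last_M_disappears n ts..n choose 3}.
                    homologically_connected (complex_at n ts m))})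
           \<longlonglongrightarrow> 1 \<and>
         (\<forall>\<omega> :: nat \<Rightarrow> real. filterlim \<omega> at_top sequentially \<longrightarrow>
            (\<lambda>n. measure_pmf.prob (full_process n)
               {ts. \<bar>6 * real (last_M_disappears n ts) / (real n)\<^sup>2
                      - ln (real n) - 1 / 2 * ln (ln (real n))\<bar> \<le> \<omega> n})
              \<longlonglongrightarrow> 1)"
proof (intro conjI allI impI)
  show "(\<lambda>n. Pr n {ts. (\<forall>m < last_M_disappears n ts. \<not> homologically_connected (complex_at n ts m)) \<and>
      (\<forall>m \<in> {last_M_disappears n ts..n choose 3}. homologically_connected (complex_at n ts m))}) \<longlonglongrightarrow> 1"
    by (rule Pr_tendsto_1_mono[OF slow_window.hitting_time[OF slow_window_loglog]]) (rule always_eventually, auto)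
next
  fix \<omega> :: "nat \<Rightarrow> real" assume \<omega>: "filterlim \<omega> at_top sequentially"
  \<comment> \<open>An arbitrary \<omega> is cut down to an admissible one; the narrower window
    implies the wider one.\<close>
  define \<omega>' where "\<omega>' n = min (\<omega> n) (ln (ln (real n)) / 4)" for n
  have ll: "filterlim (\<lambda>n::nat. ln (ln (real n)) / 4) at_top sequentially" by real_asymp
  interpret slow_window \<omega>'
  proof
    show "filterlim \<omega>' at_top sequentially"
      unfolding filterlim_at_top
    proof
      fix Z :: real
      have "\<forall>\<^sub>F n in sequentially. Z \<le> \<omega> n" "\<forall>\<^sub>F n in sequentially. Z \<le> ln (ln (real n)) / 4"
        using \<omega> ll by (simp_all only: filterlim_at_top)
      then show "\<forall>\<^sub>F n in sequentially. Z \<le> \<omega>' n" by eventually_elim (simp add: \<omega>'_def)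
    qed
    show "\<forall>\<^sub>F n in sequentially. \<omega>' n \<le> ln (ln (real n)) / 4"
      by (rule always_eventually) (simp only: \<omega>'_def min.cobounded2 simp_thms)
  qed
  show "(\<lambda>n. Pr n {ts. \<bar>6 * real (last_M_disappears n ts) / (real n)\<^sup>2 - ln (real n) - 1 / 2 * ln (ln (real n))\<bar> \<le> \<omega> n})
      \<longlonglongrightarrow> 1"
  proof (rule Pr_tendsto_1_mono[OF hitting_time])
    show "\<forall>\<^sub>F n in sequentially. {ts. m_lo \<omega>' n < last_M_disappears n ts \<and> last_M_disappears n ts \<le> m_hi \<omega>' n \<and>
      (\<forall>m<last_M_disappears n ts. \<not> homologically_connected (complex_at n ts m)) \<and>
      (\<forall>m\<ge>last_M_disappears n ts. homologically_connected (complex_at n ts m))} \<subseteq>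
      {ts. \<bar>6 * real (last_M_disappears n ts) / (real n)\<^sup>2 - ln (real n) - 1 / 2 * ln (ln (real n))\<bar> \<le> \<omega> n}"
      using m_lo_bounds m_hi_bounds eventually_ge_at_top[of "1::nat"]
    proof eventually_elim
      case (elim n)
      show ?case
      proof clarify
        fix ts assume \<tau>: "m_lo \<omega>' n < last_M_disappears n ts" "last_M_disappears n ts \<le> m_hi \<omega>' n"
        let ?\<tau> = "real (last_M_disappears n ts)"
        have n2: "0 < (real n)\<^sup>2" using elim(3) by simp
        have "(real n)\<^sup>2 / 6 * (crit n - \<omega>' n) \<le> ?\<tau>" "?\<tau> \<le> (real n)\<^sup>2 / 6 * (crit n + \<omega>' n)"
          using elim(1,2) \<tau> by linarith+
        then have "crit n - \<omega>' n \<le> 6 * ?\<tau> / (real n)\<^sup>2" "6 * ?\<tau> / (real n)\<^sup>2 \<le> crit n + \<omega>' n"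
          using n2 by (simp_all add: pos_le_divide_eq pos_divide_le_eq mult.commute)
        moreover have "\<omega>' n \<le> \<omega> n" by (simp add: \<omega>'_def)
        ultimately show "\<bar>6 * ?\<tau> / (real n)\<^sup>2 - ln (real n) - 1 / 2 * ln (ln (real n))\<bar> \<le> \<omega> n"
          unfolding crit_def by linarith
      qed
    qed
  qed
qed

end
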